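(* Let $H$ be an infinite countable group, $\Sigma<H$ a subgroup and $\theta:\Sigma\to H$ an injective group homomorphism. Let $\Gamma=\mathrm{HNN}(H,\Sigma,\theta)=\langle H,t\mid \theta(\sigma)=t\sigma t^{-1}\ \forall\sigma\in\Sigma\rangle$. Suppose that both $\Sigma$ and $\theta(\Sigma)$ are highly core-free in $H$. Then $\Gamma$ admits a highly transitive and faithful action on an infinite countable set. Moreover, if $H$ is amenable and $\Sigma$ is finite, this action can be chosen to be amenable (that is, there is then an action of $\Gamma$ on an infinite countable set which is simultaneously highly transitive, faithful and amenable).
   Context: For a subgroup $\Sigma<H$ and $S\subset H$, put $\mathrm{Core}_S(\Sigma)=\bigcap_{h\in S}h^{-1}\Sigma h$. A subgroup $\Sigma<H$ is highly core-free if, for every finite subset $F\subset H$, every $n\geq 1$ and all non-empty subsets $S_1,\dots,S_n\subset H$ with $H\setminus\Sigma F\subset\bigcup_{k=1}^n S_k$, there exists $1\leq k\leq n$ such that $\mathrm{Core}_{S_k}(\Sigma)=\{1\}$. An action of a countable group $\Gamma$ on an infinite countable set $X$ is highly transitive if for all $n\geq 1$, for any pairwise distinct $x_1,\dots,x_n\in X$ and any pairwise distinct $y_1,\dots,y_n\in X$ there is $g\in\Gamma$ with $gx_k=y_k$ for all $k$. An action is faithful if only $1\in\Gamma$ acts as the identity. An action $\Gamma\curvearrowright X$ is amenable if there is a $\Gamma$-invariant finitely additive probability measure on all subsets of $X$ (for countable $\Gamma$: equivalently a Følner sequence of finite non-empty subsets $C_n\subset X$ with $|gC_n\triangle C_n|/|C_n|\to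 0$ for all $g\in\Gamma$). *)

theory Defs
  imports Complex_Main "HOL-Algebra.Group_Action" "HOL-Library.Countable_Set"
begin

section \<open>Highly core-free subgroups\<close>

text \<open>The intersection with the carrier only matters for empty \<^term>\<open>S\<close>, where the core is the
  whole group.\<close>

definition Core :: "('a, 'b) monoid_scheme \<Rightarrow> 'a set \<Rightarrow> 'a set \<Rightarrow> 'a set" where
  "Core G S K = carrier G \<inter> (\<Inter>h\<in>S. (inv\<^bsub>G\<^esub> h <#\<^bsub>G\<^esub> K) #>\<^bsub>G\<^esub> h)"

definition highly_core_free :: "('a, 'b) monoid_scheme \<Rightarrow> 'a set \<Rightarrow> bool" where
  "highly_core_free G K \<longleftrightarrow>
     (\<forall>F (n::nat) S.
        finite F \<longrightarrow> F \<subseteq> carrier G \<longrightarrow> n \<ge> 1 \<longrightarrow>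
        (\<forall>k\<in>{1..n}. S k \<noteq> {} \<and> S k \<subseteq> carrier G) \<longrightarrow>
        carrier G - (K <#>\<^bsub>G\<^esub> F) \<subseteq> (\<Union>k\<in>{1..n}. S k) \<longrightarrow>
        (\<exists>k\<in>{1..n}. Core G (S k) K = {\<one>\<^bsub>G\<^esub>}))"


section \<open>Properties of actions\<close>

definition highly_transitive ::
    "('a, 'b) monoid_scheme \<Rightarrow> 'x set \<Rightarrow> ('a \<Rightarrow> 'x \<Rightarrow> 'x) \<Rightarrow> bool" where
  "highly_transitive G E \<phi> \<longleftrightarrow>
     (\<forall>(n::nat) x y. n \<ge> 1 \<longrightarrow>
        (\<forall>k\<in>{1..n}. x k \<in> E \<and> y k \<in> E) \<longrightarrow> inj_on x {1..n} \<longrightarrow> inj_on y {1..n} \<longrightarrow>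
        (\<exists>g\<in>carrier G. \<forall>k\<in>{1..n}. \<phi> g (x k) = y k))"

definition fin_add_prob :: "'x set \<Rightarrow> ('x set \<Rightarrow> real) \<Rightarrow> bool" where
  "fin_add_prob E \<mu> \<longleftrightarrow>
     (\<forall>A. A \<subseteq> E \<longrightarrow> \<mu> A \<ge> 0) \<and> \<mu> E = 1 \<and>
     (\<forall>A B. A \<subseteq> E \<longrightarrow> B \<subseteq> E \<longrightarrow> A \<inter> B = {} \<longrightarrow> \<mu> (A \<union> B) = \<mu> A + \<mu> B)"

definition amenable_action ::
    "('a, 'b) monoid_scheme \<Rightarrow> 'x set \<Rightarrow> ('a \<Rightarrow> 'x \<Rightarrow> 'x) \<Rightarrow> bool" where
  "amenable_action G E \<phi> \<longleftrightarrow>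
     (\<exists>\<mu>. fin_add_prob E \<mu> \<and> (\<forall>g\<in>carrier G. \<forall>A. A \<subseteq> E \<longrightarrow> \<mu> (\<phi> g ` A) = \<mu> A))"

definition amenable_group :: "('a, 'b) monoid_scheme \<Rightarrow> bool" where
  "amenable_group G \<longleftrightarrow>
     amenable_action G (carrier G) (\<lambda>g. \<lambda>x\<in>carrier G. g \<otimes>\<^bsub>G\<^esub> x)"

text \<open>The locale \<^locale>\<open>faithful_action\<close> asks for injectivity; this is the same as only the
  neutral element acting as the identity.\<close>

lemma faithful_action_iff:
  "faithful_action G E \<phi> \<longleftrightarrow>
     group_action G E \<phi> \<and> (\<forall>g\<in>carrier G. (\<forall>x\<in>E. \<phi> g x = x) \<longrightarrow> g = \<one>\<^bsub>G\<^esub>)"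
proof -
  have "inj_on \<phi> (carrier G) \<longleftrightarrow> (\<forall>g\<in>carrier G. (\<forall>x\<in>E. \<phi> g x = x) \<longrightarrow> g = \<one>\<^bsub>G\<^esub>)"
    if ga: "group_action G E \<phi>"
  proof -
    interpret group_hom G "BijGroup E" \<phi>
      using ga by (simp add: group_action_def)
    have "\<phi> g = \<one>\<^bsub>BijGroup E\<^esub> \<longleftrightarrow> (\<forall>x\<in>E. \<phi> g x = x)" if "g \<in> carrier G" for g
    proof -
      have "\<phi> g \<in> extensional E"
        using hom_closed[OF that] by (simp add: BijGroup_def Bij_def)
      then show ?thesis
        by (auto simp: BijGroup_def extensional_def fun_eq_iff)
    qed
    then show ?thesis
      by (auto simp: inj_on_one_iff)
  qed
  then show ?thesis
    by (auto simp: faithful_action_def faithful_action_axioms_def)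
qed


section \<open>HNN extensions\<close>

text \<open>The presentation \<open>\<langle>H, t | \<theta>(\<sigma>) = t \<sigma> t\<inverse>\<rangle>\<close> is realised as words over \<open>H \<union> {t, t\<inverse>}\<close> modulo the
  congruence generated by the multiplication table of \<open>H\<close>, the cancellation of \<open>t\<close> with \<open>t\<inverse>\<close>, and
  the HNN relations. Since every letter has an inverse letter, this monoid presentation is the
  group presentation; see \<open>group_HNN\<close> and \<open>HNN_universal\<close> below.\<close>

datatype 'a hnn_letter = Base 'a | Stable | StableInv

definition hnn_words :: "('a, 'b) monoid_scheme \<Rightarrow> 'a hnn_letter list set" where
  "hnn_words H = lists (Base ` carrier H \<union> {Stable, StableInv})"

inductive hnn_eq ::
    "('a, 'b) monoid_scheme \<Rightarrow> 'a set \<Rightarrow> ('a \<Rightarrow> 'a) \<Rightarrow> 'a hnn_letter list \<Rightarrow> 'a hnn_letter list \<Rightarrow> bool"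
  for H and K and \<theta> where
  refl: "w \<in> hnn_words H \<Longrightarrow> hnn_eq H K \<theta> w w"
| sym: "hnn_eq H K \<theta> u v \<Longrightarrow> hnn_eq H K \<theta> v u"
| trans: "hnn_eq H K \<theta> u v \<Longrightarrow> hnn_eq H K \<theta> v w \<Longrightarrow> hnn_eq H K \<theta> u w"
| append: "hnn_eq H K \<theta> u u' \<Longrightarrow> hnn_eq H K \<theta> v v' \<Longrightarrow> hnn_eq H K \<theta> (u @ v) (u' @ v')"
| base_one: "hnn_eq H K \<theta> [Base \<one>\<^bsub>H\<^esub>] []"
| base_mult: "g \<in> carrier H \<Longrightarrow> h \<in> carrier H \<Longrightarrow>
    hnn_eq H K \<theta> [Base g, Base h] [Base (g \<otimes>\<^bsub>H\<^esub> h)]"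
| stable_right: "hnn_eq H K \<theta> [Stable, StableInv] []"
| stable_left: "hnn_eq H K \<theta> [StableInv, Stable] []"
| conj: "\<sigma> \<in> K \<Longrightarrow> hnn_eq H K \<theta> [Stable, Base \<sigma>, StableInv] [Base (\<theta> \<sigma>)]"

definition hnn_rel ::
    "('a, 'b) monoid_scheme \<Rightarrow> 'a set \<Rightarrow> ('a \<Rightarrow> 'a) \<Rightarrow> ('a hnn_letter list \<times> 'a hnn_letter list) set" where
  "hnn_rel H K \<theta> = {(u, v). hnn_eq H K \<theta> u v}"

definition hnn_class ::
    "('a, 'b) monoid_scheme \<Rightarrow> 'a set \<Rightarrow> ('a \<Rightarrow> 'a) \<Rightarrow> 'a hnn_letter list \<Rightarrow> 'a hnn_letter list set" where
  "hnn_class H K \<theta> w = hnn_rel H K \<theta> `` {w}"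

definition HNN ::
    "('a, 'b) monoid_scheme \<Rightarrow> 'a set \<Rightarrow> ('a \<Rightarrow> 'a) \<Rightarrow> 'a hnn_letter list set monoid" where
  "HNN H K \<theta> =
     \<lparr>carrier = hnn_words H // hnn_rel H K \<theta>,
      mult = (\<lambda>A B. \<Union>u\<in>A. \<Union>v\<in>B. hnn_class H K \<theta> (u @ v)),
      one = hnn_class H K \<theta> []\<rparr>"

locale hnn_data =
  fixes H :: "('a, 'b) monoid_scheme" (structure) and K :: "'a set" and \<theta> :: "'a \<Rightarrow> 'a"
  assumes group_H: "group H"
    and subgroup_K: "subgroup K H"
    and theta_hom: "\<theta> \<in> hom (H\<lparr>carrier := K\<rparr>) H"
begin

interpretation H: group H by (rule group_H)

abbreviation cls where "cls \<equiv> hnn_class H K \<theta>"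
abbreviation \<Gamma> where "\<Gamma> \<equiv> HNN H K \<theta>"

lemma words_simps [simp]:
  "[] \<in> hnn_words H"
  "Base g # w \<in> hnn_words H \<longleftrightarrow> g \<in> carrier H \<and> w \<in> hnn_words H"
  "Stable # w \<in> hnn_words H \<longleftrightarrow> w \<in> hnn_words H"
  "StableInv # w \<in> hnn_words H \<longleftrightarrow> w \<in> hnn_words H"
  "u @ v \<in> hnn_words H \<longleftrightarrow> u \<in> hnn_words H \<and> v \<in> hnn_words H"
  by (auto simp: hnn_words_def)

lemma K_carrier: "\<sigma> \<in> K \<Longrightarrow> \<sigma> \<in> carrier H"
  using subgroup.subset[OF subgroup_K] by auto

lemma theta_carrier: "\<sigma> \<in> K \<Longrightarrow> \<theta> \<sigma> \<in> carrier H"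
  using theta_hom by (auto simp: hom_def)

lemma hnn_eq_words: "hnn_eq H K \<theta> u v \<Longrightarrow> u \<in> hnn_words H \<and> v \<in> hnn_words H"
  by (induction rule: hnn_eq.induct) (auto simp: K_carrier theta_carrier)

lemma equiv_hnn_rel: "equiv (hnn_words H) (hnn_rel H K \<theta>)"
proof (rule equivI)
  show "refl_on (hnn_words H) (hnn_rel H K \<theta>)"
    using hnn_eq.refl hnn_eq_words by (fastforce simp: hnn_rel_def refl_on_def)
  show "sym (hnn_rel H K \<theta>)"
    unfolding sym_def hnn_rel_def using hnn_eq.sym by blast
  show "trans (hnn_rel H K \<theta>)"
    unfolding trans_def hnn_rel_def using hnn_eq.trans by blast
  show "hnn_rel H K \<theta> \<subseteq> hnn_words H \<times> hnn_words H"
    unfolding hnn_rel_def using hnn_eq_words by blast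
qed

lemma cls_eq_iff:
  "u \<in> hnn_words H \<Longrightarrow> v \<in> hnn_words H \<Longrightarrow> cls u = cls v \<longleftrightarrow> hnn_eq H K \<theta> u v"
  using eq_equiv_class_iff[OF equiv_hnn_rel] by (simp add: hnn_class_def hnn_rel_def)

lemma cls_eqI: "hnn_eq H K \<theta> u v \<Longrightarrow> cls u = cls v"
  using cls_eq_iff hnn_eq_words by blast

lemma carrier_HNN: "carrier \<Gamma> = cls ` hnn_words H"
  by (auto simp: HNN_def quotient_def hnn_class_def)

lemma mem_cls_iff: "u \<in> cls w \<longleftrightarrow> hnn_eq H K \<theta> w u"
  by (simp add: hnn_class_def hnn_rel_def)

lemma mult_HNN:
  assumes "u \<in> hnn_words H" "v \<in> hnn_words H"
  shows "cls u \<otimes>\<^bsub>\<Gamma>\<^esub> cls v = cls (u @ v)"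
proof -
  have "cls (a @ b) = cls (u @ v)" if "a \<in> cls u" "b \<in> cls v" for a b
    using that by (simp add: mem_cls_iff cls_eqI hnn_eq.append hnn_eq.sym)
  then have "cls u \<otimes>\<^bsub>\<Gamma>\<^esub> cls v = (\<Union>a\<in>cls u. \<Union>b\<in>cls v. cls (u @ v))"
    by (simp add: HNN_def cong: SUP_cong_simp)
  moreover have "u \<in> cls u" "v \<in> cls v"
    using assms by (simp_all add: mem_cls_iff hnn_eq.refl)
  ultimately show ?thesis
    by blast
qed

lemma one_HNN: "\<one>\<^bsub>\<Gamma>\<^esub> = cls []"
  by (simp add: HNN_def)

fun inv_letter where
  "inv_letter (Base g) = Base (inv g)"
| "inv_letter Stable = StableInv"
| "inv_letter StableInv = Stable"

lemma inv_letter_eq: "[x] \<in> hnn_words H \<Longrightarrow> hnn_eq H K \<theta> [inv_letter x, x] []"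
proof (cases x)
  case (Base g)
  assume "[x] \<in> hnn_words H"
  then have g: "g \<in> carrier H"
    using Base by simp
  then have "hnn_eq H K \<theta> [Base (inv g), Base g] [Base (inv g \<otimes> g)]"
    by (intro hnn_eq.base_mult H.inv_closed)
  then show ?thesis
    using Base g hnn_eq.trans[OF _ hnn_eq.base_one] by simp
qed (simp_all add: hnn_eq.stable_left hnn_eq.stable_right)

lemma left_inverse:
  "w \<in> hnn_words H \<Longrightarrow> \<exists>w'\<in>hnn_words H. hnn_eq H K \<theta> (w' @ w) []"
proof (induction w)
  case Nil
  then show ?case by (auto intro!: bexI[of _ "[]"] hnn_eq.refl)
next
  case (Cons x w)
  then have x: "[x] \<in> hnn_words H" and w: "w \<in> hnn_words H"
    by (auto simp: hnn_words_def)
  then obtain w' where w': "w' \<in> hnn_words H" "hnn_eq H K \<theta> (w' @ w) []"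
    using Cons.IH by blast
  have ix: "[inv_letter x] \<in> hnn_words H"
    using x by (cases x) auto
  have "hnn_eq H K \<theta> (w' @ [inv_letter x, x] @ w) (w' @ [] @ w)"
    using w w'(1) inv_letter_eq[OF x] by (intro hnn_eq.append hnn_eq.refl)
  then have "hnn_eq H K \<theta> ((w' @ [inv_letter x]) @ x # w) []"
    using hnn_eq.trans[OF _ w'(2)] by simp
  then show ?case
    using ix w'(1) by (intro bexI[of _ "w' @ [inv_letter x]"]) auto
qed

theorem group_HNN: "group \<Gamma>"
proof (rule groupI)
  fix x assume "x \<in> carrier \<Gamma>"
  then obtain w where "w \<in> hnn_words H" "x = cls w"
    by (auto simp: carrier_HNN)
  moreover obtain w' where "w' \<in> hnn_words H" "hnn_eq H K \<theta> (w' @ w) []"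
    using left_inverse[OF calculation(1)] by blast
  ultimately show "\<exists>y\<in>carrier \<Gamma>. y \<otimes>\<^bsub>\<Gamma>\<^esub> x = \<one>\<^bsub>\<Gamma>\<^esub>"
    by (auto simp: carrier_HNN mult_HNN one_HNN intro!: cls_eqI bexI[of _ "cls w'"])
qed (auto simp: carrier_HNN mult_HNN one_HNN)

definition base where "base g = cls [Base g]"
definition stable where "stable = cls [Stable]"

lemma base_hom: "base \<in> hom H \<Gamma>"
  by (auto simp: hom_def base_def carrier_HNN mult_HNN
      intro!: cls_eqI hnn_eq.sym[OF hnn_eq.base_mult])

lemma stable_closed: "stable \<in> carrier \<Gamma>"
  by (simp add: stable_def carrier_HNN)

lemma inv_stable: "inv\<^bsub>\<Gamma>\<^esub> stable = cls [StableInv]"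
proof -
  interpret group \<Gamma> by (rule group_HNN)
  show ?thesis
    by (rule inv_equality)
       (auto simp: stable_def carrier_HNN mult_HNN one_HNN intro!: cls_eqI hnn_eq.stable_left)
qed

lemma stable_conj: "\<sigma> \<in> K \<Longrightarrow> stable \<otimes>\<^bsub>\<Gamma>\<^esub> base \<sigma> \<otimes>\<^bsub>\<Gamma>\<^esub> inv\<^bsub>\<Gamma>\<^esub> stable = base (\<theta> \<sigma>)"
  unfolding inv_stable
  by (auto simp: stable_def base_def mult_HNN K_carrier intro!: cls_eqI hnn_eq.conj)

theorem HNN_universal:
  fixes L :: "('c, 'd) monoid_scheme"
  assumes "group L" and f: "f \<in> hom H L" and s: "s \<in> carrier L"
    and rel: "\<And>\<sigma>. \<sigma> \<in> K \<Longrightarrow> f (\<theta> \<sigma>) = s \<otimes>\<^bsub>L\<^esub> f \<sigma> \<otimes>\<^bsub>L\<^esub> inv\<^bsub>L\<^esub> s"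
  shows "\<exists>\<Phi>\<in>hom \<Gamma> L. (\<forall>g\<in>carrier H. \<Phi> (base g) = f g) \<and> \<Phi> stable = s"
    and "\<And>\<Phi> \<Psi>. \<Phi> \<in> hom \<Gamma> L \<Longrightarrow> \<Psi> \<in> hom \<Gamma> L \<Longrightarrow>
          (\<And>g. g \<in> carrier H \<Longrightarrow> \<Phi> (base g) = \<Psi> (base g)) \<Longrightarrow> \<Phi> stable = \<Psi> stable \<Longrightarrow>
          \<forall>x\<in>carrier \<Gamma>. \<Phi> x = \<Psi> x"
proof -
  interpret L: group L by fact
  interpret G: group \<Gamma> by (rule group_HNN)
  interpret f: group_hom H L f
    using f by unfold_locales
  define ev where "ev = (\<lambda>x. case x of Base g \<Rightarrow> f g | Stable \<Rightarrow> s | StableInv \<Rightarrow> inv\<^bsub>L\<^esub> s)"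
  define evs where "evs = (\<lambda>w. foldr (\<lambda>x y. ev x \<otimes>\<^bsub>L\<^esub> y) w \<one>\<^bsub>L\<^esub>)"
  have ev_closed: "[x] \<in> hnn_words H \<Longrightarrow> ev x \<in> carrier L" for x
    using s by (cases x) (auto simp: ev_def)
  have evs_Nil: "evs [] = \<one>\<^bsub>L\<^esub>" and evs_Cons: "evs (x # w) = ev x \<otimes>\<^bsub>L\<^esub> evs w" for x w
    by (auto simp: evs_def)
  have Cons_words: "x # w \<in> hnn_words H \<longleftrightarrow> [x] \<in> hnn_words H \<and> w \<in> hnn_words H" for x w
    by (auto simp: hnn_words_def)
  have evs_closed: "w \<in> hnn_words H \<Longrightarrow> evs w \<in> carrier L" for w
  proof (induction w)
    case Nil
    then show ?case by (simp add: evs_Nil)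
  next
    case (Cons x w)
    then have "[x] \<in> hnn_words H" "w \<in> hnn_words H"
      using Cons_words by blast+
    then show ?case
      using Cons.IH by (simp add: evs_Cons ev_closed)
  qed
  have evs_append: "u \<in> hnn_words H \<Longrightarrow> v \<in> hnn_words H \<Longrightarrow> evs (u @ v) = evs u \<otimes>\<^bsub>L\<^esub> evs v" for u v
  proof (induction u)
    case Nil
    then show ?case by (simp add: evs_Nil evs_closed)
  next
    case (Cons x u)
    then have "[x] \<in> hnn_words H" "u \<in> hnn_words H"
      using Cons_words by blast+
    then show ?case
      using Cons by (simp add: evs_Cons ev_closed evs_closed L.m_assoc)
  qed
  have evs_eq: "hnn_eq H K \<theta> u v \<Longrightarrow> evs u = evs v" for u v
  proof (induction rule: hnn_eq.induct)
    case (append u u' v v')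
    then show ?case using evs_append hnn_eq_words by metis
  next
    case (conj \<sigma>)
    then show ?case
      using rel[OF conj] s K_carrier theta_carrier
      by (simp add: evs_Nil evs_Cons ev_def L.m_assoc)
  qed (auto simp: evs_Nil evs_Cons ev_def s)
  define \<Phi> where "\<Phi> = (\<lambda>A. evs (SOME w. w \<in> A))"
  have \<Phi>: "\<Phi> (cls w) = evs w" if "w \<in> hnn_words H" for w
  proof -
    have "w \<in> cls w" using that by (simp add: mem_cls_iff hnn_eq.refl)
    then have "(SOME w'. w' \<in> cls w) \<in> cls w" by (rule someI)
    then show ?thesis by (simp add: \<Phi>_def mem_cls_iff evs_eq)
  qed
  have "\<Phi> \<in> hom \<Gamma> L"
    by (auto simp: hom_def carrier_HNN mult_HNN \<Phi> evs_append evs_closed)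
  moreover have "\<forall>g\<in>carrier H. \<Phi> (base g) = f g" "\<Phi> stable = s"
    using s by (auto simp: base_def stable_def \<Phi> evs_Cons evs_Nil ev_def)
  ultimately show "\<exists>\<Phi>\<in>hom \<Gamma> L. (\<forall>g\<in>carrier H. \<Phi> (base g) = f g) \<and> \<Phi> stable = s"
    by blast
  fix \<Phi> \<Psi>
  assume hom: "\<Phi> \<in> hom \<Gamma> L" "\<Psi> \<in> hom \<Gamma> L"
    and eq: "\<And>g. g \<in> carrier H \<Longrightarrow> \<Phi> (base g) = \<Psi> (base g)" "\<Phi> stable = \<Psi> stable"
  interpret P: group_hom \<Gamma> L \<Phi> using hom by unfold_locales
  interpret Q: group_hom \<Gamma> L \<Psi> using hom by unfold_locales
  have letter: "\<Phi> (cls [x]) = \<Psi> (cls [x])" if "[x] \<in> hnn_words H" for x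
  proof (cases x)
    case StableInv
    then show ?thesis
      using eq(2) P.hom_inv[OF stable_closed] Q.hom_inv[OF stable_closed] by (simp add: inv_stable)
  qed (use that eq in \<open>auto simp: base_def stable_def\<close>)
  have "\<Phi> (cls w) = \<Psi> (cls w)" if "w \<in> hnn_words H" for w
    using that
  proof (induction w)
    case Nil
    then show ?case by (simp flip: one_HNN)
  next
    case (Cons x w)
    then have x: "[x] \<in> hnn_words H" and w: "w \<in> hnn_words H"
      using Cons_words by blast+
    then have "cls (x # w) = cls [x] \<otimes>\<^bsub>\<Gamma>\<^esub> cls w"
      by (simp add: mult_HNN)
    moreover have "cls [x] \<in> carrier \<Gamma>" "cls w \<in> carrier \<Gamma>"
      using x w by (auto simp: carrier_HNN)
    ultimately show ?case
      using letter[OF x] Cons.IH[OF w] by simp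
  qed
  then show "\<forall>x\<in>carrier \<Gamma>. \<Phi> x = \<Psi> x"
    by (auto simp: carrier_HNN)
qed

end

end

(* Start from a countable set X with a free H-action. An action of the HNN extension on X extending it is
   the same as a bijection w of X with w (s x) = theta s (w x) for s in Sigma. Such a w is built by back
   and forth from partial bijections defined on finitely many new Sigma-orbits. High core-freeness of
   Sigma provides, for every finite tuple, some h in H that moves the tuple away from any given finite set
   of Sigma-orbits and into pairwise distinct Sigma-orbits; likewise for theta Sigma. So two tuples x, y
   can be linked by prescribing w (h x) = h' y, which gives high transitivity. Applied to X = H, this shows
   that H embeds in the HNN extension Gamma, so that Gamma is a free H-set.

   For faithfulness, X contains one copy of Gamma for each word u, on which finitely many Sigma-orbits of w
   are prescribed as left multiplication by t, so that u acts on that copy as on Gamma. For amenability, X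
   also contains H x Sigma with the average of the mean of H. There w is prescribed, off a null set, to be
   a measure-preserving equivariant bijection that is a piecewise translation. The null set meets each
   H-orbit in an infinite set, which is all that is needed to move points of H x Sigma to other parts of X
   by means of w. *)

theory Submission
  imports Defs "HOL-Library.Infinite_Set"
begin

section \<open>Free actions\<close>

text \<open>The partial bijection prescribed in advance may occupy infinitely many orbits, on H x
  Sigma even all but a null set, whereas core-freeness controls only finitely many. No single h need
  move a whole tuple off the prescribed part. Hence a reservoir is kept: an H-invariant set on which
  nothing is prescribed. Each use of w brings at least one more entry of the tuple into it, and two
  tuples are linked only once both lie there. So it is enough that one point at a time can leave the
  prescribed part. On a copy of Gamma, prescribing multiplication by t everywhere would leave no
  fresh orbit. Finitely many orbits suffice, because a word acting on the neutral element passes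
  only through the classes of its suffixes. The factor Sigma in H x Sigma answers another obstacle:
  fundamental domains of Sigma and theta Sigma in H have no evident matching by finitely many
  translations. The extra coordinate can store the position of a point in its orbit, and swapping
  stored and actual position is an explicit piecewise translation.\<close>

locale free_act = group G for G :: "('k, 'm) monoid_scheme" (structure) +
  fixes X :: "'x set" and a :: "'k \<Rightarrow> 'x \<Rightarrow> 'x"
  assumes act_closed [simp]: "g \<in> carrier G \<Longrightarrow> x \<in> X \<Longrightarrow> a g x \<in> X"
    and act_one [simp]: "x \<in> X \<Longrightarrow> a \<one> x = x"
    and act_mult: "g \<in> carrier G \<Longrightarrow> h \<in> carrier G \<Longrightarrow> x \<in> X \<Longrightarrow> a (g \<otimes> h) x = a g (a h x)"
    and act_free: "g \<in> carrier G \<Longrightarrow> x \<in> X \<Longrightarrow> a g x = x \<Longrightarrow> g = \<one>"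
begin

definition orb :: "'x set \<Rightarrow> 'x set" where
  "orb F = {a g x | g x. g \<in> carrier G \<and> x \<in> F}"

lemma act_inv_left: "g \<in> carrier G \<Longrightarrow> x \<in> X \<Longrightarrow> a (inv g) (a g x) = x"
  by (simp flip: act_mult)

lemma act_inv_right: "g \<in> carrier G \<Longrightarrow> x \<in> X \<Longrightarrow> a g (a (inv g) x) = x"
  by (simp flip: act_mult)

lemma act_inj: "g \<in> carrier G \<Longrightarrow> x \<in> X \<Longrightarrow> y \<in> X \<Longrightarrow> a g x = a g y \<Longrightarrow> x = y"
  by (metis act_inv_left)

lemma act_cancel:
  assumes "g \<in> carrier G" "h \<in> carrier G" "x \<in> X" "a g x = a h x"
  shows "g = h"
proof -
  have "a (inv h \<otimes> g) x = x"
    using assms by (simp add: act_mult act_inv_left)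
  then have "inv h \<otimes> g = \<one>"
    by (rule act_free[rotated 2]) (use assms in auto)
  then have "h \<otimes> (inv h \<otimes> g) = h"
    using assms by simp
  then show ?thesis
    using assms by (simp flip: m_assoc)
qed

lemma orbI: "g \<in> carrier G \<Longrightarrow> x \<in> F \<Longrightarrow> a g x \<in> orb F"
  by (auto simp: orb_def)

lemma orb_self: "x \<in> F \<Longrightarrow> F \<subseteq> X \<Longrightarrow> x \<in> orb F"
  by (metis orbI one_closed act_one subsetD)

lemma orb_Un: "orb (F \<union> F') = orb F \<union> orb F'"
  by (auto simp: orb_def)

lemma act_mem_orb_iff:
  assumes "g \<in> carrier G" "x \<in> X" "F \<subseteq> X"
  shows "a g x \<in> orb F \<longleftrightarrow> x \<in> orb F"
proof
  assume "a g x \<in> orb F"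
  then obtain h y where h: "h \<in> carrier G" "y \<in> F" "a g x = a h y"
    by (auto simp: orb_def)
  then have "x = a (inv g \<otimes> h) y"
    using assms by (metis act_inv_left act_mult inv_closed subsetD)
  then show "x \<in> orb F"
    using h assms by (auto intro: orbI)
next
  assume "x \<in> orb F"
  then obtain h y where h: "h \<in> carrier G" "y \<in> F" "x = a h y"
    by (auto simp: orb_def)
  then have "a g x = a (g \<otimes> h) y"
    using assms by (auto simp: act_mult)
  then show "a g x \<in> orb F"
    using h assms by (auto intro: orbI)
qed

text \<open>By freeness at most one group element carries a given point to a given point. This turns
  finite data in \<open>X\<close> into finite subsets of the group, to which core-freeness
  applies.\<close>

lemma finite_transporters:
  assumes "finite Z" "Z \<subseteq> X" "finite F"
  shows "finite {g \<in> carrier G. \<exists>z\<in>Z. a g z \<in> F}"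
proof -
  have "finite {g \<in> carrier G. a g z = y}" if "z \<in> Z" for z y
  proof (cases "\<exists>g\<in>carrier G. a g z = y")
    case True
    then obtain g where "g \<in> carrier G" "a g z = y" by blast
    then have "{g \<in> carrier G. a g z = y} \<subseteq> {g}"
      using that assms act_cancel by blast
    then show ?thesis
      using finite_subset by blast
  next
    case False
    then have "{g \<in> carrier G. a g z = y} = {}" by blast
    then show ?thesis by (simp only: finite.emptyI)
  qed
  moreover have "{g \<in> carrier G. \<exists>z\<in>Z. a g z \<in> F} = (\<Union>z\<in>Z. \<Union>y\<in>F. {g \<in> carrier G. a g z = y})"
    by auto
  ultimately show ?thesis
    using assms by simp
qed

text \<open>With a representative chosen in each orbit, \<open>r x\<close> is the unique element
  carrying the representative to \<open>x\<close>. It provides the position of \<open>x\<close> in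
  its orbit that \<open>flip\<close> later exchanges.\<close>

lemma exists_equivariant_map:
  "\<exists>r. (\<forall>x\<in>X. r x \<in> carrier G) \<and> (\<forall>g\<in>carrier G. \<forall>x\<in>X. r (a g x) = g \<otimes> r x)"
proof -
  \<comment> \<open>The choice depends on the orbit as a set only, so it is constant on
    orbits.\<close>
  define c where "c x = (SOME y. y \<in> orb {x})" for x
  have c: "c x \<in> orb {x}" if "x \<in> X" for x
    unfolding c_def using orb_self[of x "{x}"] that by (intro someI) auto
  have c_closed: "c x \<in> X" if "x \<in> X" for x
    using c[OF that] that by (auto simp: orb_def)
  have "orb {a g x} = orb {x}" if "g \<in> carrier G" "x \<in> X" for g x
  proof -
    have "y \<in> orb {a g x} \<longleftrightarrow> y \<in> orb {x}" for y
    proof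
      assume "y \<in> orb {a g x}"
      then obtain h where "h \<in> carrier G" "y = a h (a g x)"
        by (auto simp: orb_def)
      then have "h \<in> carrier G" "y = a (h \<otimes> g) x"
        using that by (simp_all add: act_mult)
      then show "y \<in> orb {x}"
        using that by (auto intro: orbI)
    next
      assume "y \<in> orb {x}"
      then obtain h where h: "h \<in> carrier G" "y = a h x"
        by (auto simp: orb_def)
      then have "y = a (h \<otimes> inv g) (a g x)"
        using that by (simp add: act_mult act_inv_left)
      then show "y \<in> orb {a g x}"
        using that h by (auto intro: orbI)
    qed
    then show ?thesis by blast
  qed
  then have c_eq: "c (a g x) = c x" if "g \<in> carrier G" "x \<in> X" for g x
    using that by (simp add: c_def)
  have "\<forall>x\<in>X. \<exists>g. g \<in> carrier G \<and> a g (c x) = x"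
  proof
    fix x assume x: "x \<in> X"
    then obtain h where "h \<in> carrier G" "c x = a h x"
      using c[OF x] by (auto simp: orb_def)
    then show "\<exists>g. g \<in> carrier G \<and> a g (c x) = x"
      using x act_inv_left by (intro exI[of _ "inv h"]) auto
  qed
  then obtain r where r: "\<forall>x\<in>X. r x \<in> carrier G \<and> a (r x) (c x) = x"
    by metis
  have "r (a g x) = g \<otimes> r x" if "g \<in> carrier G" "x \<in> X" for g x
  proof (rule act_cancel)
    show "c x \<in> X" using that c_closed by blast
    show "r (a g x) \<in> carrier G" "g \<otimes> r x \<in> carrier G"
      using that r by auto
    have "a (r (a g x)) (c x) = a (r (a g x)) (c (a g x))"
      using that by (simp add: c_eq)
    also have "\<dots> = a g x"
      using that r by simp
    also have "\<dots> = a (g \<otimes> r x) (c x)"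
      using that r c_closed by (simp add: act_mult)
    finally show "a (r (a g x)) (c x) = a (g \<otimes> r x) (c x)" .
  qed
  then show ?thesis
    using r by blast
qed

text \<open>Serves for the inclusion of \<open>K\<close> and for \<theta>, which yield two free
  actions of \<open>K\<close> on one set.\<close>

lemma free_act_restrict_hom:
  assumes "group L" "\<alpha> \<in> hom L G" "inj_on \<alpha> (carrier L)"
  shows "free_act L X (\<lambda>k. a (\<alpha> k))"
proof -
  interpret L: group L by fact
  interpret \<alpha>: group_hom L G \<alpha>
    using assms by unfold_locales
  show ?thesis
  proof unfold_locales
    fix g x assume "g \<in> carrier L" "x \<in> X" "a (\<alpha> g) x = x"
    then have "\<alpha> g = \<alpha> \<one>\<^bsub>L\<^esub>"
      using act_free by simp
    then show "g = \<one>\<^bsub>L\<^esub>"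
      using assms(3) \<open>g \<in> carrier L\<close> by (meson L.one_closed inj_onD)
  qed (auto simp: act_mult)
qed

end


section \<open>Separating finite sets by highly core-free subgroups\<close>

lemma (in group) mem_Core_conj:
  assumes K: "subgroup K G" and S: "S \<subseteq> carrier G" and u: "u \<in> carrier G"
    and conj: "\<And>h. h \<in> S \<Longrightarrow> h \<otimes> u \<otimes> inv h \<in> K"
  shows "u \<in> Core G S K"
proof -
  have "u \<in> (inv h <# K) #> h" if "h \<in> S" for h
  proof -
    have h: "h \<in> carrier G" using that S by blast
    have "u = (inv h \<otimes> (h \<otimes> u \<otimes> inv h)) \<otimes> h"
      using h u by (simp add: m_assoc flip: m_assoc[of "inv h" h])
    then show ?thesis
      using conj[OF that] by (auto simp: l_coset_def r_coset_def)
  qed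
  then show ?thesis
    using u by (auto simp: Core_def)
qed

lemma highly_core_freeD:
  fixes n :: nat
  assumes "highly_core_free G K" "finite F" "F \<subseteq> carrier G" "n \<ge> 1"
    and "\<forall>k\<in>{1..n}. S k \<noteq> {} \<and> S k \<subseteq> carrier G"
    and "carrier G - (K <#>\<^bsub>G\<^esub> F) \<subseteq> (\<Union>k\<in>{1..n}. S k)"
  shows "\<exists>k\<in>{1..n}. Core G (S k) K = {\<one>\<^bsub>G\<^esub>}"
  using assms(1)[unfolded highly_core_free_def, THEN spec[of _ F], THEN spec[of _ n], THEN spec[of _ S]]
    assms(2-) by simp

text \<open>If \<open>K <#> F\<close> were the whole group, the covering condition would hold for
  the single set \<open>{\<one>}\<close>, whose core is \<open>K\<close>. Then \<open>K\<close>
  would be trivial and the group would equal the finite set \<open>F\<close>.\<close>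

lemma (in group) highly_core_free_not_covered:
  assumes inf: "infinite (carrier G)" and K: "subgroup K G" and hcf: "highly_core_free G K"
    and F: "finite F" "F \<subseteq> carrier G"
  shows "\<not> carrier G \<subseteq> K <#> F"
proof
  assume "carrier G \<subseteq> K <#> F"
  then have "Core G {\<one>} K = {\<one>}"
    using highly_core_freeD[OF hcf F, of 1 "\<lambda>_. {\<one>}"] by (simp add: Diff_eq_empty_iff[THEN iffD2])
  moreover have "K \<subseteq> Core G {\<one>} K"
    using subgroup.subset[OF K] by (intro subsetI mem_Core_conj K) auto
  ultimately have "K \<subseteq> {\<one>}"
    by simp
  then have "K <#> F \<subseteq> {\<one>} <#> F"
    by (rule mono_set_mult) simp
  also have "\<dots> = F"
    using F by (auto simp: set_mult_def subset_iff)
  finally have "finite (carrier G)"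
    using \<open>carrier G \<subseteq> K <#> F\<close> F(1) finite_subset by (metis subset_trans)
  with inf show False by blast
qed

text \<open>The elements conjugating a given \<open>u\<close> into \<open>K\<close> form a set whose
  core contains \<open>u\<close>. If every \<open>h\<close> outside \<open>K <#> F\<close> failed
  for some \<open>u\<close> in \<open>U\<close>, these sets would cover the complement of
  \<open>K <#> F\<close>, so one of them would have trivial core, against
  \<open>u \<noteq> \<one>\<close>.\<close>

lemma (in group) highly_core_free_avoid_conjugates:
  assumes inf: "infinite (carrier G)" and K: "subgroup K G" and hcf: "highly_core_free G K"
    and F: "finite F" "F \<subseteq> carrier G"
    and U: "finite U" "U \<subseteq> carrier G" "\<one> \<notin> U"
  shows "\<exists>h\<in>carrier G. h \<notin> K <#> F \<and> (\<forall>u\<in>U. h \<otimes> u \<otimes> inv h \<notin> K)"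
proof (rule ccontr)
  assume contra: "\<not> ?thesis"
  define S where "S u = {h \<in> carrier G. h \<otimes> u \<otimes> inv h \<in> K}" for u
  \<comment> \<open>Core-freeness speaks of at least one set, all of them non-empty. Some set
    survives here because \<open>K <#> F\<close> is not the whole group.\<close>
  define U' where "U' = {u \<in> U. S u \<noteq> {}}"
  have cover: "carrier G - (K <#> F) \<subseteq> (\<Union>u\<in>U'. S u)"
  proof
    fix h assume h: "h \<in> carrier G - (K <#> F)"
    then obtain u where "u \<in> U" "h \<otimes> u \<otimes> inv h \<in> K"
      using contra by blast
    then show "h \<in> (\<Union>u\<in>U'. S u)"
      using h unfolding S_def U'_def by blast
  qed
  have "finite U'"
    using U by (simp add: U'_def)
  then obtain e where e: "bij_betw e {1..card U'} U'"
    using ex_bij_betw_nat_finite_1 by blast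
  have "U' \<noteq> {}"
    using cover highly_core_free_not_covered[OF inf K hcf F] by blast
  then have "card U' \<ge> 1"
    using \<open>finite U'\<close> by (simp add: Suc_le_eq card_gt_0_iff)
  moreover have "\<forall>k\<in>{1..card U'}. S (e k) \<noteq> {} \<and> S (e k) \<subseteq> carrier G"
    using bij_betw_apply[OF e] by (auto simp: U'_def S_def)
  moreover have "carrier G - (K <#> F) \<subseteq> (\<Union>k\<in>{1..card U'}. S (e k))"
  proof -
    have "(\<Union>k\<in>{1..card U'}. S (e k)) = \<Union> (S ` e ` {1..card U'})"
      by (simp add: image_image)
    with cover show ?thesis
      by (simp only: bij_betw_imp_surj_on[OF e])
  qed
  ultimately have "\<exists>k\<in>{1..card U'}. Core G (S (e k)) K = {\<one>}"
    by (intro highly_core_freeD[OF hcf F, of "card U'" "\<lambda>k. S (e k)"])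
  then obtain k where k: "k \<in> {1..card U'}" "Core G (S (e k)) K = {\<one>}"
    by blast
  then have "e k \<in> U"
    using bij_betw_apply[OF e] by (auto simp: U'_def)
  moreover from this have "e k \<in> Core G (S (e k)) K"
    using U by (intro mem_Core_conj K) (auto simp: S_def)
  ultimately show False
    using k(2) U by auto
qed

text \<open>If \<open>a h z = a k y\<close>, then \<open>inv k \<otimes> h\<close> carries
  \<open>z\<close> to \<open>y\<close>, which puts \<open>h\<close> into \<open>K\<close> times a
  transporter.\<close>

lemma (in free_act) avoid_orbit:
  assumes K: "subgroup K G" and Z: "Z \<subseteq> X" and F: "F \<subseteq> X"
    and h: "h \<in> carrier G" "h \<notin> K <#> {g \<in> carrier G. \<exists>z\<in>Z. a g z \<in> F}"
    and mem: "z \<in> Z" "k \<in> K" "y \<in> F"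
  shows "a h z \<noteq> a k y"
proof
  assume eq: "a h z = a k y"
  have k: "k \<in> carrier G"
    using subgroup.mem_carrier[OF K mem(2)] .
  have "a (inv k \<otimes> h) z = y"
    using mem Z F h(1) k eq by (simp add: act_mult act_inv_left subset_iff)
  then have "inv k \<otimes> h \<in> {g \<in> carrier G. \<exists>z\<in>Z. a g z \<in> F}"
    using mem h k by auto
  moreover have "h = k \<otimes> (inv k \<otimes> h)"
    using h k by (simp flip: m_assoc)
  ultimately show False
    using h(2) mem by (auto simp: set_mult_def)
qed

text \<open>The points \<open>a h z\<close> and \<open>a h z'\<close> share a \<open>K\<close>-orbit
  exactly when \<open>h\<close> conjugates into \<open>K\<close> an element carrying
  \<open>z\<close> to \<open>z'\<close>. Separating \<open>Z\<close> thus means keeping the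
  conjugates of the finitely many elements of \<open>U\<close> out of \<open>K\<close>, and leaving
  the orbits of \<open>F\<close> means staying out of \<open>K <#> F'\<close>.\<close>

lemma (in free_act) separate_finite:
  assumes inf: "infinite (carrier G)" and K: "subgroup K G" and hcf: "highly_core_free G K"
    and Z: "finite Z" "Z \<subseteq> X" and F: "finite F" "F \<subseteq> X"
  shows "\<exists>h\<in>carrier G. (\<forall>z\<in>Z. \<forall>k\<in>K. \<forall>y\<in>F. a h z \<noteq> a k y) \<and>
           (\<forall>z\<in>Z. \<forall>z'\<in>Z. \<forall>k\<in>K. a h z' = a k (a h z) \<longrightarrow> z = z')"
proof -
  define F' where "F' = {g \<in> carrier G. \<exists>z\<in>Z. a g z \<in> F}"
  define U where "U = {g \<in> carrier G. \<exists>z\<in>Z. a g z \<in> Z} - {\<one>}"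
  have "finite F'" "F' \<subseteq> carrier G" "finite U" "U \<subseteq> carrier G" "\<one> \<notin> U"
    using finite_transporters Z F by (auto simp: F'_def U_def)
  then obtain h where h: "h \<in> carrier G" "h \<notin> K <#> F'" "\<forall>u\<in>U. h \<otimes> u \<otimes> inv h \<notin> K"
    using highly_core_free_avoid_conjugates[OF inf K hcf] by meson
  note K_carrier = subgroup.mem_carrier[OF K]
  have "a h z \<noteq> a k y" if "z \<in> Z" "k \<in> K" "y \<in> F" for z k y
    using avoid_orbit[OF K Z(2) F(2) h(1)] h(2) that by (simp add: F'_def)
  moreover have "z = z'" if "z \<in> Z" "z' \<in> Z" "k \<in> K" "a h z' = a k (a h z)" for z z' k
  proof -
    have k: "k \<in> carrier G" using that K_carrier by blast
    define u where "u = inv h \<otimes> k \<otimes> h"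
    have u: "u \<in> carrier G" using h k by (simp add: u_def)
    have "a u z = a (inv h) (a k (a h z))"
      using that(1) Z h(1) k by (simp add: u_def act_mult subset_iff)
    also have "\<dots> = z'"
      using that(2) Z h(1) by (simp add: act_inv_left subset_iff flip: that(4))
    finally have uz: "a u z = z'" .
    have "h \<otimes> u = k \<otimes> h"
      using h(1) k by (simp add: u_def m_assoc[symmetric])
    then have "h \<otimes> u \<otimes> inv h = k"
      using h(1) k by (simp add: m_assoc)
    then have "u \<notin> U"
      using h(3) that by auto
    then have "u = \<one>"
      using that u uz by (auto simp: U_def)
    then show ?thesis
      using uz that Z by auto
  qed
  ultimately show ?thesis
    using h(1) by blast
qed

section \<open>Equivariant back and forth\<close>

text \<open>Expresses that some word in the moves \<open>M\<close>, the relation \<open>P\<close>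
  and their inverses carries one tuple to the other, while \<open>P\<close> is still partial. It is
  monotone in \<open>P\<close>, so a link made at a finite stage survives in the union.\<close>

inductive linked :: "'x set \<Rightarrow> ('x \<Rightarrow> 'x) set \<Rightarrow> ('x \<times> 'x) set \<Rightarrow> 'x list \<Rightarrow> 'x list \<Rightarrow> bool"
  for X M P where
  refl: "set xs \<subseteq> X \<Longrightarrow> linked X M P xs xs"
| sym: "linked X M P xs ys \<Longrightarrow> linked X M P ys xs"
| trans: "linked X M P xs ys \<Longrightarrow> linked X M P ys zs \<Longrightarrow> linked X M P xs zs"
| move: "m \<in> M \<Longrightarrow> set xs \<subseteq> X \<Longrightarrow> linked X M P xs (map m xs)"
| step: "list_all2 (\<lambda>x y. (x, y) \<in> P) xs ys \<Longrightarrow> linked X M P xs ys"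

lemma linked_mono: "linked X M P xs ys \<Longrightarrow> P \<subseteq> P' \<Longrightarrow> linked X M P' xs ys"
proof (induction rule: linked.induct)
  case (step xs ys)
  then show ?case
    by (intro linked.step) (auto elim: list_all2_mono)
qed (auto intro: linked.intros)

text \<open>A step along the converse is a step read backwards, which rule \<open>sym\<close>
  absorbs. Links found with domain and range exchanged therefore count as well.\<close>

lemma linked_converse: "linked X M P xs ys \<Longrightarrow> linked X M (P\<inverse>) xs ys"
proof (induction rule: linked.induct)
  case (step xs ys)
  then have "list_all2 (\<lambda>x y. (x, y) \<in> P\<inverse>) ys xs"
    by (simp add: list_all2_conv_all_nth)
  then show ?case
    by (intro linked.sym[OF linked.step])
qed (auto intro: linked.intros)

text \<open>Partial bijections are kept as graphs, so that inversion exchanges the roles of \<open>A\<close> and \<open>B\<close>.\<close>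

lemma single_valued_Un:
  assumes "single_valued P" "single_valued Q" "Domain P \<inter> Domain Q = {}"
  shows "single_valued (P \<union> Q)"
proof (rule single_valuedI)
  fix x y z assume "(x, y) \<in> P \<union> Q" "(x, z) \<in> P \<union> Q"
  then have "(x, y) \<in> P \<and> (x, z) \<in> P \<or> (x, y) \<in> Q \<and> (x, z) \<in> Q"
    using assms(3) by blast
  then show "y = z"
    using assms(1,2) by (auto dest: single_valuedD)
qed

lemma single_valued_map_prod:
  assumes "inj f" "single_valued P"
  shows "single_valued (map_prod f f ` P)"
proof (rule single_valuedI)
  fix x y z assume xyz: "(x, y) \<in> map_prod f f ` P" "(x, z) \<in> map_prod f f ` P"
  obtain u v where "x = f u" "y = f v" "(u, v) \<in> P"
    using xyz(1) by auto
  moreover obtain u' v' where "x = f u'" "z = f v'" "(u', v') \<in> P"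
    using xyz(2) by auto
  ultimately show "y = z"
    using assms by (auto dest: injD single_valuedD)
qed

lemma converse_map_prod: "(map_prod f f ` P)\<inverse> = map_prod f f ` (P\<inverse>)"
  by (auto simp: image_iff Bex_def)

section \<open>Equivariant partial bijections between two free actions\<close>

locale equivariant_relation = A: free_act K X A + B: free_act K X B
  for K :: "('k, 'm) monoid_scheme" (structure) and X :: "'x set"
    and A :: "'k \<Rightarrow> 'x \<Rightarrow> 'x" and B :: "'k \<Rightarrow> 'x \<Rightarrow> 'x"
begin

definition partial_iso :: "('x \<times> 'x) set \<Rightarrow> bool" where
  "partial_iso P \<longleftrightarrow> P \<subseteq> X \<times> X \<and> single_valued P \<and> single_valued (P\<inverse>) \<and>
     (\<forall>(x, y)\<in>P. \<forall>k\<in>carrier K. (A k x, B k y) \<in> P)"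

text \<open>Graph of the only equivariant map from the orbit of \<open>x\<close> that sends
  \<open>x\<close> to \<open>y\<close>. Freeness of \<open>A\<close> makes it well defined, freeness
  of \<open>B\<close> makes it injective.\<close>

definition pair_orb :: "'x \<Rightarrow> 'x \<Rightarrow> ('x \<times> 'x) set" where
  "pair_orb x y = {(A k x, B k y) | k. k \<in> carrier K}"

lemma partial_iso_swap: "equivariant_relation.partial_iso K X B A (P\<inverse>) \<longleftrightarrow> partial_iso P"
proof -
  interpret S: equivariant_relation K X B A ..
  show ?thesis
    unfolding partial_iso_def S.partial_iso_def by fastforce
qed

lemma Domain_partial_iso_iff:
  assumes "partial_iso P" "k \<in> carrier K" "x \<in> X"
  shows "A k x \<in> Domain P \<longleftrightarrow> x \<in> Domain P"
proof
  assume "A k x \<in> Domain P"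
  then obtain y where "(A k x, y) \<in> P" by blast
  then have "(A (inv k) (A k x), B (inv k) y) \<in> P"
    using assms by (fastforce simp: partial_iso_def)
  then show "x \<in> Domain P"
    using assms by (auto simp: A.act_inv_left)
next
  assume "x \<in> Domain P"
  then show "A k x \<in> Domain P"
    using assms by (fastforce simp: partial_iso_def)
qed

lemma Range_partial_iso_iff:
  assumes "partial_iso P" "k \<in> carrier K" "y \<in> X"
  shows "B k y \<in> Range P \<longleftrightarrow> y \<in> Range P"
proof -
  interpret S: equivariant_relation K X B A ..
  have "S.partial_iso (P\<inverse>)"
    using assms partial_iso_swap by blast
  from S.Domain_partial_iso_iff[OF this assms(2,3)] show ?thesis by simp
qed

text \<open>Domain and range of an equivariant relation are unions of orbits. If \<open>x\<close>
  and \<open>y\<close> lie outside, so do their orbits, and new pairs cannot collide with old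
  ones.\<close>

lemma partial_iso_insert:
  assumes P: "partial_iso P" and x: "x \<in> X - Domain P" and y: "y \<in> X - Range P"
  shows "partial_iso (P \<union> pair_orb x y)"
proof -
  have sub: "P \<union> pair_orb x y \<subseteq> X \<times> X"
    using assms by (auto simp: partial_iso_def pair_orb_def)
  have notin: "A k x \<notin> Domain P" "B k y \<notin> Range P" if "k \<in> carrier K" for k
    using that assms Domain_partial_iso_iff[OF P] Range_partial_iso_iff[OF P] by auto
  have "single_valued P" "single_valued (P\<inverse>)"
    using P by (auto simp: partial_iso_def)
  have "k = l" if "k \<in> carrier K" "l \<in> carrier K" "A k x = A l x" for k l
    using that x A.act_cancel by blast
  moreover have "k = l" if "k \<in> carrier K" "l \<in> carrier K" "B k y = B l y" for k l
    using that y B.act_cancel by blast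
  ultimately have "single_valued (pair_orb x y)" "single_valued ((pair_orb x y)\<inverse>)"
    by (auto simp: pair_orb_def single_valued_def)
  moreover have "Domain P \<inter> Domain (pair_orb x y) = {}" "Range P \<inter> Range (pair_orb x y) = {}"
    using notin by (auto simp: pair_orb_def)
  ultimately have "single_valued (P \<union> pair_orb x y)" "single_valued ((P \<union> pair_orb x y)\<inverse>)"
    using \<open>single_valued P\<close> \<open>single_valued (P\<inverse>)\<close>
    by (auto simp: converse_Un intro!: single_valued_Un)
  moreover have "(A k u, B k v) \<in> P \<union> pair_orb x y"
    if uv: "(u, v) \<in> P \<union> pair_orb x y" and k: "k \<in> carrier K" for u v k
    using uv
  proof
    assume "(u, v) \<in> P"
    then show ?thesis using P k by (auto simp: partial_iso_def)
  next
    assume "(u, v) \<in> pair_orb x y"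
    then obtain l where l: "l \<in> carrier K" "u = A l x" "v = B l y"
      by (auto simp: pair_orb_def)
    then have "A k u = A (k \<otimes> l) x" "B k v = B (k \<otimes> l) y"
      using x y k by (auto simp: A.act_mult B.act_mult)
    then show ?thesis
      using l k by (auto simp: pair_orb_def)
  qed
  ultimately show ?thesis
    using sub by (auto simp: partial_iso_def)
qed

lemma Domain_pair_orb: "Domain (pair_orb x y) = A.orb {x}"
  by (auto simp: pair_orb_def A.orb_def)

lemma Range_pair_orb: "Range (pair_orb x y) = B.orb {y}"
  by (auto simp: pair_orb_def B.orb_def)

lemma pair_orb_self: "x \<in> X \<Longrightarrow> y \<in> X \<Longrightarrow> (x, y) \<in> pair_orb x y"
  by (auto simp: pair_orb_def intro!: exI[of _ \<one>])

end

section \<open>Back and forth with a reservoir of fresh points\<close>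

text \<open>\<open>M\<close> stands for the moves by elements of H and \<open>Y\<close> for the
  reservoir. The \<open>separate\<close> assumptions scatter a whole tuple over distinct new orbits
  but do not mention \<open>P0\<close>. The \<open>escape\<close> assumptions take one chosen point
  off \<open>P0\<close> while the whole tuple avoids finitely many orbits. The list is invariant
  under exchanging \<open>A\<close> with \<open>B\<close> and \<open>P0\<close> with its
  converse.\<close>

locale back_and_forth = equivariant_relation K X A B
  for K :: "('k, 'm) monoid_scheme" (structure) and X :: "'x set" and A B +
  fixes Y :: "'x set" and M :: "('x \<Rightarrow> 'x) set" and P0 :: "('x \<times> 'x) set"
  assumes countable_X: "countable X"
    and Y: "Y \<subseteq> X" "Y \<noteq> {}"
    and A_Y: "\<And>k y. k \<in> carrier K \<Longrightarrow> y \<in> Y \<Longrightarrow> A k y \<in> Y"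
    and B_Y: "\<And>k y. k \<in> carrier K \<Longrightarrow> y \<in> Y \<Longrightarrow> B k y \<in> Y"
    and M: "\<And>m. m \<in> M \<Longrightarrow> m \<in> X \<rightarrow> X" "\<And>m. m \<in> M \<Longrightarrow> inj_on m X" "\<And>m. m \<in> M \<Longrightarrow> m \<in> Y \<rightarrow> Y"
    and P0: "partial_iso P0"
    and Y_P0: "Y \<inter> Domain P0 = {}" "Y \<inter> Range P0 = {}"
    and separate_A: "\<And>Z F. finite Z \<Longrightarrow> Z \<subseteq> X \<Longrightarrow> finite F \<Longrightarrow> F \<subseteq> X \<Longrightarrow>
      \<exists>m\<in>M. (\<forall>z\<in>Z. m z \<notin> A.orb F) \<and> (\<forall>z\<in>Z. \<forall>z'\<in>Z. m z' \<in> A.orb {m z} \<longrightarrow> z = z')"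
    and separate_B: "\<And>Z F. finite Z \<Longrightarrow> Z \<subseteq> X \<Longrightarrow> finite F \<Longrightarrow> F \<subseteq> X \<Longrightarrow>
      \<exists>m\<in>M. (\<forall>z\<in>Z. m z \<notin> B.orb F) \<and> (\<forall>z\<in>Z. \<forall>z'\<in>Z. m z' \<in> B.orb {m z} \<longrightarrow> z = z')"
    and escape_A: "\<And>z Z F. z \<in> Z \<Longrightarrow> finite Z \<Longrightarrow> Z \<subseteq> X \<Longrightarrow> finite F \<Longrightarrow> F \<subseteq> X \<Longrightarrow>
      \<exists>m\<in>M. m z \<notin> Domain P0 \<and> (\<forall>x\<in>Z. m x \<notin> A.orb F)"
    and escape_B: "\<And>z Z F. z \<in> Z \<Longrightarrow> finite Z \<Longrightarrow> Z \<subseteq> X \<Longrightarrow> finite F \<Longrightarrow> F \<subseteq> X \<Longrightarrow>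
      \<exists>m\<in>M. m z \<notin> Range P0 \<and> (\<forall>x\<in>Z. m x \<notin> B.orb F)"
begin

text \<open>The stages of the construction: \<open>P0\<close> enlarged by finitely many orbits on
  each side, as the finite sets \<open>F\<close> in \<open>separate\<close> and
  \<open>escape\<close> require.\<close>

definition approx :: "('x \<times> 'x) set \<Rightarrow> bool" where
  "approx P \<longleftrightarrow> P0 \<subseteq> P \<and> partial_iso P \<and>
     (\<exists>F. finite F \<and> F \<subseteq> X \<and> Domain P \<subseteq> Domain P0 \<union> A.orb F) \<and>
     (\<exists>F. finite F \<and> F \<subseteq> X \<and> Range P \<subseteq> Range P0 \<union> B.orb F)"

lemma swap: "back_and_forth K X B A Y M (P0\<inverse>)"
proof -
  interpret S: equivariant_relation K X B A ..
  show ?thesis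
    by unfold_locales (unfold Domain_converse Range_converse partial_iso_swap,
        (fact countable_X Y A_Y B_Y M P0 Y_P0 separate_A separate_B escape_A escape_B)+)
qed

lemma approx_swap: "back_and_forth.approx K X B A (P0\<inverse>) (P\<inverse>) \<longleftrightarrow> approx P"
proof -
  interpret S: back_and_forth K X B A Y M "P0\<inverse>" by (rule swap)
  show ?thesis
    unfolding approx_def S.approx_def using partial_iso_swap by auto
qed

lemma approx_P0: "approx P0"
  using P0 by (auto simp: approx_def intro: exI[of _ "{}"])

lemma approx_insert:
  assumes "approx P" "x \<in> X - Domain P" "y \<in> X - Range P"
  shows "approx (P \<union> pair_orb x y)"
proof -
  obtain F F' where F: "finite F" "F \<subseteq> X" "Domain P \<subseteq> Domain P0 \<union> A.orb F"
      "finite F'" "F' \<subseteq> X" "Range P \<subseteq> Range P0 \<union> B.orb F'"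
    using assms(1) by (auto simp: approx_def)
  have "Domain (P \<union> pair_orb x y) \<subseteq> Domain P0 \<union> A.orb (F \<union> {x})"
    using F unfolding Domain_Un_eq Domain_pair_orb A.orb_Un by blast
  moreover have "Range (P \<union> pair_orb x y) \<subseteq> Range P0 \<union> B.orb (F' \<union> {y})"
    using F unfolding Range_Un_eq Range_pair_orb B.orb_Un by blast
  moreover have "finite (F \<union> {x})" "F \<union> {x} \<subseteq> X" "finite (F' \<union> {y})" "F' \<union> {y} \<subseteq> X"
    using F assms by auto
  moreover have "partial_iso (P \<union> pair_orb x y)"
    using assms partial_iso_insert by (auto simp: approx_def)
  moreover have "P0 \<subseteq> P \<union> pair_orb x y"
    using assms(1) by (auto simp: approx_def)
  ultimately show ?thesis
    unfolding approx_def by blast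
qed

text \<open>A point of \<open>Y\<close> is moved off the finitely many orbits added to the range. It
  stays in \<open>Y\<close>, hence off \<open>Range P0\<close>, and is a legitimate new value. That
  new values lie in \<open>Y\<close> is what later drives tuples into \<open>Y\<close>.\<close>

lemma extend_Domain:
  assumes P: "approx P" and x: "x \<in> X"
  shows "\<exists>P'. approx P' \<and> P \<subseteq> P' \<and> x \<in> Domain P' \<and> (\<forall>(u, v)\<in>P' - P. v \<in> Y)"
proof (cases "x \<in> Domain P")
  case True
  then show ?thesis using P by blast
next
  case False
  obtain F where F: "finite F" "F \<subseteq> X" "Range P \<subseteq> Range P0 \<union> B.orb F"
    using P by (auto simp: approx_def)
  obtain y0 where y0: "y0 \<in> Y" using Y by blast
  then obtain m where m: "m \<in> M" "m y0 \<notin> B.orb F"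
    using separate_B[of "{y0}" F] Y F by auto
  have y: "m y0 \<in> Y"
    using M(3)[OF m(1)] y0 by blast
  then have y': "m y0 \<in> X - Range P"
    using m(2) F(3) Y Y_P0(2) by blast
  have "v \<in> Y" if "(u, v) \<in> pair_orb x (m y0)" for u v
    using that y B_Y by (auto simp: pair_orb_def)
  moreover have "approx (P \<union> pair_orb x (m y0))"
    using P x False y' by (intro approx_insert) auto
  moreover have "(x, m y0) \<in> pair_orb x (m y0)"
    using x y' by (intro pair_orb_self) auto
  ultimately show ?thesis
    by (intro exI[of _ "P \<union> pair_orb x (m y0)"]) blast
qed

lemma extend_Domain_finite:
  assumes "finite Z" "Z \<subseteq> X" "approx P"
  shows "\<exists>P'. approx P' \<and> P \<subseteq> P' \<and> Z \<subseteq> Domain P' \<and> (\<forall>(u, v)\<in>P' - P. v \<in> Y)"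
  using assms
proof (induction Z rule: finite_induct)
  case empty
  then show ?case by blast
next
  case (insert x Z)
  then obtain P' where P': "approx P'" "P \<subseteq> P'" "Z \<subseteq> Domain P'" "\<forall>(u, v)\<in>P' - P. v \<in> Y"
    by blast
  obtain P'' where P'': "approx P''" "P' \<subseteq> P''" "x \<in> Domain P''" "\<forall>(u, v)\<in>P'' - P'. v \<in> Y"
    using extend_Domain[OF P'(1), of x] insert.prems by blast
  have "\<forall>(u, v)\<in>P'' - P. v \<in> Y"
    using P'(4) P''(4) by blast
  then show ?case
    using P' P'' by (intro exI[of _ P'']) blast
qed

lemma extend_Range:
  assumes "approx P" "y \<in> X"
  shows "\<exists>P'. approx P' \<and> P \<subseteq> P' \<and> y \<in> Range P'"
proof -
  interpret S: back_and_forth K X B A Y M "P0\<inverse>" by (rule swap)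
  obtain Q where "S.approx Q" "P\<inverse> \<subseteq> Q" "y \<in> Domain Q"
    using S.extend_Domain[of "P\<inverse>" y] assms approx_swap by blast
  then show ?thesis
    using approx_swap[of "Q\<inverse>"] by (intro exI[of _ "Q\<inverse>"]) auto
qed

text \<open>Fresh images are chosen in \<open>Y\<close>, and points of \<open>Y\<close> are moved off the domain before the next
  application of the relation, so each round increases the number of entries lying in \<open>Y\<close>.\<close>

lemma push_into_Y:
  assumes "approx P" "set xs \<subseteq> X" "distinct xs"
  shows "\<exists>P' ys. approx P' \<and> P \<subseteq> P' \<and> set ys \<subseteq> Y \<and> distinct ys \<and> length ys = length xs \<and>
           linked X M P' xs ys"
  using assms
proof (induction "length (filter (\<lambda>x. x \<notin> Y) xs)" arbitrary: P xs rule: less_induct)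
  case less
  show ?case
  proof (cases "set xs \<subseteq> Y")
    case True
    then show ?thesis
      using less.prems by (intro exI[of _ P] exI[of _ xs]) (auto intro: linked.refl)
  next
    case False
    then obtain z where z: "z \<in> set xs" "z \<notin> Y" by blast
    obtain F where F: "finite F" "F \<subseteq> X" "Domain P \<subseteq> Domain P0 \<union> A.orb F"
      using less.prems by (auto simp: approx_def)
    obtain m where m: "m \<in> M" "m z \<notin> Domain P0" "\<forall>x\<in>set xs. m x \<notin> A.orb F"
      using escape_A[of z "set xs" F] z less.prems F by blast
    have sub: "set (map m xs) \<subseteq> X"
      using M(1)[OF m(1)] less.prems by auto
    obtain P' where P': "approx P'" "P \<subseteq> P'" "set (map m xs) \<subseteq> Domain P'"
        "\<forall>(u, v)\<in>P' - P. v \<in> Y"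
      using extend_Domain_finite[OF _ sub less.prems(1)] by blast
    have sv: "single_valued (P'\<inverse>)" "P' \<subseteq> X \<times> X"
      using P'(1) by (auto simp: approx_def partial_iso_def)
    have "\<forall>x\<in>set xs. \<exists>y. (m x, y) \<in> P'"
      using P'(3) by auto
    then obtain f where f: "\<And>x. x \<in> set xs \<Longrightarrow> (m x, f x) \<in> P'"
      by metis
    \<comment> \<open>Entries in \<open>Y\<close> stay in \<open>Y\<close> under \<open>m\<close>,
      hence off \<open>Domain P0\<close>, and \<open>z\<close> leaves it by the choice of
      \<open>m\<close>. As all entries avoid \<open>F\<close>, the pairs at these entries are new
      and have values in \<open>Y\<close>. The other entries may follow \<open>P0\<close>
      anywhere.\<close>
    have fY: "f x \<in> Y" if "x \<in> set xs" "x \<in> Y \<or> x = z" for x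
    proof -
      have "m x \<notin> Domain P0"
        using that m M(3)[OF m(1)] Y_P0 by auto
      then have "(m x, f x) \<notin> P"
        using m(3) F(3) that by auto
      then show ?thesis
        using f[OF that(1)] P'(4) by blast
    qed
    have inj: "inj_on f (set xs)"
    proof (rule inj_onI)
      fix x y assume xy: "x \<in> set xs" "y \<in> set xs" "f x = f y"
      then have "m x = m y"
        using f[of x] f[of y] sv(1) by (auto simp: single_valued_def)
      then show "x = y"
        using M(2)[OF m(1)] xy less.prems by (meson inj_onD subsetD)
    qed
    have "length (filter (\<lambda>x. x \<notin> Y) (map f xs)) = length (filter (\<lambda>x. f x \<notin> Y) xs)"
      by (simp add: filter_map comp_def)
    also have "\<dots> = length (filter (\<lambda>x. f x \<notin> Y) (filter (\<lambda>x. x \<notin> Y) xs))"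
      using fY by (intro arg_cong[where f = length]) (auto intro: filter_cong)
    also have "\<dots> < length (filter (\<lambda>x. x \<notin> Y) xs)"
      using fY z by (intro length_filter_less[of z]) auto
    finally have lt: "length (filter (\<lambda>x. x \<notin> Y) (map f xs)) < length (filter (\<lambda>x. x \<notin> Y) xs)" .
    have "linked X M P' xs (map m xs)"
      using m less.prems by (intro linked.move)
    moreover have "linked X M P' (map m xs) (map f xs)"
      using f by (intro linked.step) (auto simp: list_all2_conv_all_nth)
    ultimately have l: "linked X M P' xs (map f xs)"
      by (rule linked.trans)
    have "set (map f xs) \<subseteq> X" "distinct (map f xs)"
      using f sv inj less.prems by (auto simp: distinct_map)
    then obtain P'' ys where P'': "approx P''" "P' \<subseteq> P''" "set ys \<subseteq> Y" "distinct ys"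
        "length ys = length xs" "linked X M P'' (map f xs) ys"
      using less.hyps[OF lt P'(1)] by auto
    then have "linked X M P'' xs ys"
      using l linked_mono linked.trans by metis
    then show ?thesis
      using P'' P'(2) by blast
  qed
qed

text \<open>Pairs are added one by one. Since the points lie in pairwise distinct orbits, adding one
  orbit leaves the remaining points outside domain and range.\<close>

lemma insert_pairs:
  assumes "approx P" "length xs = length ys"
    "set xs \<subseteq> X - Domain P" "set ys \<subseteq> X - Range P" "distinct xs" "distinct ys"
    "\<forall>x\<in>set xs. \<forall>x'\<in>set xs. x' \<in> A.orb {x} \<longrightarrow> x = x'"
    "\<forall>y\<in>set ys. \<forall>y'\<in>set ys. y' \<in> B.orb {y} \<longrightarrow> y = y'"
  shows "\<exists>P'. approx P' \<and> P \<subseteq> P' \<and> list_all2 (\<lambda>x y. (x, y) \<in> P') xs ys"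
  using assms(2,1,3-)
proof (induction xs ys arbitrary: P rule: list_induct2)
  case Nil
  then show ?case by auto
next
  case (Cons x xs y ys)
  define Q where "Q = P \<union> pair_orb x y"
  have "approx Q"
    unfolding Q_def using Cons.prems by (intro approx_insert) auto
  moreover have "x' \<notin> A.orb {x}" if "x' \<in> set xs" for x'
    using that Cons.prems by auto
  then have "set xs \<subseteq> X - Domain Q"
    using Cons.prems by (auto simp: Q_def Domain_Un_eq Domain_pair_orb)
  moreover have "y' \<notin> B.orb {y}" if "y' \<in> set ys" for y'
    using that Cons.prems by auto
  then have "set ys \<subseteq> X - Range Q"
    using Cons.prems by (auto simp: Q_def Range_Un_eq Range_pair_orb)
  moreover have "distinct xs" "distinct ys"
      "\<forall>u\<in>set xs. \<forall>u'\<in>set xs. u' \<in> A.orb {u} \<longrightarrow> u = u'"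
      "\<forall>u\<in>set ys. \<forall>u'\<in>set ys. u' \<in> B.orb {u} \<longrightarrow> u = u'"
    using Cons.prems by simp_all
  ultimately obtain P' where P': "approx P'" "Q \<subseteq> P'" "list_all2 (\<lambda>x y. (x, y) \<in> P') xs ys"
    using Cons.IH[of Q] by blast
  have "(x, y) \<in> Q"
    using Cons.prems(2,3) pair_orb_self by (simp add: Q_def)
  then show ?case
    using P' by (intro exI[of _ P']) (auto simp: Q_def)
qed

text \<open>Separation acts on both sides: \<open>m\<close> spreads \<open>xs\<close> over distinct
  new \<open>A\<close>-orbits, \<open>n\<close> spreads \<open>ys\<close> over distinct new
  \<open>B\<close>-orbits, and then \<open>m\<close> of each entry may be sent to \<open>n\<close>
  of the corresponding one. In \<open>Y\<close> all of this happens off \<open>P0\<close>.\<close>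

lemma link_in_Y:
  assumes P: "approx P" and xs: "set xs \<subseteq> Y" "distinct xs" and ys: "set ys \<subseteq> Y" "distinct ys"
    and len: "length xs = length ys"
  shows "\<exists>P'. approx P' \<and> P \<subseteq> P' \<and> linked X M P' xs ys"
proof -
  obtain F F' where F: "finite F" "F \<subseteq> X" "Domain P \<subseteq> Domain P0 \<union> A.orb F"
      "finite F'" "F' \<subseteq> X" "Range P \<subseteq> Range P0 \<union> B.orb F'"
    using P by (auto simp: approx_def)
  have X: "set xs \<subseteq> X" "set ys \<subseteq> X"
    using xs ys Y by auto
  obtain m where m: "m \<in> M" "\<forall>z\<in>set xs. m z \<notin> A.orb F"
      "\<forall>z\<in>set xs. \<forall>z'\<in>set xs. m z' \<in> A.orb {m z} \<longrightarrow> z = z'"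
    using separate_A[of "set xs" F] X F by auto
  obtain n where n: "n \<in> M" "\<forall>z\<in>set ys. n z \<notin> B.orb F'"
      "\<forall>z\<in>set ys. \<forall>z'\<in>set ys. n z' \<in> B.orb {n z} \<longrightarrow> z = z'"
    using separate_B[of "set ys" F'] X F by auto
  have "m ` set xs \<subseteq> Y"
    using M(3)[OF m(1)] xs by auto
  then have 1: "set (map m xs) \<subseteq> X - Domain P"
    using m(2) F(3) Y_P0(1) Y(1) unfolding set_map by blast
  have "n ` set ys \<subseteq> Y"
    using M(3)[OF n(1)] ys by auto
  then have 2: "set (map n ys) \<subseteq> X - Range P"
    using n(2) F(6) Y_P0(2) Y(1) unfolding set_map by blast
  have sep: "\<forall>x\<in>set (map m xs). \<forall>x'\<in>set (map m xs). x' \<in> A.orb {x} \<longrightarrow> x = x'"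
      "\<forall>y\<in>set (map n ys). \<forall>y'\<in>set (map n ys). y' \<in> B.orb {y} \<longrightarrow> y = y'"
    using m(3) n(3) unfolding set_map by blast+
  have "distinct (map m xs)" "distinct (map n ys)"
    using M(2)[OF m(1)] M(2)[OF n(1)] X xs ys inj_on_subset by (auto simp: distinct_map)
  then obtain P' where P': "approx P'" "P \<subseteq> P'" "list_all2 (\<lambda>x y. (x, y) \<in> P') (map m xs) (map n ys)"
    using insert_pairs[OF P _ 1 2 _ _ sep] len by (metis length_map)
  have "linked X M P' xs (map m xs)" "linked X M P' (map m xs) (map n ys)"
      "linked X M P' (map n ys) ys"
    by (rule linked.move[OF m(1) X(1)], rule linked.step[OF P'(3)],
        rule linked.sym[OF linked.move[OF n(1) X(2)]])
  then have "linked X M P' xs ys"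
    by (blast intro: linked.trans)
  then show ?thesis
    using P' by blast
qed

lemma link_tuples:
  assumes P: "approx P" and xs: "set xs \<subseteq> X" "distinct xs" and ys: "set ys \<subseteq> X" "distinct ys"
    and len: "length xs = length ys"
  shows "\<exists>P'. approx P' \<and> P \<subseteq> P' \<and> linked X M P' xs ys"
proof -
  interpret S: back_and_forth K X B A Y M "P0\<inverse>" by (rule swap)
  obtain P1 xs' where 1: "approx P1" "P \<subseteq> P1" "set xs' \<subseteq> Y" "distinct xs'"
      "length xs' = length xs" "linked X M P1 xs xs'"
    using push_into_Y[OF P xs] by blast
  \<comment> \<open>The second tuple is pushed along the converse relation, that is in the swapped
    situation, and the link is read back afterwards.\<close>
  obtain Q ys' where 2: "S.approx Q" "P1\<inverse> \<subseteq> Q" "set ys' \<subseteq> Y" "distinct ys'"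
      "length ys' = length ys" "linked X M Q ys ys'"
    using S.push_into_Y[of "P1\<inverse>" ys] ys 1(1) approx_swap by blast
  define P2 where "P2 = Q\<inverse>"
  have P2: "approx P2" "P1 \<subseteq> P2" "linked X M P2 ys ys'"
    using 2 approx_swap[of P2] linked_converse[OF 2(6)] by (auto simp: P2_def)
  obtain P3 where 3: "approx P3" "P2 \<subseteq> P3" "linked X M P3 xs' ys'"
    using link_in_Y[OF P2(1), of xs' ys'] 1 2 len by auto
  have "linked X M P3 xs xs'" "linked X M P3 ys ys'"
    using 1(6) P2 3 linked_mono by blast+
  then have "linked X M P3 xs ys"
    using 3(3) by (blast intro: linked.trans linked.sym)
  then show ?thesis
    using 3 P2 1 by blast
qed

text \<open>Points of \<open>X\<close> and pairs of finite tuples are both countable in number.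
  Stage \<open>n\<close> puts the \<open>n\<close>-th point into domain and range and links the
  \<open>n\<close>-th pair of tuples.\<close>

theorem exists_highly_transitive_completion:
  "\<exists>P. P0 \<subseteq> P \<and> partial_iso P \<and> Domain P = X \<and> Range P = X \<and>
     (\<forall>xs ys. set xs \<subseteq> X \<longrightarrow> distinct xs \<longrightarrow> set ys \<subseteq> X \<longrightarrow> distinct ys \<longrightarrow> length xs = length ys \<longrightarrow>
        linked X M P xs ys)"
proof -
  define L where "L = {(xs, ys). set xs \<subseteq> X \<and> distinct xs \<and> set ys \<subseteq> X \<and> distinct ys \<and> length xs = length ys}"
  have "L \<subseteq> lists X \<times> lists X"
    by (auto simp: L_def lists_eq_set)
  moreover have "countable (lists X \<times> lists X)"
    using countable_X by simp
  ultimately have L: "countable L"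
    by (rule countable_subset)
  have L_ne: "L \<noteq> {}"
    by (auto simp: L_def intro!: exI[of _ "[]"])
  have X_ne: "X \<noteq> {}"
    using Y by blast
  define goal where "goal n P \<longleftrightarrow> from_nat_into X n \<in> Domain P \<and> from_nat_into X n \<in> Range P \<and>
    (case from_nat_into L n of (xs, ys) \<Rightarrow> linked X M P xs ys)" for n P
  have "\<exists>P'. approx P' \<and> P \<subseteq> P' \<and> goal n P'" if P: "approx P" for n P
  proof -
    have x: "from_nat_into X n \<in> X"
      using X_ne by (rule from_nat_into)
    obtain xs ys where xy: "from_nat_into L n = (xs, ys)" by fastforce
    then have "(xs, ys) \<in> L"
      using from_nat_into[OF L_ne, of n] by simp
    then have xys: "set xs \<subseteq> X" "distinct xs" "set ys \<subseteq> X" "distinct ys" "length xs = length ys"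
      by (auto simp: L_def)
    obtain P1 where 1: "approx P1" "P \<subseteq> P1" "from_nat_into X n \<in> Domain P1"
      using extend_Domain[OF P x] by blast
    obtain P2 where 2: "approx P2" "P1 \<subseteq> P2" "from_nat_into X n \<in> Range P2"
      using extend_Range[OF 1(1) x] by blast
    obtain P3 where 3: "approx P3" "P2 \<subseteq> P3" "linked X M P3 xs ys"
      using link_tuples[OF 2(1) xys] by blast
    have "goal n P3"
      using 1 2 3 xy by (auto simp: goal_def)
    then show ?thesis
      using 1 2 3 by blast
  qed
  then have "\<exists>f. \<forall>n. approx (f n) \<and> (f n \<subseteq> f (Suc n) \<and> goal n (f (Suc n)))"
    using approx_P0 by (intro dependent_nat_choice) auto
  then obtain f where f: "\<And>n. approx (f n)" "\<And>n. f n \<subseteq> f (Suc n)" "\<And>n. goal n (f (Suc n))"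
    by blast
  have mono: "f m \<subseteq> f n" if "m \<le> n" for m n
    using that f(2) lift_Suc_mono_le by blast
  define P where "P = (\<Union>n. f n)"
  have sub: "f n \<subseteq> P" for n
    by (auto simp: P_def)
  have iso: "partial_iso (f n)" for n
    using f(1) by (simp add: approx_def)
  have common: "\<exists>n. p \<in> f n \<and> q \<in> f n" if pq: "p \<in> P" "q \<in> P" for p q
  proof -
    obtain i j where "p \<in> f i" "q \<in> f j" using pq unfolding P_def by blast
    then show ?thesis
      using mono[of i "max i j"] mono[of j "max i j"] by (intro exI[of _ "max i j"]) auto
  qed
  have "single_valued P"
  proof (rule single_valuedI)
    fix x y z assume "(x, y) \<in> P" "(x, z) \<in> P"
    then obtain n where "(x, y) \<in> f n" "(x, z) \<in> f n" using common by blast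
    then show "y = z" using iso[of n] by (auto simp: partial_iso_def single_valued_def)
  qed
  moreover have "single_valued (P\<inverse>)"
  proof (rule single_valuedI)
    fix x y z assume "(x, y) \<in> P\<inverse>" "(x, z) \<in> P\<inverse>"
    then obtain n where "(y, x) \<in> f n" "(z, x) \<in> f n" using common by blast
    then show "y = z" using iso[of n] by (auto simp: partial_iso_def single_valued_def)
  qed
  moreover have "P \<subseteq> X \<times> X" "\<forall>(x, y)\<in>P. \<forall>k\<in>carrier K. (A k x, B k y) \<in> P"
    using iso by (auto simp: P_def partial_iso_def) blast+
  ultimately have "partial_iso P"
    by (simp add: partial_iso_def)
  moreover have "P0 \<subseteq> P"
    using f(1)[of 0] sub[of 0] by (auto simp: approx_def)
  moreover have "x \<in> Domain P \<and> x \<in> Range P" if x: "x \<in> X" for x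
  proof -
    obtain n where "x = from_nat_into X n"
      using from_nat_into_surj[OF countable_X x] by metis
    then have "x \<in> Domain (f (Suc n))" "x \<in> Range (f (Suc n))"
      using f(3)[of n] by (auto simp: goal_def)
    then show ?thesis
      using sub[of "Suc n"] by blast
  qed
  moreover have "linked X M P xs ys"
    if "set xs \<subseteq> X" "distinct xs" "set ys \<subseteq> X" "distinct ys" "length xs = length ys" for xs ys
  proof -
    have "(xs, ys) \<in> L"
      using that by (simp add: L_def)
    then obtain n where n: "from_nat_into L n = (xs, ys)"
      using from_nat_into_surj[OF L] by metis
    then have "linked X M (f (Suc n)) xs ys"
      using f(3)[of n] by (simp add: goal_def)
    then show ?thesis
      using linked_mono sub by blast
  qed
  ultimately show ?thesis
    using \<open>P \<subseteq> X \<times> X\<close> by (intro exI[of _ P]) blast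
qed

end

section \<open>Actions of HNN extensions\<close>

sublocale hnn_data \<subseteq> H: group H
  by (rule group_H)

context hnn_data
begin

lemma base_closed: "g \<in> carrier H \<Longrightarrow> base g \<in> carrier \<Gamma>"
  by (simp add: base_def carrier_HNN)

lemma base_mult: "g \<in> carrier H \<Longrightarrow> h \<in> carrier H \<Longrightarrow> base (g \<otimes> h) = base g \<otimes>\<^bsub>\<Gamma>\<^esub> base h"
  using base_hom by (rule hom_mult)

lemma base_one: "base \<one> = \<one>\<^bsub>\<Gamma>\<^esub>"
  by (rule hom_one[OF base_hom group_H group_HNN])

lemma stable_base: "\<sigma> \<in> K \<Longrightarrow> stable \<otimes>\<^bsub>\<Gamma>\<^esub> base \<sigma> = base (\<theta> \<sigma>) \<otimes>\<^bsub>\<Gamma>\<^esub> stable"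
  unfolding stable_def base_def
proof (simp add: mult_HNN K_carrier theta_carrier, rule cls_eqI)
  assume \<sigma>: "\<sigma> \<in> K"
  have "hnn_eq H K \<theta> ([Stable, Base \<sigma>] @ []) ([Stable, Base \<sigma>] @ [StableInv, Stable])"
    using \<sigma> K_carrier by (intro hnn_eq.append hnn_eq.refl hnn_eq.sym[OF hnn_eq.stable_left]) auto
  moreover have "hnn_eq H K \<theta> ([Stable, Base \<sigma>, StableInv] @ [Stable]) ([Base (\<theta> \<sigma>)] @ [Stable])"
    using \<sigma> by (intro hnn_eq.append hnn_eq.refl hnn_eq.conj) auto
  ultimately show "hnn_eq H K \<theta> [Stable, Base \<sigma>] [Base (\<theta> \<sigma>), Stable]"
    by (auto intro: hnn_eq.trans)
qed

text \<open>Left multiplication by \<open>stable\<close> intertwines the two actions of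
  \<open>K\<close> on \<Gamma>: it is the model for the prescribed bijection on copies of
  \<Gamma>.\<close>

lemma stable_base_mult:
  assumes "\<sigma> \<in> K" "x \<in> carrier \<Gamma>"
  shows "stable \<otimes>\<^bsub>\<Gamma>\<^esub> (base \<sigma> \<otimes>\<^bsub>\<Gamma>\<^esub> x) = base (\<theta> \<sigma>) \<otimes>\<^bsub>\<Gamma>\<^esub> (stable \<otimes>\<^bsub>\<Gamma>\<^esub> x)"
proof -
  interpret G: group \<Gamma> by (rule group_HNN)
  have "base \<sigma> \<in> carrier \<Gamma>" "base (\<theta> \<sigma>) \<in> carrier \<Gamma>"
    using assms K_carrier theta_carrier base_closed by auto
  then show ?thesis
    using stable_base[OF assms(1)] stable_closed assms(2) G.m_assoc by metis
qed

lemma cls_Cons: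
  "x # w \<in> hnn_words H \<Longrightarrow>
    cls (x # w) = (case x of Base g \<Rightarrow> base g | Stable \<Rightarrow> stable | StableInv \<Rightarrow> inv\<^bsub>\<Gamma>\<^esub> stable) \<otimes>\<^bsub>\<Gamma>\<^esub> cls w"
  by (cases x) (simp_all add: base_def inv_stable mult_HNN, simp add: stable_def mult_HNN)

lemma HNN_induct [consumes 1, case_names one base stable inv_stable]:
  assumes "x \<in> carrier \<Gamma>" "P \<one>\<^bsub>\<Gamma>\<^esub>"
    and "\<And>g x. g \<in> carrier H \<Longrightarrow> x \<in> carrier \<Gamma> \<Longrightarrow> P x \<Longrightarrow> P (base g \<otimes>\<^bsub>\<Gamma>\<^esub> x)"
    and "\<And>x. x \<in> carrier \<Gamma> \<Longrightarrow> P x \<Longrightarrow> P (stable \<otimes>\<^bsub>\<Gamma>\<^esub> x)"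
    and "\<And>x. x \<in> carrier \<Gamma> \<Longrightarrow> P x \<Longrightarrow> P (inv\<^bsub>\<Gamma>\<^esub> stable \<otimes>\<^bsub>\<Gamma>\<^esub> x)"
  shows "P x"
proof -
  obtain w where "w \<in> hnn_words H" "x = cls w"
    using assms(1) by (auto simp: carrier_HNN)
  moreover have "w \<in> hnn_words H \<Longrightarrow> P (cls w)" for w
  proof (induction w)
    case Nil
    then show ?case using assms(2) by (simp add: one_HNN)
  next
    case (Cons y w)
    then have "w \<in> hnn_words H"
      by (cases y) auto
    then have "cls w \<in> carrier \<Gamma>" "P (cls w)"
      using Cons.IH by (auto simp: carrier_HNN)
    then show ?case
      using Cons.prems assms(3-) by (cases y) (auto simp: cls_Cons)
  qed
  ultimately show ?thesis by blast
qed

lemma countable_HNN: "countable (carrier H) \<Longrightarrow> countable (hnn_words H) \<and> countable (carrier \<Gamma>)"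
  by (simp add: carrier_HNN hnn_words_def)

text \<open>In the group of bijections of \<open>X\<close>, equivariance of \<open>w\<close> is the
  defining relation of the HNN extension, so the universal property applies.\<close>

lemma exists_HNN_action:
  assumes act: "free_act H X a" and w: "bij_betw w X X"
    and equi: "\<And>\<sigma> x. \<sigma> \<in> K \<Longrightarrow> x \<in> X \<Longrightarrow> w (a \<sigma> x) = a (\<theta> \<sigma>) (w x)"
  shows "\<exists>\<phi>. group_action \<Gamma> X \<phi> \<and> (\<forall>g\<in>carrier H. \<forall>x\<in>X. \<phi> (base g) x = a g x) \<and>
           (\<forall>x\<in>X. \<phi> stable x = w x)"
proof -
  interpret free_act H X a by fact
  interpret L: group "BijGroup X" by (rule group_BijGroup)
  \<comment> \<open>Elements of \<open>BijGroup\<close> are extensional functions, hence the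
    restriction to \<open>X\<close>.\<close>
  define f where "f g = (\<lambda>x\<in>X. a g x)" for g
  define s where "s = (\<lambda>x\<in>X. w x)"
  have s: "s \<in> carrier (BijGroup X)"
    using w by (simp add: s_def BijGroup_def Bij_def cong: bij_betw_cong)
  have bij: "bij_betw (a g) X X" if "g \<in> carrier H" for g
    using that act_inv_left act_inv_right by (intro bij_betwI[where g = "a (inv g)"]) auto
  then have f: "f g \<in> carrier (BijGroup X)" if "g \<in> carrier H" for g
    using that by (simp add: f_def BijGroup_def Bij_def cong: bij_betw_cong)
  have mult: "u \<otimes>\<^bsub>BijGroup X\<^esub> v = (\<lambda>x\<in>X. u (v x))"
    if "u \<in> carrier (BijGroup X)" "v \<in> carrier (BijGroup X)" for u v
    using that by (simp add: BijGroup_def compose_def)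
  have "f \<in> hom H (BijGroup X)"
    using f by (auto simp: hom_def mult) (auto simp: f_def act_mult fun_eq_iff)
  moreover have "f (\<theta> \<sigma>) = s \<otimes>\<^bsub>BijGroup X\<^esub> f \<sigma> \<otimes>\<^bsub>BijGroup X\<^esub> inv\<^bsub>BijGroup X\<^esub> s" if "\<sigma> \<in> K" for \<sigma>
  proof (rule L.inv_solve_right[THEN iffD2, OF _ _ s])
    show "f (\<theta> \<sigma>) \<in> carrier (BijGroup X)" "s \<otimes>\<^bsub>BijGroup X\<^esub> f \<sigma> \<in> carrier (BijGroup X)"
      using that f s theta_carrier K_carrier by auto
    have "w x \<in> X" if "x \<in> X" for x
      using that w bij_betw_apply by metis
    then show "s \<otimes>\<^bsub>BijGroup X\<^esub> f \<sigma> = f (\<theta> \<sigma>) \<otimes>\<^bsub>BijGroup X\<^esub> s"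
      using that f s theta_carrier K_carrier by (simp add: mult) (auto simp: f_def s_def equi fun_eq_iff)
  qed
  ultimately obtain \<phi> where "\<phi> \<in> hom \<Gamma> (BijGroup X)" "\<forall>g\<in>carrier H. \<phi> (base g) = f g" "\<phi> stable = s"
    using HNN_universal(1)[OF L.is_group _ s] by blast
  then show ?thesis
    using group_HNN L.is_group
    by (intro exI[of _ \<phi>]) (auto simp: group_action_def group_hom_def group_hom_axioms_def f_def s_def)
qed

text \<open>The rules of \<open>linked\<close> are matched by the unit, inverses, products,
  \<open>base\<close> and \<open>stable\<close> in \<Gamma>.\<close>

lemma linked_imp_HNN_orbit:
  assumes act: "group_action \<Gamma> X \<phi>"
    and base: "\<forall>g\<in>carrier H. \<forall>x\<in>X. \<phi> (base g) x = a g x"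
    and stable: "\<forall>x\<in>X. \<phi> stable x = w x"
    and "linked X (a ` carrier H) {(x, w x) | x. x \<in> X} xs ys"
  shows "\<exists>\<gamma>\<in>carrier \<Gamma>. set xs \<subseteq> X \<and> ys = map (\<phi> \<gamma>) xs"
  using assms(4)
proof (induction rule: linked.induct)
  interpret group_action \<Gamma> X \<phi> by fact
  interpret G: group \<Gamma> by (rule group_HNN)
  {
    case (refl xs)
    have "\<phi> \<one>\<^bsub>\<Gamma>\<^esub> x = x" if "x \<in> X" for x
      using fun_cong[OF id_eq_one, of x] that by simp
    then show ?case
      using refl by (intro bexI[of _ "\<one>\<^bsub>\<Gamma>\<^esub>"]) (auto intro!: map_idI[symmetric])
  next
    case (sym xs ys)
    then obtain \<gamma> where g: "\<gamma> \<in> carrier \<Gamma>" "set xs \<subseteq> X" "ys = map (\<phi> \<gamma>) xs" by blast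
    then have "\<phi> (inv\<^bsub>\<Gamma>\<^esub> \<gamma>) (\<phi> \<gamma> x) = x" if "x \<in> set xs" for x
      using orbit_sym_aux[OF g(1), of x] that g(2) by blast
    then show ?case
      using g element_image by (intro bexI[of _ "inv\<^bsub>\<Gamma>\<^esub> \<gamma>"]) (auto intro!: map_idI[symmetric])
  next
    case (trans xs ys zs)
    then obtain \<gamma> \<delta> where g: "\<gamma> \<in> carrier \<Gamma>" "\<delta> \<in> carrier \<Gamma>" "set xs \<subseteq> X" "ys = map (\<phi> \<gamma>) xs"
        "zs = map (\<phi> \<delta>) ys" by blast
    then have "\<phi> (\<delta> \<otimes>\<^bsub>\<Gamma>\<^esub> \<gamma>) x = \<phi> \<delta> (\<phi> \<gamma> x)" if "x \<in> set xs" for x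
      using composition_rule that by auto
    then show ?case
      using g by (intro bexI[of _ "\<delta> \<otimes>\<^bsub>\<Gamma>\<^esub> \<gamma>"]) auto
  next
    case (move m xs)
    then obtain g where g: "g \<in> carrier H" "m = a g" by blast
    then have "map m xs = map (\<phi> (base g)) xs"
      using base move(2) by auto
    then show ?case
      using base_closed[OF g(1)] move(2) by blast
  next
    case (step xs ys)
    then have "set xs \<subseteq> X \<and> ys = map (\<phi> stable) xs"
      using stable by (induction rule: list_all2_induct) auto
    then show ?case
      using stable_closed by blast
  }
qed

end

lemma highly_transitiveI:
  assumes "\<And>xs ys. set xs \<subseteq> E \<Longrightarrow> distinct xs \<Longrightarrow> set ys \<subseteq> E \<Longrightarrow> distinct ys \<Longrightarrow>
    length xs = length ys \<Longrightarrow> \<exists>g\<in>carrier G. ys = map (\<phi> g) xs"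
  shows "highly_transitive G E \<phi>"
  unfolding highly_transitive_def
proof (intro allI impI)
  fix n :: nat and x y
  assume xy: "\<forall>k\<in>{1..n}. x k \<in> E \<and> y k \<in> E" "inj_on x {1..n}" "inj_on y {1..n}"
  have eq: "set [1..<Suc n] = {1..n}" by auto
  have "\<exists>g\<in>carrier G. map y [1..<Suc n] = map (\<phi> g) (map x [1..<Suc n])"
    using xy by (intro assms) (simp_all only: set_map eq distinct_map distinct_upt length_map, auto)
  then obtain g where "g \<in> carrier G" "map y [1..<Suc n] = map (\<lambda>k. \<phi> g (x k)) [1..<Suc n]"
    by (auto simp: comp_def)
  then have "\<forall>k\<in>{1..n}. \<phi> g (x k) = y k"
    unfolding map_eq_conv eq by simp
  then show "\<exists>g\<in>carrier G. \<forall>k\<in>{1..n}. \<phi> g (x k) = y k"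
    using \<open>g \<in> carrier G\<close> by blast
qed

section \<open>Completing a prescribed partial bijection over core-free data\<close>

locale hnn_core_free = hnn_data +
  assumes infinite_H: "infinite (carrier H)" and countable_H: "countable (carrier H)"
    and inj_theta: "inj_on \<theta> K"
    and core_free_K: "highly_core_free H K" and core_free_theta: "highly_core_free H (\<theta> ` K)"
begin

abbreviation L where "L \<equiv> H\<lparr>carrier := K\<rparr>"

lemma group_L: "group L"
  by (rule subgroup.subgroup_is_group[OF subgroup_K group_H])

lemma subgroup_theta: "subgroup (\<theta> ` K) H"
proof -
  interpret group_hom L H \<theta>
    by (rule group_hom.intro[OF group_L group_H group_hom_axioms.intro[OF theta_hom]])
  show ?thesis
    using img_is_subgroup by simp
qed

lemma free_act_K: "free_act H X a \<Longrightarrow> free_act L X a"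
  using free_act.free_act_restrict_hom[of H X a L id] group_L K_carrier
  by (simp add: hom_def)

lemma free_act_theta: "free_act H X a \<Longrightarrow> free_act L X (\<lambda>k. a (\<theta> k))"
  using free_act.free_act_restrict_hom[of H X a L \<theta>] group_L theta_hom inj_theta by simp

text \<open>The escape hypotheses concern one point and a finite set of group elements, a form that
  is easy to check for a concrete \<open>P0\<close>. Passing to tuples in \<open>X\<close> is a
  matter of transporters.\<close>

theorem exists_highly_transitive_bijection:
  assumes act: "free_act H X a" and X: "countable X"
    and Y: "Y \<subseteq> X" "Y \<noteq> {}" "\<And>g y. g \<in> carrier H \<Longrightarrow> y \<in> Y \<Longrightarrow> a g y \<in> Y"
    and P0: "equivariant_relation.partial_iso L X a (\<lambda>k. a (\<theta> k)) P0"
    and Y_P0: "Y \<inter> Domain P0 = {}" "Y \<inter> Range P0 = {}"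
    and escape_Domain: "\<And>z F. z \<in> X \<Longrightarrow> finite F \<Longrightarrow> F \<subseteq> carrier H \<Longrightarrow>
      \<exists>h\<in>carrier H. h \<notin> K <#> F \<and> a h z \<notin> Domain P0"
    and escape_Range: "\<And>z F. z \<in> X \<Longrightarrow> finite F \<Longrightarrow> F \<subseteq> carrier H \<Longrightarrow>
      \<exists>h\<in>carrier H. h \<notin> (\<theta> ` K) <#> F \<and> a h z \<notin> Range P0"
  shows "\<exists>w. bij_betw w X X \<and> (\<forall>\<sigma>\<in>K. \<forall>x\<in>X. w (a \<sigma> x) = a (\<theta> \<sigma>) (w x)) \<and>
    (\<forall>(x, y)\<in>P0. w x = y) \<and>
    (\<forall>xs ys. set xs \<subseteq> X \<longrightarrow> distinct xs \<longrightarrow> set ys \<subseteq> X \<longrightarrow> distinct ys \<longrightarrow> length xs = length ys \<longrightarrow>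
       linked X (a ` carrier H) {(x, w x) | x. x \<in> X} xs ys)"
proof -
  interpret free_act H X a by fact
  interpret A: free_act L X a by (rule free_act_K[OF act])
  interpret B: free_act L X "\<lambda>k. a (\<theta> k)" by (rule free_act_theta[OF act])
  interpret equivariant_relation L X a "\<lambda>k. a (\<theta> k)" ..
  have A_orb: "x \<in> A.orb F \<longleftrightarrow> (\<exists>k\<in>K. \<exists>y\<in>F. x = a k y)"
    and B_orb: "x \<in> B.orb F \<longleftrightarrow> (\<exists>k\<in>\<theta> ` K. \<exists>y\<in>F. x = a k y)" for x F
    by (auto simp: A.orb_def B.orb_def)
  have separate: "\<exists>m\<in>a ` carrier H. (\<forall>z\<in>Z. \<not> (\<exists>k\<in>J. \<exists>y\<in>F. m z = a k y)) \<and>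
      (\<forall>z\<in>Z. \<forall>z'\<in>Z. (\<exists>k\<in>J. \<exists>y\<in>{m z}. m z' = a k y) \<longrightarrow> z = z')"
    if "finite Z" "Z \<subseteq> X" "finite F" "F \<subseteq> X" "subgroup J H" "highly_core_free H J" for Z F J
    using separate_finite[OF infinite_H that(5,6) that(1-4)] by fastforce
  have escape: "\<exists>m\<in>a ` carrier H. m z \<notin> D \<and> (\<forall>x\<in>Z. \<not> (\<exists>k\<in>J. \<exists>y\<in>F. m x = a k y))"
    if "z \<in> Z" "finite Z" "Z \<subseteq> X" "finite F" "F \<subseteq> X" "subgroup J H"
      and esc: "\<And>F. finite F \<Longrightarrow> F \<subseteq> carrier H \<Longrightarrow> \<exists>h\<in>carrier H. h \<notin> J <#> F \<and> a h z \<notin> D"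
    for z Z F J D
  proof -
    \<comment> \<open>Staying out of \<open>J <#> ?F\<close> takes every point of \<open>Z\<close>
      off the \<open>J\<close>-orbits of \<open>F\<close> at once.\<close>
    let ?F = "{g \<in> carrier H. \<exists>z\<in>Z. a g z \<in> F}"
    have "finite ?F" "?F \<subseteq> carrier H"
      using finite_transporters that by auto
    then obtain h where h: "h \<in> carrier H" "h \<notin> J <#> ?F" "a h z \<notin> D"
      using esc by blast
    then show ?thesis
      using avoid_orbit[OF that(6,3,5) h(1,2)] by blast
  qed
  have M: "m \<in> X \<rightarrow> X" "inj_on m X" "m \<in> Y \<rightarrow> Y" if m: "m \<in> a ` carrier H" for m
  proof -
    obtain g where g: "g \<in> carrier H" "m = a g" using m by blast
    show "m \<in> X \<rightarrow> X" "m \<in> Y \<rightarrow> Y"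
      unfolding g(2) by (rule funcsetI, erule act_closed[OF g(1)], rule funcsetI, erule Y(3)[OF g(1)])
    show "inj_on m X"
      unfolding g(2) by (rule inj_onI) (rule act_inj[OF g(1)])
  qed
  have "back_and_forth_axioms L X a (\<lambda>k. a (\<theta> k)) Y (a ` carrier H) P0"
  proof (rule back_and_forth_axioms.intro)
    show "a k y \<in> Y" if "k \<in> carrier L" "y \<in> Y" for k y
      using Y(3)[OF K_carrier that(2)] that(1) by simp
    show "a (\<theta> k) y \<in> Y" if "k \<in> carrier L" "y \<in> Y" for k y
      using Y(3)[OF theta_carrier that(2)] that(1) by simp
    show "\<exists>m\<in>a ` carrier H. (\<forall>z\<in>Z. m z \<notin> A.orb F) \<and>
        (\<forall>z\<in>Z. \<forall>z'\<in>Z. m z' \<in> A.orb {m z} \<longrightarrow> z = z')"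
      if "finite Z" "Z \<subseteq> X" "finite F" "F \<subseteq> X" for Z F
      using separate[OF that subgroup_K core_free_K] unfolding A_orb .
    show "\<exists>m\<in>a ` carrier H. (\<forall>z\<in>Z. m z \<notin> B.orb F) \<and>
        (\<forall>z\<in>Z. \<forall>z'\<in>Z. m z' \<in> B.orb {m z} \<longrightarrow> z = z')"
      if "finite Z" "Z \<subseteq> X" "finite F" "F \<subseteq> X" for Z F
      using separate[OF that subgroup_theta core_free_theta] unfolding B_orb .
    show "\<exists>m\<in>a ` carrier H. m z \<notin> Domain P0 \<and> (\<forall>x\<in>Z. m x \<notin> A.orb F)"
      if "z \<in> Z" "finite Z" "Z \<subseteq> X" "finite F" "F \<subseteq> X" for z Z F
      using escape[OF that subgroup_K escape_Domain] that unfolding A_orb by blast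
    show "\<exists>m\<in>a ` carrier H. m z \<notin> Range P0 \<and> (\<forall>x\<in>Z. m x \<notin> B.orb F)"
      if "z \<in> Z" "finite Z" "Z \<subseteq> X" "finite F" "F \<subseteq> X" for z Z F
      using escape[OF that subgroup_theta escape_Range] that unfolding B_orb by blast
  qed (fact X Y P0 Y_P0 M)+
  then interpret back_and_forth L X a "\<lambda>k. a (\<theta> k)" Y "a ` carrier H" P0
    by (rule back_and_forth.intro[OF equivariant_relation_axioms])
  obtain P where P: "P0 \<subseteq> P" "partial_iso P" "Domain P = X" "Range P = X"
    and lk: "\<And>xs ys. set xs \<subseteq> X \<Longrightarrow> distinct xs \<Longrightarrow> set ys \<subseteq> X \<Longrightarrow> distinct ys \<Longrightarrow>
        length xs = length ys \<Longrightarrow> linked X (a ` carrier H) P xs ys"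
    using exists_highly_transitive_completion by blast
  have sv: "single_valued P" "single_valued (P\<inverse>)" "P \<subseteq> X \<times> X"
    using P(2) by (auto simp: partial_iso_def)
  have "\<forall>x\<in>X. \<exists>y. (x, y) \<in> P"
    using P(3) by blast
  then obtain w where w: "\<And>x. x \<in> X \<Longrightarrow> (x, w x) \<in> P"
    by metis
  have w_eq: "w x = y" if "(x, y) \<in> P" for x y
    using that w sv by (meson single_valuedD SigmaD1 subsetD)
  have "P = {(x, w x) | x. x \<in> X}"
    using w w_eq sv(3) by blast
  moreover have "bij_betw w X X"
  proof (intro bij_betw_imageI inj_onI)
    fix x y assume "x \<in> X" "y \<in> X" "w x = w y"
    then show "x = y"
      using w[of x] w[of y] sv(2) by (auto simp: single_valued_def)
  next
    show "w ` X = X"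
      using w w_eq sv(3) P(4) by blast
  qed
  moreover have "w (a \<sigma> x) = a (\<theta> \<sigma>) (w x)" if "\<sigma> \<in> K" "x \<in> X" for \<sigma> x
    using P(2) w[OF that(2)] that(1) by (intro w_eq) (auto simp: partial_iso_def)
  moreover have "\<forall>(x, y)\<in>P0. w x = y"
    using P(1) w_eq by blast
  ultimately show ?thesis
    using lk by (intro exI[of _ w]) blast
qed

text \<open>\<Gamma> acts on H so that \<open>base g\<close> is left translation by
  \<open>g\<close>, and its value at \<open>\<one>\<close> recovers \<open>g\<close>. This takes the
  place of a normal form for words.\<close>

lemma base_inj: "inj_on base (carrier H)"
proof -
  interpret free_act H "carrier H" "\<lambda>g x. g \<otimes> x"
    by unfold_locales (auto simp: H.m_assoc)
  interpret A: free_act L "carrier H" "\<lambda>g x. g \<otimes> x"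
    by (rule free_act_K) unfold_locales
  interpret B: free_act L "carrier H" "\<lambda>k x. \<theta> k \<otimes> x"
    by (rule free_act_theta[of "carrier H" "\<lambda>g x. g \<otimes> x"]) unfold_locales
  interpret equivariant_relation L "carrier H" "\<lambda>g x. g \<otimes> x" "\<lambda>k x. \<theta> k \<otimes> x" ..
  have not_covered: "\<exists>h\<in>carrier H. h \<notin> J <#> F \<and> h \<otimes> z \<notin> {}"
    if "finite F" "F \<subseteq> carrier H" "subgroup J H" "highly_core_free H J" for F J z
    using H.highly_core_free_not_covered[OF infinite_H that(3,4,1,2)] by blast
  have "\<exists>w. bij_betw w (carrier H) (carrier H) \<and>
     (\<forall>\<sigma>\<in>K. \<forall>x\<in>carrier H. w (\<sigma> \<otimes> x) = \<theta> \<sigma> \<otimes> w x) \<and> (\<forall>(x, y)\<in>{}. w x = y) \<and>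
    (\<forall>xs ys. set xs \<subseteq> carrier H \<longrightarrow> distinct xs \<longrightarrow> set ys \<subseteq> carrier H \<longrightarrow> distinct ys \<longrightarrow>
       length xs = length ys \<longrightarrow>
       linked (carrier H) ((\<lambda>g x. g \<otimes> x) ` carrier H) {(x, w x) | x. x \<in> carrier H} xs ys)"
  \<comment> \<open>With nothing prescribed, all of H is fresh and serves as its own
    reservoir.\<close>
  proof (rule exists_highly_transitive_bijection[where Y = "carrier H"])
    show "partial_iso {}"
      by (simp add: partial_iso_def)
    show "\<exists>h\<in>carrier H. h \<notin> K <#> F \<and> h \<otimes> z \<notin> Domain {}"
      if "finite F" "F \<subseteq> carrier H" for F z
      using not_covered[OF that subgroup_K core_free_K] by simp
    show "\<exists>h\<in>carrier H. h \<notin> \<theta> ` K <#> F \<and> h \<otimes> z \<notin> Range {}"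
      if "finite F" "F \<subseteq> carrier H" for F z
      using not_covered[OF that subgroup_theta core_free_theta] by simp
  qed (use countable_H in \<open>auto intro: free_act_axioms\<close>)
  then obtain w where "bij_betw w (carrier H) (carrier H)"
      "\<forall>\<sigma>\<in>K. \<forall>x\<in>carrier H. w (\<sigma> \<otimes> x) = \<theta> \<sigma> \<otimes> w x"
    by blast
  then obtain \<phi> where \<phi>: "\<forall>g\<in>carrier H. \<forall>x\<in>carrier H. \<phi> (base g) x = g \<otimes> x"
    using exists_HNN_action[OF free_act_axioms, of w] by blast
  show ?thesis
  proof (rule inj_onI)
    fix g h assume "g \<in> carrier H" "h \<in> carrier H" "base g = base h"
    then have "g \<otimes> \<one> = h \<otimes> \<one>"
      using \<phi> by (metis H.one_closed)
    then show "g = h"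
      using \<open>g \<in> carrier H\<close> \<open>h \<in> carrier H\<close> by simp
  qed
qed

end

section \<open>Copies of \<Gamma> indexed by words\<close>

context hnn_core_free
begin

text \<open>On the copy of \<open>\<Gamma>\<close> indexed by a nonempty word \<open>u\<close>, the stable letter is prescribed to act by
  left multiplication on the \<open>K\<close>-orbits of all suffixes of \<open>u\<close>: then \<open>u\<close> moves the neutral element of
  that copy to \<open>cls u\<close>. The copy indexed by the empty word is the supply of fresh points for the
  back and forth.\<close>

definition prescribed_translation ::
    "(('a hnn_letter list set \<times> 'a hnn_letter list) \<times> ('a hnn_letter list set \<times> 'a hnn_letter list)) set" where
  "prescribed_translation = {((g, u), (stable \<otimes>\<^bsub>\<Gamma>\<^esub> g, u)) | g u. u \<in> hnn_words H \<and> u \<noteq> [] \<and>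
     (\<exists>\<sigma>\<in>K. \<exists>i\<le>length u. g = base \<sigma> \<otimes>\<^bsub>\<Gamma>\<^esub> cls (drop i u))}"

lemma cls_drop_closed: "u \<in> hnn_words H \<Longrightarrow> cls (drop i u) \<in> carrier \<Gamma>"
  by (auto simp: carrier_HNN hnn_words_def dest: in_set_dropD)

lemma free_act_Gamma_copies:
  "free_act H (carrier \<Gamma> \<times> hnn_words H) (\<lambda>h (g, u). (base h \<otimes>\<^bsub>\<Gamma>\<^esub> g, u))"
proof -
  interpret G: group \<Gamma> by (rule group_HNN)
  show ?thesis
  proof unfold_locales
    fix h x assume "h \<in> carrier H" "x \<in> carrier \<Gamma> \<times> hnn_words H"
      and eq: "(case x of (g, u) \<Rightarrow> (base h \<otimes>\<^bsub>\<Gamma>\<^esub> g, u)) = x"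
    then have "base h = base \<one>"
      using base_closed G.r_cancel_one by (auto simp: base_one)
    then show "h = \<one>"
      using inj_onD[OF base_inj] \<open>h \<in> carrier H\<close> by blast
  qed (auto simp: base_closed base_one base_mult G.m_assoc)
qed

text \<open>A restriction of left multiplication by \<open>stable\<close> is injective and
  compatible with the two actions. Its domain is a union of \<open>K\<close>-orbits because \<sigma>
  runs over all of \<open>K\<close>.\<close>

lemma partial_iso_prescribed_translation:
  "equivariant_relation.partial_iso L (carrier \<Gamma> \<times> hnn_words H)
     (\<lambda>h (g, u). (base h \<otimes>\<^bsub>\<Gamma>\<^esub> g, u)) (\<lambda>h (g, u). (base (\<theta> h) \<otimes>\<^bsub>\<Gamma>\<^esub> g, u)) prescribed_translation"
proof -
  interpret G: group \<Gamma> by (rule group_HNN)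
  interpret A: free_act L "carrier \<Gamma> \<times> hnn_words H" "\<lambda>h (g, u). (base h \<otimes>\<^bsub>\<Gamma>\<^esub> g, u)"
    by (rule free_act_K[OF free_act_Gamma_copies])
  interpret B: free_act L "carrier \<Gamma> \<times> hnn_words H" "\<lambda>h (g, u). (base (\<theta> h) \<otimes>\<^bsub>\<Gamma>\<^esub> g, u)"
    by (rule free_act_theta[OF free_act_Gamma_copies])
  interpret equivariant_relation L "carrier \<Gamma> \<times> hnn_words H"
    "\<lambda>h (g, u). (base h \<otimes>\<^bsub>\<Gamma>\<^esub> g, u)" "\<lambda>h (g, u). (base (\<theta> h) \<otimes>\<^bsub>\<Gamma>\<^esub> g, u)" ..
  have closed: "g \<in> carrier \<Gamma>" if "((g, u), y) \<in> prescribed_translation" for g u y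
    using that base_closed K_carrier cls_drop_closed by (auto simp: prescribed_translation_def)
  have "prescribed_translation \<subseteq> (carrier \<Gamma> \<times> hnn_words H) \<times> (carrier \<Gamma> \<times> hnn_words H)"
    using base_closed K_carrier cls_drop_closed stable_closed by (auto simp: prescribed_translation_def)
  moreover have "single_valued prescribed_translation"
    by (auto simp: single_valued_def prescribed_translation_def)
  moreover have "single_valued (prescribed_translation\<inverse>)"
  proof (rule single_valuedI)
    fix x y z assume xyz: "(x, y) \<in> prescribed_translation\<inverse>" "(x, z) \<in> prescribed_translation\<inverse>"
    then obtain g h u where "y = (g, u)" "z = (h, u)" "stable \<otimes>\<^bsub>\<Gamma>\<^esub> g = stable \<otimes>\<^bsub>\<Gamma>\<^esub> h"
        "g \<in> carrier \<Gamma>" "h \<in> carrier \<Gamma>"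
    proof -
      obtain g h u where "y = (g, u)" "z = (h, u)" "x = (stable \<otimes>\<^bsub>\<Gamma>\<^esub> g, u)" "x = (stable \<otimes>\<^bsub>\<Gamma>\<^esub> h, u)"
        using xyz unfolding prescribed_translation_def by auto
      then show thesis
        using that[of g u h] closed[of g u x] closed[of h u x] xyz by simp
    qed
    then show "y = z"
      using stable_closed by simp
  qed
  moreover have "((base \<tau> \<otimes>\<^bsub>\<Gamma>\<^esub> g, u), (base (\<theta> \<tau>) \<otimes>\<^bsub>\<Gamma>\<^esub> g', u')) \<in> prescribed_translation"
    if mem: "((g, u), (g', u')) \<in> prescribed_translation" and \<tau>: "\<tau> \<in> K" for \<tau> g u g' u'
  proof -
    obtain \<sigma> i where s: "\<sigma> \<in> K" "i \<le> length u" "g = base \<sigma> \<otimes>\<^bsub>\<Gamma>\<^esub> cls (drop i u)"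
        "u \<in> hnn_words H" "u \<noteq> []" "u' = u" "g' = stable \<otimes>\<^bsub>\<Gamma>\<^esub> g"
      using mem by (auto simp: prescribed_translation_def)
    have "base \<tau> \<otimes>\<^bsub>\<Gamma>\<^esub> g = base (\<tau> \<otimes> \<sigma>) \<otimes>\<^bsub>\<Gamma>\<^esub> cls (drop i u)"
      using s \<tau> K_carrier base_closed cls_drop_closed by (simp add: base_mult G.m_assoc)
    moreover have "\<tau> \<otimes> \<sigma> \<in> K"
      using s \<tau> subgroup.m_closed[OF subgroup_K] by blast
    moreover have "base (\<theta> \<tau>) \<otimes>\<^bsub>\<Gamma>\<^esub> g' = stable \<otimes>\<^bsub>\<Gamma>\<^esub> (base \<tau> \<otimes>\<^bsub>\<Gamma>\<^esub> g)"
      using s(7) stable_base_mult[OF \<tau> closed[OF mem]] by simp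
    ultimately show ?thesis
      using s unfolding prescribed_translation_def by blast
  qed
  ultimately show ?thesis
    by (auto simp: partial_iso_def)
qed

text \<open>Infinitely many orbits are prescribed altogether, but an H-orbit stays within one copy,
  where at most \<open>length u + 1\<close> of them occur. Avoiding these is again avoiding
  \<open>K <#> F\<close> for a larger finite \<open>F\<close>.\<close>

lemma escape_prescribed_translation:
  assumes z: "z \<in> carrier \<Gamma> \<times> hnn_words H" and F: "finite F" "F \<subseteq> carrier H"
  shows "\<exists>h\<in>carrier H. h \<notin> K <#> F \<and>
           (case z of (g, u) \<Rightarrow> (base h \<otimes>\<^bsub>\<Gamma>\<^esub> g, u)) \<notin> Domain prescribed_translation"
    and "\<exists>h\<in>carrier H. h \<notin> (\<theta> ` K) <#> F \<and>
           (case z of (g, u) \<Rightarrow> (base h \<otimes>\<^bsub>\<Gamma>\<^esub> g, u)) \<notin> Range prescribed_translation"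
proof -
  interpret G: group \<Gamma> by (rule group_HNN)
  interpret free_act H "carrier \<Gamma> \<times> hnn_words H" "\<lambda>h (g, u). (base h \<otimes>\<^bsub>\<Gamma>\<^esub> g, u)"
    by (rule free_act_Gamma_copies)
  obtain g0 u where z_eq: "z = (g0, u)" by fastforce
  have u: "u \<in> hnn_words H"
    using z z_eq by simp
  let ?D = "(\<lambda>i. (cls (drop i u), u)) ` {..length u}"
  let ?R = "(\<lambda>i. (stable \<otimes>\<^bsub>\<Gamma>\<^esub> cls (drop i u), u)) ` {..length u}"
  let ?T = "\<lambda>S. {h \<in> carrier H. \<exists>y\<in>{z}. (case y of (g, u) \<Rightarrow> (base h \<otimes>\<^bsub>\<Gamma>\<^esub> g, u)) \<in> S}"
  have D: "finite ?D" "?D \<subseteq> carrier \<Gamma> \<times> hnn_words H"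
    and R: "finite ?R" "?R \<subseteq> carrier \<Gamma> \<times> hnn_words H"
    using u cls_drop_closed stable_closed by auto
  have fin: "finite (F \<union> ?T S)" "F \<union> ?T S \<subseteq> carrier H" if "finite S" for S
    using F finite_transporters[of "{z}" S] that z by auto
  have mono: "J <#> F \<subseteq> J <#> (F \<union> F')" "J <#> F' \<subseteq> J <#> (F \<union> F')" for J F'
    by (auto simp: set_mult_def)
  obtain h where h: "h \<in> carrier H" "h \<notin> K <#> (F \<union> ?T ?D)"
    using H.highly_core_free_not_covered[OF infinite_H subgroup_K core_free_K fin[OF D(1)]] by blast
  have "(base h \<otimes>\<^bsub>\<Gamma>\<^esub> g0, u) \<notin> Domain prescribed_translation"
  proof
    assume "(base h \<otimes>\<^bsub>\<Gamma>\<^esub> g0, u) \<in> Domain prescribed_translation"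
    then obtain \<sigma> i where "\<sigma> \<in> K" "i \<le> length u" "base h \<otimes>\<^bsub>\<Gamma>\<^esub> g0 = base \<sigma> \<otimes>\<^bsub>\<Gamma>\<^esub> cls (drop i u)"
      by (auto simp: prescribed_translation_def)
    moreover have "h \<notin> K <#> ?T ?D"
      using h(2) mono(2)[of K "?T ?D"] by blast
    ultimately show False
      using avoid_orbit[OF subgroup_K _ D(2) h(1), of "{z}" z \<sigma> "(cls (drop i u), u)"] z z_eq by auto
  qed
  moreover have "h \<notin> K <#> F"
    using h(2) mono(1)[of "K" "?T ?D"] by blast
  ultimately show "\<exists>h\<in>carrier H. h \<notin> K <#> F \<and>
           (case z of (g, u) \<Rightarrow> (base h \<otimes>\<^bsub>\<Gamma>\<^esub> g, u)) \<notin> Domain prescribed_translation"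
    using h(1) unfolding z_eq prod.case by blast
  obtain h where h: "h \<in> carrier H" "h \<notin> (\<theta> ` K) <#> (F \<union> ?T ?R)"
    using H.highly_core_free_not_covered[OF infinite_H subgroup_theta core_free_theta fin[OF R(1)]]
    by blast
  have "(base h \<otimes>\<^bsub>\<Gamma>\<^esub> g0, u) \<notin> Range prescribed_translation"
  proof
    assume "(base h \<otimes>\<^bsub>\<Gamma>\<^esub> g0, u) \<in> Range prescribed_translation"
    then obtain \<sigma> i where s: "\<sigma> \<in> K" "i \<le> length u"
        "base h \<otimes>\<^bsub>\<Gamma>\<^esub> g0 = stable \<otimes>\<^bsub>\<Gamma>\<^esub> (base \<sigma> \<otimes>\<^bsub>\<Gamma>\<^esub> cls (drop i u))"
      unfolding prescribed_translation_def by blast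
    then have "base h \<otimes>\<^bsub>\<Gamma>\<^esub> g0 = base (\<theta> \<sigma>) \<otimes>\<^bsub>\<Gamma>\<^esub> (stable \<otimes>\<^bsub>\<Gamma>\<^esub> cls (drop i u))"
      using stable_base_mult[OF s(1) cls_drop_closed[OF u]] by simp
    moreover have "h \<notin> (\<theta> ` K) <#> ?T ?R"
      using h(2) mono(2)[of "\<theta> ` K" "?T ?R"] by blast
    ultimately show False
      using avoid_orbit[OF subgroup_theta _ R(2) h(1), of "{z}" z "\<theta> \<sigma>"
          "(stable \<otimes>\<^bsub>\<Gamma>\<^esub> cls (drop i u), u)"] z z_eq s by auto
  qed
  moreover have "h \<notin> (\<theta> ` K) <#> F"
    using h(2) mono(1)[of "(\<theta> ` K)" "?T ?R"] by blast
  ultimately show "\<exists>h\<in>carrier H. h \<notin> (\<theta> ` K) <#> F \<and>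
           (case z of (g, u) \<Rightarrow> (base h \<otimes>\<^bsub>\<Gamma>\<^esub> g, u)) \<notin> Range prescribed_translation"
    using h(1) unfolding z_eq prod.case by blast
qed

text \<open>The word is read from its last letter, each suffix carrying the neutral element to its
  own class. \<open>Stable\<close> at position \<open>i\<close> uses the prescription for suffix
  \<open>Suc i\<close>, \<open>StableInv\<close> uses the one for suffix \<open>i\<close> backwards.
  Hence both the empty suffix and the full word must be among the prescribed ones. The map
  \<open>e\<close> embeds the copies into the larger set.\<close>

lemma prescribed_translation_moves:
  assumes act: "group_action \<Gamma> X \<phi>" and e: "\<And>x. x \<in> carrier \<Gamma> \<times> hnn_words H \<Longrightarrow> e x \<in> X"
    and base: "\<And>h g u. h \<in> carrier H \<Longrightarrow> g \<in> carrier \<Gamma> \<Longrightarrow> u \<in> hnn_words H \<Longrightarrow>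
        \<phi> (base h) (e (g, u)) = e (base h \<otimes>\<^bsub>\<Gamma>\<^esub> g, u)"
    and stable: "\<And>x y. (x, y) \<in> prescribed_translation \<Longrightarrow> \<phi> stable (e x) = e y"
    and u: "u \<in> hnn_words H" "u \<noteq> []"
  shows "\<phi> (cls u) (e (\<one>\<^bsub>\<Gamma>\<^esub>, u)) = e (cls u, u)"
proof -
  interpret group_action \<Gamma> X \<phi> by fact
  interpret G: group \<Gamma> by (rule group_HNN)
  have eX: "e (g, u) \<in> X" if "g \<in> carrier \<Gamma>" for g
    using e u that by blast
  have pres: "\<phi> stable (e (cls (drop i u), u)) = e (stable \<otimes>\<^bsub>\<Gamma>\<^esub> cls (drop i u), u)"
    if "i \<le> length u" for i
  proof (rule stable)
    have "cls (drop i u) = base \<one> \<otimes>\<^bsub>\<Gamma>\<^esub> cls (drop i u)"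
      using cls_drop_closed[OF u(1)] by (simp add: base_one)
    then show "((cls (drop i u), u), stable \<otimes>\<^bsub>\<Gamma>\<^esub> cls (drop i u), u) \<in> prescribed_translation"
      unfolding prescribed_translation_def using u that subgroup.one_closed[OF subgroup_K] by blast
  qed
  have "\<phi> (cls (drop i u)) (e (\<one>\<^bsub>\<Gamma>\<^esub>, u)) = e (cls (drop i u), u)" if "i \<le> length u" for i
    using that
  proof (induction rule: inc_induct)
    case base
    have "\<phi> \<one>\<^bsub>\<Gamma>\<^esub> (e (\<one>\<^bsub>\<Gamma>\<^esub>, u)) = e (\<one>\<^bsub>\<Gamma>\<^esub>, u)"
      using fun_cong[OF id_eq_one, of "e (\<one>\<^bsub>\<Gamma>\<^esub>, u)"] eX by simp
    then show ?case
      by (simp add: one_HNN)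
  next
    case (step i)
    let ?x = "cls (drop (Suc i) u)"
    have x: "?x \<in> carrier \<Gamma>"
      using cls_drop_closed[OF u(1)] .
    have drop: "drop i u = u ! i # drop (Suc i) u"
      using step.hyps by (simp add: Cons_nth_drop_Suc)
    have word: "u ! i # drop (Suc i) u \<in> hnn_words H"
      unfolding drop[symmetric] using u(1) by (auto simp: hnn_words_def dest: in_set_dropD)
    have comp: "\<phi> (g \<otimes>\<^bsub>\<Gamma>\<^esub> ?x) (e (\<one>\<^bsub>\<Gamma>\<^esub>, u)) = \<phi> g (e (?x, u))" if "g \<in> carrier \<Gamma>" for g
      using composition_rule[OF eX that x] step.IH by simp
    show ?case
    proof (cases "u ! i")
      case (Base h)
      then have h: "h \<in> carrier H" using word by simp
      have "cls (drop i u) = base h \<otimes>\<^bsub>\<Gamma>\<^esub> ?x"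
        unfolding drop cls_Cons[OF word] by (simp add: Base)
      then show ?thesis
        using comp[OF base_closed[OF h]] assms(3)[OF h x u(1)] by simp
    next
      case Stable
      have "cls (drop i u) = stable \<otimes>\<^bsub>\<Gamma>\<^esub> ?x"
        unfolding drop cls_Cons[OF word] by (simp add: Stable)
      then show ?thesis
        using comp[OF stable_closed] pres[of "Suc i"] step.hyps by simp
    next
      case StableInv
      have eq: "cls (drop i u) = inv\<^bsub>\<Gamma>\<^esub> stable \<otimes>\<^bsub>\<Gamma>\<^esub> ?x"
        unfolding drop cls_Cons[OF word] by (simp add: StableInv)
      then have "stable \<otimes>\<^bsub>\<Gamma>\<^esub> cls (drop i u) = ?x"
        using x stable_closed by (simp flip: G.m_assoc)
      then have "\<phi> stable (e (cls (drop i u), u)) = e (?x, u)"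
        using pres[of i] step.hyps by simp
      then have "\<phi> (inv\<^bsub>\<Gamma>\<^esub> stable) (e (?x, u)) = e (cls (drop i u), u)"
        using orbit_sym_aux[OF stable_closed eX[OF cls_drop_closed[OF u(1)]]] by blast
      then show ?thesis
        using comp[of "inv\<^bsub>\<Gamma>\<^esub> stable"] eq stable_closed by simp
    qed
  qed
  from this[of 0] show ?thesis by simp
qed

text \<open>The summand \<open>O'\<close> with its partial bijection \<open>Q\<close> is a
  parameter: empty for the first assertion, the carrier of the mean in the amenable case. Both
  summands are H-invariant, so escape is checked in the one containing the point.\<close>

theorem exists_faithful_highly_transitive_action:
  fixes O' :: "'o set"
  assumes act: "free_act H O' b" and countable: "countable O'"
    and Q: "equivariant_relation.partial_iso L O' b (\<lambda>k. b (\<theta> k)) Q"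
    and escape_Domain: "\<And>z F. z \<in> O' \<Longrightarrow> finite F \<Longrightarrow> F \<subseteq> carrier H \<Longrightarrow>
      \<exists>h\<in>carrier H. h \<notin> K <#> F \<and> b h z \<notin> Domain Q"
    and escape_Range: "\<And>z F. z \<in> O' \<Longrightarrow> finite F \<Longrightarrow> F \<subseteq> carrier H \<Longrightarrow>
      \<exists>h\<in>carrier H. h \<notin> (\<theta> ` K) <#> F \<and> b h z \<notin> Range Q"
  shows "\<exists>(X :: (('a hnn_letter list set \<times> 'a hnn_letter list) + 'o) set) \<phi>.
    countable X \<and> infinite X \<and> faithful_action \<Gamma> X \<phi> \<and> highly_transitive \<Gamma> X \<phi> \<and> Inr ` O' \<subseteq> X \<and>
    (\<forall>h\<in>carrier H. \<forall>z\<in>O'. \<phi> (base h) (Inr z) = Inr (b h z)) \<and>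
    (\<forall>(x, y)\<in>Q. \<phi> stable (Inr x) = Inr y)"
proof -
  interpret G: group \<Gamma> by (rule group_HNN)
  let ?Y = "carrier \<Gamma> \<times> hnn_words H" and ?c = "\<lambda>h (g, u). (base h \<otimes>\<^bsub>\<Gamma>\<^esub> g, u :: 'a hnn_letter list)"
  define X :: "(('a hnn_letter list set \<times> 'a hnn_letter list) + 'o) set"
    where "X = ?Y <+> O'"
  define a where "a h = map_sum (?c h) (b h)" for h
  define P0 where "P0 = map_prod Inl Inl ` prescribed_translation \<union> map_prod Inr Inr ` Q"
  define Y0 :: "(('a hnn_letter list set \<times> 'a hnn_letter list) + 'o) set"
    where "Y0 = Inl ` (carrier \<Gamma> \<times> {[]})"
  interpret C: free_act H ?Y ?c by (rule free_act_Gamma_copies)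
  interpret O: free_act H O' b by fact
  have a_simps: "a h (Inl x) = Inl (?c h x)" "a h (Inr z) = Inr (b h z)" for h x z
    by (simp_all add: a_def)
  interpret a: free_act H X a
  proof unfold_locales
    show "a g x \<in> X" if "g \<in> carrier H" "x \<in> X" for g x
      using that base_closed O.act_closed by (auto simp: X_def a_simps)
    show "a \<one> x = x" if "x \<in> X" for x
      using that O.act_one by (auto simp: X_def a_simps base_one)
    show "a (g \<otimes> h) x = a g (a h x)" if "g \<in> carrier H" "h \<in> carrier H" "x \<in> X" for g h x
      using that by (auto simp: X_def a_simps base_mult base_closed G.m_assoc O.act_mult)
    show "g = \<one>" if g: "g \<in> carrier H" "x \<in> X" "a g x = x" for g x
    proof (cases x)
      case (Inl y)
      then have "y \<in> ?Y"
        using g(2) by (auto simp: X_def)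
      then show ?thesis
        using C.act_free[OF g(1)] g(3) unfolding Inl a_simps sum.inject by blast
    next
      case (Inr z)
      then have "z \<in> O'"
        using g(2) by (auto simp: X_def)
      then show ?thesis
        using O.act_free[OF g(1)] g(3) unfolding Inr a_simps sum.inject by blast
    qed
  qed
  interpret aA: free_act L X a by (rule free_act_K[OF a.free_act_axioms])
  interpret aB: free_act L X "\<lambda>k. a (\<theta> k)" by (rule free_act_theta[OF a.free_act_axioms])
  interpret CA: free_act L ?Y ?c by (rule free_act_K[OF C.free_act_axioms])
  interpret CB: free_act L ?Y "\<lambda>k. ?c (\<theta> k)" by (rule free_act_theta[OF C.free_act_axioms])
  interpret OA: free_act L O' b by (rule free_act_K[OF O.free_act_axioms])
  interpret OB: free_act L O' "\<lambda>k. b (\<theta> k)" by (rule free_act_theta[OF O.free_act_axioms])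
  interpret a: equivariant_relation L X a "\<lambda>k. a (\<theta> k)" ..
  interpret C: equivariant_relation L ?Y ?c "\<lambda>k. ?c (\<theta> k)" ..
  interpret O: equivariant_relation L O' b "\<lambda>k. b (\<theta> k)" ..
  have P0_simps: "(Inl x, y) \<in> P0 \<longleftrightarrow> (\<exists>x'. y = Inl x' \<and> (x, x') \<in> prescribed_translation)"
    "(x', Inl y') \<in> P0 \<longleftrightarrow> (\<exists>y. x' = Inl y \<and> (y, y') \<in> prescribed_translation)"
    "(Inr z, y) \<in> P0 \<longleftrightarrow> (\<exists>z'. y = Inr z' \<and> (z, z') \<in> Q)"
    "(x', Inr z') \<in> P0 \<longleftrightarrow> (\<exists>z. x' = Inr z \<and> (z, z') \<in> Q)" for x y z x' y' z'
    by (auto simp: P0_def)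
  note isoC = partial_iso_prescribed_translation[unfolded C.partial_iso_def]
    and isoO = Q[unfolded O.partial_iso_def]
  have P0: "a.partial_iso P0"
    unfolding a.partial_iso_def
  proof (intro conjI)
    show "P0 \<subseteq> X \<times> X"
      using isoC isoO by (fastforce simp: P0_def X_def)
    have disj: "Domain (map_prod Inl Inl ` R) \<inter> Domain (map_prod Inr Inr ` S) = {}" for R S
      by auto
    show "single_valued P0"
      unfolding P0_def using isoC isoO
      by (intro single_valued_Un single_valued_map_prod disj) auto
    show "single_valued (P0\<inverse>)"
      unfolding P0_def converse_Un converse_map_prod using isoC isoO
      by (intro single_valued_Un single_valued_map_prod disj) auto
    have "(a k (Inl x), a (\<theta> k) (Inl y)) \<in> P0"
      if "(x, y) \<in> prescribed_translation" "k \<in> carrier L" for k x y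
      using that isoC unfolding a_simps P0_simps by blast
    moreover have "(a k (Inr x), a (\<theta> k) (Inr y)) \<in> P0" if "(x, y) \<in> Q" "k \<in> carrier L" for k x y
      using that isoO unfolding a_simps P0_simps by blast
    ultimately show "\<forall>(x, y)\<in>P0. \<forall>k\<in>carrier L. (a k x, a (\<theta> k) y) \<in> P0"
      unfolding P0_def by fastforce
  qed
  have "countable X"
    using countable_HNN[OF countable_H] countable by (auto simp: X_def Plus_def)
  have "Y0 \<subseteq> X"
    by (auto simp: Y0_def X_def)
  have "inj_on (\<lambda>h. a h (Inl (\<one>\<^bsub>\<Gamma>\<^esub>, []))) (carrier H)"
    by (rule inj_onI, rule a.act_cancel) (auto simp: X_def)
  moreover have "(\<lambda>h. a h (Inl (\<one>\<^bsub>\<Gamma>\<^esub>, []))) ` carrier H \<subseteq> X"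
    using a.act_closed[of _ "Inl (\<one>\<^bsub>\<Gamma>\<^esub>, [])"] unfolding X_def by fastforce
  ultimately have "infinite X"
    using infinite_H by (meson inj_on_finite)
  have "\<exists>w. bij_betw w X X \<and> (\<forall>\<sigma>\<in>K. \<forall>x\<in>X. w (a \<sigma> x) = a (\<theta> \<sigma>) (w x)) \<and>
    (\<forall>(x, y)\<in>P0. w x = y) \<and>
    (\<forall>xs ys. set xs \<subseteq> X \<longrightarrow> distinct xs \<longrightarrow> set ys \<subseteq> X \<longrightarrow> distinct ys \<longrightarrow> length xs = length ys \<longrightarrow>
       linked X (a ` carrier H) {(x, w x) | x. x \<in> X} xs ys)"
  proof (rule exists_highly_transitive_bijection[OF a.free_act_axioms \<open>countable X\<close> \<open>Y0 \<subseteq> X\<close> _ _ P0])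
    show "Y0 \<noteq> {}"
      using G.one_closed unfolding Y0_def by blast
    show "a g y \<in> Y0" if "g \<in> carrier H" "y \<in> Y0" for g y
      using that base_closed by (auto simp: Y0_def a_simps)
    show "Y0 \<inter> Domain P0 = {}" "Y0 \<inter> Range P0 = {}"
      by (auto simp: Y0_def P0_simps prescribed_translation_def)
    show "\<exists>h\<in>carrier H. h \<notin> K <#> F \<and> a h z \<notin> Domain P0"
      if z: "z \<in> X" "finite F" "F \<subseteq> carrier H" for z F
    proof (cases z)
      case (Inl x)
      then have "x \<in> ?Y"
        using z by (auto simp: X_def)
      then obtain h where h: "h \<in> carrier H" "h \<notin> K <#> F" "?c h x \<notin> Domain prescribed_translation"
        using escape_prescribed_translation(1) z by blast
      then have "a h z \<notin> Domain P0"
        unfolding Inl a_simps Domain_iff P0_simps by blast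
      then show ?thesis
        using h by blast
    next
      case (Inr x)
      then have "x \<in> O'"
        using z by (auto simp: X_def)
      then obtain h where h: "h \<in> carrier H" "h \<notin> K <#> F" "b h x \<notin> Domain Q"
        using escape_Domain z by blast
      then have "a h z \<notin> Domain P0"
        unfolding Inr a_simps Domain_iff P0_simps by blast
      then show ?thesis
        using h by blast
    qed
    show "\<exists>h\<in>carrier H. h \<notin> (\<theta> ` K) <#> F \<and> a h z \<notin> Range P0"
      if z: "z \<in> X" "finite F" "F \<subseteq> carrier H" for z F
    proof (cases z)
      case (Inl x)
      then have "x \<in> ?Y"
        using z by (auto simp: X_def)
      then obtain h where h: "h \<in> carrier H" "h \<notin> (\<theta> ` K) <#> F" "?c h x \<notin> Range prescribed_translation"
        using escape_prescribed_translation(2) z by blast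
      then have "a h z \<notin> Range P0"
        unfolding Inl a_simps Range_iff P0_simps by blast
      then show ?thesis
        using h by blast
    next
      case (Inr x)
      then have "x \<in> O'"
        using z by (auto simp: X_def)
      then obtain h where h: "h \<in> carrier H" "h \<notin> (\<theta> ` K) <#> F" "b h x \<notin> Range Q"
        using escape_Range z by blast
      then have "a h z \<notin> Range P0"
        unfolding Inr a_simps Range_iff P0_simps by blast
      then show ?thesis
        using h by blast
    qed
  qed
  then obtain w where w: "bij_betw w X X" "\<forall>\<sigma>\<in>K. \<forall>x\<in>X. w (a \<sigma> x) = a (\<theta> \<sigma>) (w x)"
      "\<forall>(x, y)\<in>P0. w x = y"
    and lk: "\<forall>xs ys. set xs \<subseteq> X \<longrightarrow> distinct xs \<longrightarrow> set ys \<subseteq> X \<longrightarrow> distinct ys \<longrightarrow>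
      length xs = length ys \<longrightarrow> linked X (a ` carrier H) {(x, w x) | x. x \<in> X} xs ys"
    by (elim exE conjE)
  obtain \<phi> where \<phi>: "group_action \<Gamma> X \<phi>" "\<forall>g\<in>carrier H. \<forall>x\<in>X. \<phi> (base g) x = a g x"
      "\<forall>x\<in>X. \<phi> stable x = w x"
    using exists_HNN_action[OF a.free_act_axioms w(1)] w(2) by blast
  have stable_P0: "\<phi> stable x = y" if "(x, y) \<in> P0" for x y
    using that P0 \<phi>(3) w(3) by (auto simp: a.partial_iso_def)
  have "highly_transitive \<Gamma> X \<phi>"
    using linked_imp_HNN_orbit[OF \<phi>(1-3)] lk by (intro highly_transitiveI) blast
  moreover have "\<gamma> = \<one>\<^bsub>\<Gamma>\<^esub>" if fixes_X: "\<gamma> \<in> carrier \<Gamma>" "\<forall>x\<in>X. \<phi> \<gamma> x = x" for \<gamma>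
  proof -
    obtain u where u: "u \<in> hnn_words H" "\<gamma> = cls u"
      using fixes_X(1) by (auto simp: carrier_HNN)
    show ?thesis
    proof (cases "u = []")
      case True
      then show ?thesis using u by (simp add: one_HNN)
    next
      case False
      \<comment> \<open>The copy indexed by a word representing \<gamma> detects \<gamma>: fixing
        its base point forces \<open>cls u\<close> to be neutral.\<close>
      have "\<phi> (cls u) (Inl (\<one>\<^bsub>\<Gamma>\<^esub>, u)) = Inl (cls u, u)"
      proof (rule prescribed_translation_moves[OF \<phi>(1) _ _ _ u(1) False])
        show "Inl x \<in> X" if "x \<in> ?Y" for x
          using that by (auto simp: X_def)
        then show "\<phi> (base h) (Inl (g, u)) = Inl (base h \<otimes>\<^bsub>\<Gamma>\<^esub> g, u)"
          if "h \<in> carrier H" "g \<in> carrier \<Gamma>" "u \<in> hnn_words H" for h g u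
          using that \<phi>(2) by (simp add: a_simps)
        show "\<phi> stable (Inl x) = Inl y" if "(x, y) \<in> prescribed_translation" for x y
          using that stable_P0 by (simp add: P0_simps)
      qed
      moreover have "Inl (\<one>\<^bsub>\<Gamma>\<^esub>, u) \<in> X"
        using u by (auto simp: X_def)
      ultimately show ?thesis
        using fixes_X(2) u(2) by simp
    qed
  qed
  then have "faithful_action \<Gamma> X \<phi>"
    using \<phi>(1) by (simp add: faithful_action_iff)
  moreover have "\<forall>h\<in>carrier H. \<forall>z\<in>O'. \<phi> (base h) (Inr z) = Inr (b h z)"
    using \<phi>(2) InrI[of _ O' ?Y] unfolding X_def[symmetric] by (simp add: a_simps)
  moreover have "\<forall>(x, y)\<in>Q. \<phi> stable (Inr x) = Inr y"
    using stable_P0 by (auto simp: P0_simps)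
  moreover have "Inr ` O' \<subseteq> X"
    by (auto simp: X_def)
  ultimately show ?thesis
    using \<open>countable X\<close> \<open>infinite X\<close> by blast
qed

end

section \<open>Finitely additive measures\<close>

locale finitely_additive =
  fixes E :: "'x set" and \<mu> :: "'x set \<Rightarrow> real"
  assumes fin_add_prob: "fin_add_prob E \<mu>"
begin

lemma nonneg: "A \<subseteq> E \<Longrightarrow> 0 \<le> \<mu> A"
  and total: "\<mu> E = 1"
  and additive: "A \<subseteq> E \<Longrightarrow> B \<subseteq> E \<Longrightarrow> A \<inter> B = {} \<Longrightarrow> \<mu> (A \<union> B) = \<mu> A + \<mu> B"
  using fin_add_prob by (auto simp: fin_add_prob_def)

lemma empty [simp]: "\<mu> {} = 0"
  using additive[of "{}" "{}"] by simp

lemma diff: "A \<subseteq> B \<Longrightarrow> B \<subseteq> E \<Longrightarrow> \<mu> B = \<mu> A + \<mu> (B - A)"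
  using additive[of A "B - A"] by (auto simp: Un_absorb1)

lemma mono: "A \<subseteq> B \<Longrightarrow> B \<subseteq> E \<Longrightarrow> \<mu> A \<le> \<mu> B"
  using diff[of A B] nonneg[of "B - A"] by auto

lemma subadditive:
  assumes "A \<subseteq> E" "B \<subseteq> E"
  shows "\<mu> (A \<union> B) \<le> \<mu> A + \<mu> B"
proof -
  have "\<mu> (A \<union> B) = \<mu> A + \<mu> (B - A)"
    using assms additive[of A "B - A"] by auto
  also have "\<mu> (B - A) \<le> \<mu> B"
    using assms by (intro mono) auto
  finally show ?thesis by simp
qed

lemma UN_disjoint:
  "finite I \<Longrightarrow> (\<And>i. i \<in> I \<Longrightarrow> A i \<subseteq> E) \<Longrightarrow>
    (\<And>i j. i \<in> I \<Longrightarrow> j \<in> I \<Longrightarrow> i \<noteq> j \<Longrightarrow> A i \<inter> A j = {}) \<Longrightarrow> \<mu> (\<Union>i\<in>I. A i) = (\<Sum>i\<in>I. \<mu> (A i))"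
proof (induction I rule: finite_induct)
  case (insert i I)
  have "\<mu> (A i \<union> (\<Union>j\<in>I. A j)) = \<mu> (A i) + \<mu> (\<Union>j\<in>I. A j)"
    using insert.prems insert.hyps by (intro additive) blast+
  then show ?case
    using insert by simp
qed simp

lemma UN_null:
  "finite I \<Longrightarrow> (\<And>i. i \<in> I \<Longrightarrow> A i \<subseteq> E) \<Longrightarrow> (\<And>i. i \<in> I \<Longrightarrow> \<mu> (A i) = 0) \<Longrightarrow> \<mu> (\<Union>i\<in>I. A i) = 0"
proof (induction I rule: finite_induct)
  case (insert i I)
  have "(\<Union>j\<in>I. A j) \<subseteq> E" "A i \<subseteq> E" "\<mu> (\<Union>j\<in>I. A j) = 0" "\<mu> (A i) = 0"
    using insert by auto
  then have "\<mu> (A i \<union> (\<Union>j\<in>I. A j)) = 0"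
    using subadditive[of "A i" "\<Union>j\<in>I. A j"] nonneg[of "A i \<union> (\<Union>j\<in>I. A j)"] by simp
  then show ?case
    by simp
qed simp

lemma null_subset: "A \<subseteq> N \<Longrightarrow> N \<subseteq> E \<Longrightarrow> \<mu> N = 0 \<Longrightarrow> \<mu> A = 0"
  using mono[of A N] nonneg[of A] by auto

lemma eq_up_to_null:
  assumes "A \<subseteq> B" "B \<subseteq> A \<union> N" "A \<subseteq> E" "N \<subseteq> E" "\<mu> N = 0"
  shows "\<mu> B = \<mu> A"
proof -
  have "\<mu> (B - A) = 0"
    using assms by (auto intro: null_subset[of "B - A" N])
  then show ?thesis
    using diff[of A B] assms by auto
qed

text \<open>Repeated halving gives decreasing infinite sets \<open>f n\<close> of measure at most
  \<open>(1/2) ^ n\<close>. Their intersection may be empty, so distinct points \<open>x n\<close>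
  are picked diagonally. For each \<open>n\<close> all but finitely many of them lie in
  \<open>f n\<close>, and finite sets are null.\<close>

lemma exists_infinite_null_set:
  assumes inf: "infinite E" and fin: "\<And>F. finite F \<Longrightarrow> F \<subseteq> E \<Longrightarrow> \<mu> F = 0"
  shows "\<exists>B. infinite B \<and> B \<subseteq> E \<and> \<mu> B = 0"
proof -
  have half: "\<exists>B. (infinite B \<and> B \<subseteq> E \<and> \<mu> B \<le> (1/2) ^ Suc n) \<and> B \<subseteq> A"
    if A: "infinite A \<and> A \<subseteq> E \<and> \<mu> A \<le> (1/2) ^ n" for A n
  proof -
    have "infinite A"
      using A by simp
    then obtain B C where BC: "B \<subseteq> A" "C \<subseteq> A" "infinite B" "infinite C" "B \<inter> C = {}"
      by (rule infinite_split)
    then have "\<mu> B + \<mu> C = \<mu> (B \<union> C)"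
      using A additive[of B C] by auto
    also have "\<dots> \<le> (1/2) ^ n"
      using A BC mono[of "B \<union> C" A] by auto
    finally have "\<mu> B \<le> (1/2) ^ Suc n \<or> \<mu> C \<le> (1/2) ^ Suc n"
      by (auto simp: field_simps)
    then show ?thesis
      using BC A by blast
  qed
  have "\<exists>f. \<forall>n. (infinite (f n) \<and> f n \<subseteq> E \<and> \<mu> (f n) \<le> (1/2) ^ n) \<and> f (Suc n) \<subseteq> f n"
    using inf total half by (intro dependent_nat_choice) (auto intro: exI[of _ E])
  then obtain f where f: "\<And>n. infinite (f n)" "\<And>n. f n \<subseteq> E" "\<And>n. \<mu> (f n) \<le> (1/2) ^ n"
      "\<And>n. f (Suc n) \<subseteq> f n"
    by blast
  have anti: "f n \<subseteq> f m" if "m \<le> n" for m n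
    using that f(4) lift_Suc_antimono_le by blast
  \<comment> \<open>The state consists of the points already chosen and the next one, so that
    freshness is part of the invariant.\<close>
  have "\<exists>p. \<forall>n. (finite (fst (p n)) \<and> snd (p n) \<in> f n - fst (p n)) \<and>
      fst (p (Suc n)) = insert (snd (p n)) (fst (p n))"
  proof (rule dependent_nat_choice)
    obtain x where "x \<in> f 0"
      using f(1)[of 0] by fastforce
    then show "\<exists>p. finite (fst p) \<and> snd p \<in> f 0 - fst p"
      by (intro exI[of _ "({}, x)"]) simp
  next
    fix p :: "'x set \<times> 'x" and n
    assume p: "finite (fst p) \<and> snd p \<in> f n - fst p"
    then have "infinite (f (Suc n) - insert (snd p) (fst p))"
      using f(1) by (intro Diff_infinite_finite) auto
    then obtain x where "x \<in> f (Suc n) - insert (snd p) (fst p)"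
      by (metis ex_in_conv finite.emptyI)
    then show "\<exists>q. (finite (fst q) \<and> snd q \<in> f (Suc n) - fst q) \<and> fst q = insert (snd p) (fst p)"
      using p by (intro exI[of _ "(insert (snd p) (fst p), x)"]) simp
  qed
  then obtain p where p: "\<And>n. finite (fst (p n))" "\<And>n. snd (p n) \<in> f n - fst (p n)"
      "\<And>n. fst (p (Suc n)) = insert (snd (p n)) (fst (p n))"
    by blast
  define x where "x n = snd (p n)" for n
  have mem: "x m \<in> fst (p n)" if "m < n" for m n
    using that by (induction n) (auto simp: p(3) x_def less_Suc_eq)
  have "x m \<noteq> x n" if "m < n" for m n
    using mem[OF that] p(2)[of n] by (auto simp: x_def)
  then have "inj x"
    by (rule linorder_injI)
  then have "infinite (range x)"
    using finite_imageD by blast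
  moreover have xf: "x n \<in> f n" for n
    using p(2) by (simp add: x_def)
  then have sub: "range x \<subseteq> E"
    using f(2) by blast
  moreover have "\<mu> (range x) \<le> (1/2) ^ n" for n
  proof -
    have "x m \<in> f n \<union> x ` {..<n}" for m
      using xf[of m] anti[of n m] by (cases "m < n") auto
    then have "range x \<subseteq> f n \<union> x ` {..<n}"
      by blast
    moreover have "f n \<union> x ` {..<n} \<subseteq> E" "x ` {..<n} \<subseteq> E"
      using f(2) sub by auto
    ultimately have "\<mu> (range x) \<le> \<mu> (f n) + \<mu> (x ` {..<n})"
      using mono[of "range x" "f n \<union> x ` {..<n}"] subadditive[of "f n" "x ` {..<n}"] by auto
    then show ?thesis
      using f(3)[of n] fin[of "x ` {..<n}"] \<open>x ` {..<n} \<subseteq> E\<close> by simp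
  qed
  then have "\<mu> (range x) \<le> 0"
    by (intro LIMSEQ_le_const[of "\<lambda>n. (1/2 :: real) ^ n"] exI[of _ 0]) (auto intro: LIMSEQ_realpow_zero)
  then have "\<mu> (range x) = 0"
    using nonneg[OF sub] by simp
  ultimately show ?thesis
    by blast
qed

end

section \<open>Invariant means on a group\<close>

locale invariant_mean = finitely_additive "carrier H" \<mu> + group H
  for H :: "('a, 'b) monoid_scheme" (structure) and \<mu> +
  assumes translate: "g \<in> carrier H \<Longrightarrow> A \<subseteq> carrier H \<Longrightarrow> \<mu> ((\<otimes>) g ` A) = \<mu> A"
begin

text \<open>All points have the same mass by invariance. If it were positive, a large enough finite
  subset would have measure above 1.\<close>

lemma finite_null:
  assumes inf: "infinite (carrier H)" and F: "finite F" "F \<subseteq> carrier H"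
  shows "\<mu> F = 0"
proof -
  have single: "\<mu> {x} = \<mu> {\<one>}" if "x \<in> carrier H" for x
    using translate[OF that, of "{\<one>}"] that by simp
  have card: "\<mu> S = card S * \<mu> {\<one>}" if "finite S" "S \<subseteq> carrier H" for S
  proof -
    have "\<mu> S = (\<Sum>x\<in>S. \<mu> {x})"
      using UN_disjoint[of S "\<lambda>x. {x}"] that by (simp add: subset_iff)
    also have "\<dots> = (\<Sum>x\<in>S. \<mu> {\<one>})"
      using that(2) by (intro sum.cong single) auto
    finally show ?thesis by simp
  qed
  have "\<mu> {\<one>} = 0"
  proof (rule ccontr)
    assume "\<mu> {\<one>} \<noteq> 0"
    moreover have "\<mu> {\<one>} \<ge> 0"
      by (rule nonneg) simp
    ultimately have pos: "\<mu> {\<one>} > 0"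
      by simp
    obtain n :: nat where n: "1 < n * \<mu> {\<one>}"
      using reals_Archimedean3[OF pos] by blast
    obtain S where "finite S" "card S = n" "S \<subseteq> carrier H"
      using infinite_arbitrarily_large[OF inf] by blast
    then show False
      using n card[of S] mono[of S "carrier H"] total by simp
  qed
  then show ?thesis
    using card[OF F] by simp
qed

end

lemma amenable_group_invariant_mean:
  assumes "group H" "amenable_group H"
  shows "\<exists>\<mu>. invariant_mean H \<mu>"
proof -
  obtain \<mu> where \<mu>: "fin_add_prob (carrier H) \<mu>"
    "\<And>g A. g \<in> carrier H \<Longrightarrow> A \<subseteq> carrier H \<Longrightarrow> \<mu> ((\<lambda>x\<in>carrier H. g \<otimes>\<^bsub>H\<^esub> x) ` A) = \<mu> A"
    using assms(2) unfolding amenable_group_def amenable_action_def by blast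
  have "\<mu> ((\<otimes>\<^bsub>H\<^esub>) g ` A) = \<mu> A" if "g \<in> carrier H" "A \<subseteq> carrier H" for g A
  proof -
    have "(\<lambda>x\<in>carrier H. g \<otimes>\<^bsub>H\<^esub> x) ` A = (\<otimes>\<^bsub>H\<^esub>) g ` A"
      using that(2) by (intro image_cong) auto
    then show ?thesis
      using \<mu>(2)[OF that] by simp
  qed
  then show ?thesis
    using assms(1) \<mu>(1)
    by (intro exI[of _ \<mu>] invariant_mean.intro finitely_additive.intro invariant_mean_axioms.intro)
qed

section \<open>Exchanging two finite subgroups by piecewise translations\<close>

locale averaged_mean = invariant_mean H \<mu>
  for H :: "('a, 'b) monoid_scheme" (structure) and \<mu> +
  fixes K :: "'a set"
  assumes K: "subgroup K H" and finite_K: "finite K"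
begin

text \<open>Product of \<mu> with the uniform probability on \<open>K\<close>.\<close>

definition avg :: "('a \<times> 'a) set \<Rightarrow> real" where
  "avg A = (\<Sum>s\<in>K. \<mu> {x \<in> carrier H. (x, s) \<in> A}) / card K"

lemma card_K_pos: "card K > 0"
  using finite_K subgroup.one_closed[OF K] by (auto simp: card_gt_0_iff)

sublocale avg: finitely_additive "carrier H \<times> K" avg
proof
  show "fin_add_prob (carrier H \<times> K) avg"
    unfolding fin_add_prob_def
  proof (intro conjI allI impI)
    show "avg A \<ge> 0" for A
      unfolding avg_def by (intro divide_nonneg_nonneg sum_nonneg nonneg) auto
    have "\<mu> {x \<in> carrier H. (x, s) \<in> carrier H \<times> K} = 1" if "s \<in> K" for s
      using that total by simp
    then show "avg (carrier H \<times> K) = 1"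
      using card_K_pos by (simp add: avg_def)
    fix A B :: "('a \<times> 'a) set" assume "A \<inter> B = {}"
    then have "\<mu> {x \<in> carrier H. (x, s) \<in> A \<union> B} =
        \<mu> {x \<in> carrier H. (x, s) \<in> A} + \<mu> {x \<in> carrier H. (x, s) \<in> B}" for s
      using additive[of "{x \<in> carrier H. (x, s) \<in> A}" "{x \<in> carrier H. (x, s) \<in> B}"]
      by (auto simp: Collect_disj_eq[symmetric] conj_disj_distribL)
    then show "avg (A \<union> B) = avg A + avg B"
      by (simp add: avg_def sum.distrib add_divide_distrib)
  qed
qed

lemma avg_translate:
  assumes g: "g \<in> carrier H" and A: "A \<subseteq> carrier H \<times> K"
  shows "avg ((\<lambda>(x, s). (g \<otimes> x, s)) ` A) = avg A"
proof -
  have "{x \<in> carrier H. (x, s) \<in> (\<lambda>(x, s). (g \<otimes> x, s)) ` A} = (\<otimes>) g ` {x \<in> carrier H. (x, s) \<in> A}" for s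
    using g A by auto
  then show ?thesis
    using translate[OF g] by (simp add: avg_def)
qed

text \<open>With \<open>r\<close> a \<open>K\<close>-equivariant map, writing \<open>x = \<alpha> (r x) \<otimes> t\<close>, the map \<open>flip\<close> exchanges \<open>r x\<close> and
  \<open>s\<close>: it turns the translation action of \<open>\<alpha> K\<close> on the first coordinate into the translation action
  of \<open>K\<close> on the second, while being a piecewise translation.\<close>

definition flip :: "('a \<Rightarrow> 'a) \<Rightarrow> ('a \<Rightarrow> 'a) \<Rightarrow> 'a \<times> 'a \<Rightarrow> 'a \<times> 'a" where
  "flip \<alpha> r = (\<lambda>(x, s). (\<alpha> (s \<otimes> inv (r x)) \<otimes> x, r x))"

context
  fixes \<alpha> r
  assumes \<alpha>: "\<alpha> \<in> hom (H\<lparr>carrier := K\<rparr>) H"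
    and r: "\<And>x. x \<in> carrier H \<Longrightarrow> r x \<in> K"
    and r_equiv: "\<And>k x. k \<in> K \<Longrightarrow> x \<in> carrier H \<Longrightarrow> r (\<alpha> k \<otimes> x) = k \<otimes> r x"
begin

lemma K_simps: "k \<in> K \<Longrightarrow> k \<in> carrier H" "k \<in> K \<Longrightarrow> l \<in> K \<Longrightarrow> k \<otimes> l \<in> K" "k \<in> K \<Longrightarrow> inv k \<in> K"
  using subgroup.mem_carrier[OF K] subgroup.m_closed[OF K] subgroup.m_inv_closed[OF K] by auto

lemma \<alpha>_simps: "k \<in> K \<Longrightarrow> \<alpha> k \<in> carrier H" "k \<in> K \<Longrightarrow> l \<in> K \<Longrightarrow> \<alpha> (k \<otimes> l) = \<alpha> k \<otimes> \<alpha> l" "\<alpha> \<one> = \<one>"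
proof -
  show "k \<in> K \<Longrightarrow> \<alpha> k \<in> carrier H" "k \<in> K \<Longrightarrow> l \<in> K \<Longrightarrow> \<alpha> (k \<otimes> l) = \<alpha> k \<otimes> \<alpha> l"
    using \<alpha> by (auto simp: hom_def)
  show "\<alpha> \<one> = \<one>"
    using hom_one[OF \<alpha> subgroup.subgroup_is_group[OF K is_group] is_group] by simp
qed

lemma flip_closed: "z \<in> carrier H \<times> K \<Longrightarrow> flip \<alpha> r z \<in> carrier H \<times> K"
  by (auto simp: flip_def r \<alpha>_simps K_simps)

text \<open>The new first coordinate is the point of the orbit of \<open>x\<close> at position
  \<open>s\<close>, and the new second coordinate is the old position \<open>r x\<close>, so a
  second exchange undoes the first.\<close>

lemma flip_flip:
  assumes "z \<in> carrier H \<times> K"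
  shows "flip \<alpha> r (flip \<alpha> r z) = z"
proof -
  obtain x s where z: "z = (x, s)" "x \<in> carrier H" "s \<in> K"
    using assms by blast
  note rx = r[OF z(2)]
  have k: "s \<otimes> inv (r x) \<in> K" "r x \<otimes> inv s \<in> K"
    using z rx by (simp_all add: K_simps)
  have rs: "r (\<alpha> (s \<otimes> inv (r x)) \<otimes> x) = s"
    using k(1) z rx by (simp add: r_equiv m_assoc K_simps)
  have "\<alpha> (r x \<otimes> inv s) \<otimes> (\<alpha> (s \<otimes> inv (r x)) \<otimes> x) = \<alpha> ((r x \<otimes> inv s) \<otimes> (s \<otimes> inv (r x))) \<otimes> x"
    using \<alpha>_simps(1)[OF k(1)] \<alpha>_simps(1)[OF k(2)] z(2) by (simp only: \<alpha>_simps(2)[OF k(2) k(1)] m_assoc)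
  also have "(r x \<otimes> inv s) \<otimes> (s \<otimes> inv (r x)) = \<one>"
  proof -
    have "(r x \<otimes> inv s) \<otimes> (s \<otimes> inv (r x)) = r x \<otimes> (inv s \<otimes> s) \<otimes> inv (r x)"
      using rx z K_simps by (simp only: m_assoc inv_closed m_closed)
    then show ?thesis
      using rx z K_simps by simp
  qed
  finally show ?thesis
    using z rs \<alpha>_simps(3) by (simp add: flip_def)
qed

text \<open>Translating \<open>x\<close> by \<open>\<alpha> k\<close> changes its position to
  \<open>k \<otimes> r x\<close>, but not the point of its orbit at position \<open>s\<close>, which
  is the first coordinate of the image.\<close>

lemma flip_equivariant:
  assumes "k \<in> K" "x \<in> carrier H" "s \<in> K"
  shows "flip \<alpha> r (\<alpha> k \<otimes> x, s) = (fst (flip \<alpha> r (x, s)), k \<otimes> snd (flip \<alpha> r (x, s)))"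
proof -
  note rx = r[OF assms(2)]
  have "\<alpha> (s \<otimes> inv (k \<otimes> r x)) \<otimes> (\<alpha> k \<otimes> x) = \<alpha> (s \<otimes> inv (k \<otimes> r x) \<otimes> k) \<otimes> x"
    using assms rx by (simp add: \<alpha>_simps K_simps m_assoc)
  also have "s \<otimes> inv (k \<otimes> r x) \<otimes> k = s \<otimes> inv (r x)"
    using assms rx by (simp add: inv_mult_group K_simps m_assoc)
  finally show ?thesis
    using assms by (simp add: flip_def r_equiv)
qed

lemma flip_snd_mult:
  assumes "k \<in> K" "x \<in> carrier H" "s \<in> K"
  shows "flip \<alpha> r (x, k \<otimes> s) = (\<alpha> k \<otimes> fst (flip \<alpha> r (x, s)), snd (flip \<alpha> r (x, s)))"
proof -
  note rx = r[OF assms(2)]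
  have "\<alpha> (k \<otimes> s \<otimes> inv (r x)) = \<alpha> k \<otimes> \<alpha> (s \<otimes> inv (r x))"
    using assms rx by (simp add: \<alpha>_simps(2)[symmetric] K_simps m_assoc)
  then show ?thesis
    using assms rx by (simp add: flip_def \<alpha>_simps(1) K_simps(2,3) m_assoc)
qed

lemma flip_bij: "bij_betw (flip \<alpha> r) (carrier H \<times> K) (carrier H \<times> K)"
  using flip_closed flip_flip by (intro bij_betwI[where g = "flip \<alpha> r"]) auto

text \<open>Where \<open>r x = \<rho>\<close> and the second coordinate is \<open>s\<close>, the map
  translates by \<open>\<alpha> (s \<otimes> inv \<rho>)\<close>. There are finitely many such
  pieces and translations preserve \<mu>, so only the order of summation over rows and positions
  changes.\<close>

lemma avg_flip:
  assumes A: "A \<subseteq> carrier H \<times> K"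
  shows "avg (flip \<alpha> r ` A) = avg A"
proof -
  \<comment> \<open>The part of row \<rho> of \<open>A\<close> at position \<open>s\<close>;
    \<open>flip\<close> sends it to row \<open>s\<close> at position \<rho>.\<close>
  let ?P = "\<lambda>s \<rho>. {y \<in> carrier H. r y = s \<and> (y, \<rho>) \<in> A}"
  have "\<mu> {x \<in> carrier H. (x, s) \<in> flip \<alpha> r ` A} = (\<Sum>\<rho>\<in>K. \<mu> (?P s \<rho>))" if s: "s \<in> K" for s
  proof -
    let ?Q = "\<lambda>\<rho>. {x \<in> carrier H. r x = \<rho> \<and> (\<alpha> (s \<otimes> inv \<rho>) \<otimes> x, \<rho>) \<in> A}"
    have Q_eq: "\<mu> (?Q \<rho>) = \<mu> (?P s \<rho>)" if \<rho>: "\<rho> \<in> K" for \<rho>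
    proof -
      have k: "s \<otimes> inv \<rho> \<in> K" "\<rho> \<otimes> inv s \<in> K"
        using s \<rho> by (simp_all add: K_simps)
      have "?P s \<rho> = (\<otimes>) (\<alpha> (s \<otimes> inv \<rho>)) ` ?Q \<rho>"
      proof (intro equalityI subsetI)
        fix y assume y: "y \<in> ?P s \<rho>"
        have "(s \<otimes> inv \<rho>) \<otimes> (\<rho> \<otimes> inv s) = s \<otimes> (inv \<rho> \<otimes> \<rho>) \<otimes> inv s"
          using s \<rho> K_simps by (simp only: m_assoc inv_closed m_closed)
        then have "(s \<otimes> inv \<rho>) \<otimes> (\<rho> \<otimes> inv s) = \<one>"
          using s \<rho> K_simps by simp
        then have "\<alpha> (s \<otimes> inv \<rho>) \<otimes> \<alpha> (\<rho> \<otimes> inv s) = \<one>"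
          using \<alpha>_simps(2)[OF k] \<alpha>_simps(3) by simp
        then have eq: "\<alpha> (s \<otimes> inv \<rho>) \<otimes> (\<alpha> (\<rho> \<otimes> inv s) \<otimes> y) = y"
          using y k \<alpha>_simps(1) by (simp flip: m_assoc)
        moreover have "r (\<alpha> (\<rho> \<otimes> inv s) \<otimes> y) = \<rho>"
          using y k s \<rho> by (simp add: r_equiv m_assoc K_simps)
        ultimately have "\<alpha> (\<rho> \<otimes> inv s) \<otimes> y \<in> ?Q \<rho>"
          using y k \<alpha>_simps(1) by simp
        then show "y \<in> (\<otimes>) (\<alpha> (s \<otimes> inv \<rho>)) ` ?Q \<rho>"
          using eq by (intro image_eqI[of _ _ "\<alpha> (\<rho> \<otimes> inv s) \<otimes> y"]) simp_all
      next
        fix y assume "y \<in> (\<otimes>) (\<alpha> (s \<otimes> inv \<rho>)) ` ?Q \<rho>"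
        then obtain x where "x \<in> ?Q \<rho>" "y = \<alpha> (s \<otimes> inv \<rho>) \<otimes> x"
          by blast
        then show "y \<in> ?P s \<rho>"
          using k s \<rho> \<alpha>_simps(1) by (auto simp: r_equiv m_assoc K_simps)
      qed
      then show ?thesis
        using translate[OF \<alpha>_simps(1)[OF k(1)], of "?Q \<rho>"] by auto
    qed
    \<comment> \<open>Image and preimage of \<open>A\<close> agree because \<open>flip\<close> is an
      involution.\<close>
    have iff: "(x, s) \<in> flip \<alpha> r ` A \<longleftrightarrow> flip \<alpha> r (x, s) \<in> A" if x: "x \<in> carrier H" for x
    proof
      assume "(x, s) \<in> flip \<alpha> r ` A"
      then obtain z where "z \<in> A" "(x, s) = flip \<alpha> r z" by blast
      then show "flip \<alpha> r (x, s) \<in> A"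
        using flip_flip[of z] A by auto
    next
      assume "flip \<alpha> r (x, s) \<in> A"
      then have "flip \<alpha> r (flip \<alpha> r (x, s)) \<in> flip \<alpha> r ` A" by blast
      then show "(x, s) \<in> flip \<alpha> r ` A"
        using flip_flip[of "(x, s)"] x s by simp
    qed
    have "{x \<in> carrier H. (x, s) \<in> flip \<alpha> r ` A} = {x \<in> carrier H. flip \<alpha> r (x, s) \<in> A}"
      using iff by blast
    also have "\<dots> = (\<Union>\<rho>\<in>K. ?Q \<rho>)"
      using r by (auto simp: flip_def)
    also have "\<mu> \<dots> = (\<Sum>\<rho>\<in>K. \<mu> (?Q \<rho>))"
      using finite_K by (intro UN_disjoint) auto
    also have "\<dots> = (\<Sum>\<rho>\<in>K. \<mu> (?P s \<rho>))"
      using Q_eq by (intro sum.cong) simp_all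
    finally show ?thesis .
  qed
  then have "(\<Sum>s\<in>K. \<mu> {x \<in> carrier H. (x, s) \<in> flip \<alpha> r ` A}) = (\<Sum>s\<in>K. \<Sum>\<rho>\<in>K. \<mu> (?P s \<rho>))"
    by simp
  also have "\<dots> = (\<Sum>\<rho>\<in>K. \<Sum>s\<in>K. \<mu> (?P s \<rho>))"
    by (rule sum.swap)
  also have "\<dots> = (\<Sum>\<rho>\<in>K. \<mu> {y \<in> carrier H. (y, \<rho>) \<in> A})"
  proof (intro sum.cong)
    fix \<rho>
    have "(\<Sum>s\<in>K. \<mu> (?P s \<rho>)) = \<mu> (\<Union>s\<in>K. ?P s \<rho>)"
      using finite_K by (intro UN_disjoint[symmetric]) auto
    also have "(\<Union>s\<in>K. ?P s \<rho>) = {y \<in> carrier H. (y, \<rho>) \<in> A}"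
      using r by auto
    finally show "(\<Sum>s\<in>K. \<mu> (?P s \<rho>)) = \<mu> {y \<in> carrier H. (y, \<rho>) \<in> A}" .
  qed simp
  finally show ?thesis
    by (simp add: avg_def)
qed

end

end

section \<open>The amenable action\<close>

context hnn_core_free
begin

text \<open>Finiteness of \<open>K\<close> enters twice: it bounds the number of pieces of the
  exchange maps, and it makes \<open>K <#> F\<close> finite, so that an infinite set of group
  elements cannot lie inside it.\<close>

theorem exists_amenable_faithful_highly_transitive_action:
  assumes amen: "amenable_group H" and fin_K: "finite K"
  shows "\<exists>(X :: (('a hnn_letter list set \<times> 'a hnn_letter list) + 'a \<times> 'a) set) \<phi>.
    countable X \<and> infinite X \<and> faithful_action \<Gamma> X \<phi> \<and> highly_transitive \<Gamma> X \<phi> \<and> amenable_action \<Gamma> X \<phi>"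
proof -
  obtain \<mu> where "invariant_mean H \<mu>"
    using amenable_group_invariant_mean[OF group_H amen] by blast
  then interpret averaged_mean H \<mu> K
    using subgroup_K fin_K by (intro averaged_mean.intro averaged_mean_axioms.intro)
  let ?O = "carrier H \<times> K" and ?b = "\<lambda>h (x, s). (h \<otimes> x, s)"
  have left: "free_act H (carrier H) (\<lambda>h x. h \<otimes> x)"
    by unfold_locales (auto simp: H.m_assoc)
  have b_act: "free_act H ?O ?b"
    by unfold_locales (auto simp: H.m_assoc)
  interpret b: free_act H ?O ?b by (rule b_act)
  interpret bA: free_act L ?O ?b by (rule free_act_K[OF b_act])
  interpret bB: free_act L ?O "\<lambda>k. ?b (\<theta> k)" by (rule free_act_theta[OF b_act])
  interpret b: equivariant_relation L ?O ?b "\<lambda>k. ?b (\<theta> k)" ..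
  obtain r where r: "\<forall>x\<in>carrier H. r x \<in> K" "\<forall>k\<in>K. \<forall>x\<in>carrier H. r (k \<otimes> x) = k \<otimes> r x"
    using free_act.exists_equivariant_map[OF free_act_K[OF left]] by auto
  obtain r' where r': "\<forall>x\<in>carrier H. r' x \<in> K" "\<forall>k\<in>K. \<forall>x\<in>carrier H. r' (\<theta> k \<otimes> x) = k \<otimes> r' x"
    using free_act.exists_equivariant_map[OF free_act_theta[OF left]] by auto
  have id_hom: "id \<in> hom L H"
    using K_carrier by (auto simp: hom_def)
  \<comment> \<open>\<open>f\<close> converts translation by \<open>k\<close> in the first
    coordinate into multiplication by \<open>k\<close> in the second, and \<open>g\<close> converts
    the latter into translation by \<open>\<theta> k\<close>. Hence \<open>v\<close> intertwines the
    two actions of \<open>K\<close>.\<close>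
  define f where "f = flip id r"
  define g where "g = flip \<theta> r'"
  have f: "bij_betw f ?O ?O" "\<And>A. A \<subseteq> ?O \<Longrightarrow> avg (f ` A) = avg A"
    "\<And>k x s. k \<in> K \<Longrightarrow> x \<in> carrier H \<Longrightarrow> s \<in> K \<Longrightarrow> f (k \<otimes> x, s) = (fst (f (x, s)), k \<otimes> snd (f (x, s)))"
    using flip_bij[OF id_hom, of r] avg_flip[OF id_hom, of r] flip_equivariant[OF id_hom, of r] r
    by (simp_all add: f_def)
  have g: "bij_betw g ?O ?O" "\<And>A. A \<subseteq> ?O \<Longrightarrow> avg (g ` A) = avg A"
    "\<And>k x s. k \<in> K \<Longrightarrow> x \<in> carrier H \<Longrightarrow> s \<in> K \<Longrightarrow> g (x, k \<otimes> s) = (\<theta> k \<otimes> fst (g (x, s)), snd (g (x, s)))"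
    using flip_bij[OF theta_hom, of r'] avg_flip[OF theta_hom, of r'] flip_snd_mult[OF theta_hom, of r'] r'
    by (simp_all add: g_def)
  define v where "v = g \<circ> f"
  have v_bij: "bij_betw v ?O ?O"
    unfolding v_def by (rule bij_betw_trans[OF f(1) g(1)])
  have v_closed: "v z \<in> ?O" if "z \<in> ?O" for z
    using bij_betw_apply[OF v_bij that] .
  have v_avg: "avg (v ` A) = avg A" if "A \<subseteq> ?O" for A
  proof -
    have "f ` A \<subseteq> ?O"
      using that f(1) bij_betw_imp_surj_on by blast
    then show ?thesis
      using g(2)[of "f ` A"] f(2)[OF that] by (simp add: v_def image_comp)
  qed
  have v_equiv: "v (?b k z) = ?b (\<theta> k) (v z)" if k: "k \<in> K" and z_mem: "z \<in> ?O" for k z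
  proof -
    obtain x s where z: "z = (x, s)" "x \<in> carrier H" "s \<in> K"
      using z_mem by blast
    obtain y t where y: "f (x, s) = (y, t)" by fastforce
    moreover have "f (x, s) \<in> ?O"
      using bij_betw_apply[OF f(1)] z by blast
    ultimately have "y \<in> carrier H" "t \<in> K" by simp_all
    then have "v (?b k z) = (\<theta> k \<otimes> fst (g (y, t)), snd (g (y, t)))"
      using f(3)[OF k z(2,3)] g(3)[OF k] y by (simp add: v_def z(1))
    then show ?thesis
      by (simp add: v_def z(1) y split_beta)
  qed
  obtain S where S: "infinite S" "S \<subseteq> carrier H" "\<mu> S = 0"
    using exists_infinite_null_set[OF infinite_H finite_null[OF infinite_H]] by blast
  \<comment> \<open>\<open>U\<close> is kept out of domain and range of \<open>Q\<close>. It is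
    null, yet meets every H-orbit, which has the form \<open>carrier H \<times> {s}\<close>, in
    infinitely many points.\<close>
  define U where "U = S \<times> K"
  have U: "U \<subseteq> ?O"
    using S by (auto simp: U_def)
  have U_null: "avg U = 0"
  proof -
    have "{x \<in> carrier H. (x, s) \<in> U} = S" if "s \<in> K" for s
      using that S by (auto simp: U_def)
    then show ?thesis
      using S(3) by (simp add: avg_def)
  qed
  \<comment> \<open>Saturations of \<open>U\<close> under the two actions of \<open>K\<close>:
    finite unions of translates, hence null.\<close>
  define D where "D = (\<Union>k\<in>K. ?b k ` U)"
  define R where "R = (\<Union>k\<in>K. ?b (\<theta> k) ` U)"
  have D: "D \<subseteq> ?O" "avg D = 0"
  proof -
    have sub: "?b k ` U \<subseteq> ?O" if "k \<in> K" for k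
      using U that K_carrier by auto
    then show "D \<subseteq> ?O"
      unfolding D_def by blast
    have "avg (?b k ` U) = 0" if "k \<in> K" for k
      using avg_translate[OF K_carrier[OF that] U] U_null by simp
    then show "avg D = 0"
      unfolding D_def using sub by (intro avg.UN_null fin_K)
  qed
  have R: "R \<subseteq> ?O" "avg R = 0"
  proof -
    have sub: "?b (\<theta> k) ` U \<subseteq> ?O" if "k \<in> K" for k
      using U that theta_carrier by auto
    then show "R \<subseteq> ?O"
      unfolding R_def by blast
    have "avg (?b (\<theta> k) ` U) = 0" if "k \<in> K" for k
      using avg_translate[OF theta_carrier[OF that] U] U_null by simp
    then show "avg R = 0"
      unfolding R_def using sub by (intro avg.UN_null fin_K)
  qed
  have D_eq: "D = bA.orb U" and R_eq: "R = bB.orb U"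
    by (auto simp: D_def R_def bA.orb_def bB.orb_def)
  \<comment> \<open>Removing \<open>D\<close> frees \<open>U\<close> from the domain, removing the
    preimage of \<open>R\<close> frees it from the range. Both sets are \<open>K\<close>-invariant,
    so \<open>v\<close> remains equivariant on the rest.\<close>
  define N where "N = D \<union> {z \<in> ?O. v z \<in> R}"
  have N: "N \<subseteq> ?O"
    using D(1) by (auto simp: N_def)
  have "v ` {z \<in> ?O. v z \<in> R} \<subseteq> R"
    by auto
  then have "avg {z \<in> ?O. v z \<in> R} = 0"
    using v_avg[of "{z \<in> ?O. v z \<in> R}"] avg.null_subset[OF _ R] by simp
  then have N_null: "avg N = 0"
    using avg.subadditive[of D "{z \<in> ?O. v z \<in> R}"] avg.nonneg[OF N] D by (simp add: N_def)
  have N_sat: "?b k z \<in> N \<longleftrightarrow> z \<in> N" if k: "k \<in> K" and z: "z \<in> ?O" for k z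
  proof -
    have "?b k z \<in> D \<longleftrightarrow> z \<in> D"
      unfolding D_eq by (rule bA.act_mem_orb_iff) (use k z U in auto)
    moreover have "?b (\<theta> k) (v z) \<in> R \<longleftrightarrow> v z \<in> R"
      unfolding R_eq by (rule bB.act_mem_orb_iff) (use k v_closed[OF z] U in auto)
    moreover have "?b k z \<in> ?O"
      using k z K_carrier by auto
    ultimately show ?thesis
      using v_equiv[OF k z] z by (simp add: N_def)
  qed
  define Q where "Q = {(z, v z) | z. z \<in> ?O - N}"
  have QI: "(z, v z) \<in> Q" if "z \<in> ?O - N" for z
    using that unfolding Q_def by blast
  have Q: "b.partial_iso Q"
    unfolding b.partial_iso_def
  proof (intro conjI)
    show "Q \<subseteq> ?O \<times> ?O"
      using v_closed unfolding Q_def by blast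
    show "single_valued Q"
      unfolding Q_def single_valued_def by blast
    show "single_valued (Q\<inverse>)"
    proof (rule single_valuedI)
      fix x y z assume "(x, y) \<in> Q\<inverse>" "(x, z) \<in> Q\<inverse>"
      then have "y \<in> ?O" "z \<in> ?O" "v y = v z"
        unfolding Q_def by blast+
      then show "y = z"
        using inj_onD[OF bij_betw_imp_inj_on[OF v_bij]] by blast
    qed
    show "\<forall>(z, y)\<in>Q. \<forall>k\<in>carrier L. (?b k z, ?b (\<theta> k) y) \<in> Q"
    proof (rule ballI)
      fix p assume "p \<in> Q"
      then obtain z where p: "p = (z, v z)" and z: "z \<in> ?O - N"
        unfolding Q_def by blast
      have "(?b k z, ?b (\<theta> k) (v z)) \<in> Q" if "k \<in> carrier L" for k
      proof -
        have k: "k \<in> K"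
          using that by simp
        have "?b k z \<in> ?O - N"
          using z N_sat[OF k, of z] bA.act_closed[of k z] k by auto
        then have "(?b k z, v (?b k z)) \<in> Q"
          by (rule QI)
        moreover have "v (?b k z) = ?b (\<theta> k) (v z)"
          using z by (intro v_equiv k) blast
        ultimately show ?thesis
          by (simp only:)
      qed
      then show "case p of (z, y) \<Rightarrow> \<forall>k\<in>carrier L. (?b k z, ?b (\<theta> k) y) \<in> Q"
        unfolding p prod.case by blast
    qed
  qed
  have U_Q: "U \<inter> Domain Q = {}" "U \<inter> Range Q = {}"
  proof -
    have "U \<subseteq> D" "U \<subseteq> R"
      unfolding D_eq R_eq using bA.orb_self[OF _ U] bB.orb_self[OF _ U] by auto
    then show "U \<inter> Domain Q = {}" "U \<inter> Range Q = {}"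
      by (auto simp: Q_def N_def)
  qed
  \<comment> \<open>The elements moving \<open>z = (x, s)\<close> into \<open>U\<close> are the
    \<open>y \<otimes> inv x\<close> with \<open>y\<close> in \<open>S\<close>. They are infinitely
    many, so one lies outside the finite set \<open>J <#> F\<close>.\<close>
  have escape: "\<exists>h\<in>carrier H. h \<notin> J <#> F \<and> ?b h z \<notin> V"
    if z: "z \<in> ?O" and F: "finite F" "F \<subseteq> carrier H" and J: "finite J" "J \<subseteq> carrier H"
      and V: "U \<inter> V = {}" for z F J V
  proof -
    obtain x s where xs: "z = (x, s)" "x \<in> carrier H" "s \<in> K"
      using z by blast
    have "finite (J <#> F)"
      using F J by (simp add: set_mult_def)
    moreover have "infinite ((\<lambda>y. y \<otimes> inv x) ` S)"
    proof
      assume "finite ((\<lambda>y. y \<otimes> inv x) ` S)"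
      moreover have "inj_on (\<lambda>y. y \<otimes> inv x) S"
        using S(2) xs by (intro inj_onI) (simp add: subset_iff)
      ultimately show False
        using S(1) finite_imageD by blast
    qed
    ultimately obtain h where h: "h \<in> (\<lambda>y. y \<otimes> inv x) ` S" "h \<notin> J <#> F"
      by (meson finite_subset subsetI)
    then obtain y where y: "y \<in> S" "h = y \<otimes> inv x" by blast
    then have "h \<in> carrier H" "h \<otimes> x = y"
      using S(2) xs by (auto simp: H.m_assoc subset_iff)
    then have "?b h z \<in> U"
      using y xs by (simp add: U_def)
    then show ?thesis
      using h(2) \<open>h \<in> carrier H\<close> V by blast
  qed
  have "countable ?O"
    using countable_H fin_K by (simp add: countable_finite)
  have K_sub: "K \<subseteq> carrier H" "\<theta> ` K \<subseteq> carrier H" "finite (\<theta> ` K)"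
    using K_carrier theta_carrier fin_K by auto
  have "\<exists>(X :: (('a hnn_letter list set \<times> 'a hnn_letter list) + 'a \<times> 'a) set) \<phi>.
    countable X \<and> infinite X \<and> faithful_action \<Gamma> X \<phi> \<and> highly_transitive \<Gamma> X \<phi> \<and> Inr ` ?O \<subseteq> X \<and>
    (\<forall>h\<in>carrier H. \<forall>z\<in>?O. \<phi> (base h) (Inr z) = Inr (?b h z)) \<and>
    (\<forall>(x, y)\<in>Q. \<phi> stable (Inr x) = Inr y)"
    by (rule exists_faithful_highly_transitive_action[OF b_act \<open>countable ?O\<close> Q])
       (erule (2) escape[OF _ _ _ fin_K K_sub(1) U_Q(1)] escape[OF _ _ _ K_sub(3,2) U_Q(2)])+
  then obtain X :: "(('a hnn_letter list set \<times> 'a hnn_letter list) + 'a \<times> 'a) set" and \<phi>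
    where X: "countable X" "infinite X" "faithful_action \<Gamma> X \<phi>" "highly_transitive \<Gamma> X \<phi>" "Inr ` ?O \<subseteq> X"
      and \<phi>_base: "\<forall>h\<in>carrier H. \<forall>z\<in>?O. \<phi> (base h) (Inr z) = Inr (?b h z)"
      and \<phi>_stable: "\<forall>(x, y)\<in>Q. \<phi> stable (Inr x) = Inr y"
    by (elim exE conjE)
  interpret \<phi>: group_action \<Gamma> X \<phi>
    using X(3) by (simp add: faithful_action_def)
  interpret G: group \<Gamma> by (rule group_HNN)
  \<comment> \<open>All mass sits on the second summand.\<close>
  define \<nu> where "\<nu> A = avg {z \<in> ?O. Inr z \<in> A}" for A :: "(('a hnn_letter list set \<times> 'a hnn_letter list) + 'a \<times> 'a) set"
  have "fin_add_prob X \<nu>"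
    unfolding fin_add_prob_def
  proof (intro conjI allI impI)
    show "\<nu> A \<ge> 0" for A
      unfolding \<nu>_def by (rule avg.nonneg) blast
    have "{z \<in> ?O. Inr z \<in> X} = ?O"
      using X(5) by blast
    then show "\<nu> X = 1"
      using avg.total by (simp add: \<nu>_def)
    fix A B :: "(('a hnn_letter list set \<times> 'a hnn_letter list) + 'a \<times> 'a) set" assume "A \<inter> B = {}"
    then have "avg ({z \<in> ?O. Inr z \<in> A} \<union> {z \<in> ?O. Inr z \<in> B}) = \<nu> A + \<nu> B"
      unfolding \<nu>_def by (intro avg.additive) auto
    moreover have "{z \<in> ?O. Inr z \<in> A \<union> B} = {z \<in> ?O. Inr z \<in> A} \<union> {z \<in> ?O. Inr z \<in> B}"
      by blast
    ultimately show "\<nu> (A \<union> B) = \<nu> A + \<nu> B"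
      by (simp only: \<nu>_def)
  qed
  moreover have stable_nu: "\<nu> (\<phi> stable ` B) = \<nu> B" if B: "B \<subseteq> X" for B
  proof -
    let ?B = "{z \<in> ?O. Inr z \<in> B}" and ?C = "{z \<in> ?O. Inr z \<in> \<phi> stable ` B}"
    have vN: "v ` N \<subseteq> ?O" "avg (v ` N) = 0"
      using N v_closed v_avg[OF N] N_null by (blast, simp)
    have stable_v: "\<phi> stable (Inr z) = Inr (v z)" if "z \<in> ?O - N" for z
      using bspec[OF \<phi>_stable QI[OF that]] by simp
    have "v ` (?B - N) \<subseteq> ?C"
    proof
      fix y assume "y \<in> v ` (?B - N)"
      then obtain z where z: "z \<in> ?O - N" "Inr z \<in> B" "y = v z" by blast
      then have "Inr y = \<phi> stable (Inr z)"
        using stable_v by simp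
      then show "y \<in> ?C"
        using z v_closed[of z] by blast
    qed
    \<comment> \<open>\<open>stable\<close> may also bring points of the first summand into the
      second, but only into the null image of \<open>N\<close> under \<open>v\<close>: elsewhere
      injectivity identifies the preimage as \<open>Inr z\<close>.\<close>
    moreover have "?C \<subseteq> v ` (?B - N) \<union> v ` N"
    proof
      fix y assume y: "y \<in> ?C"
      then obtain c where c: "c \<in> B" "Inr y = \<phi> stable c" by blast
      obtain z where z: "z \<in> ?O" "y = v z"
        using y bij_betw_imp_surj_on[OF v_bij] by blast
      show "y \<in> v ` (?B - N) \<union> v ` N"
      proof (cases "z \<in> N")
        case True
        then show ?thesis using z by blast
      next
        case False
        then have "\<phi> stable (Inr z) = \<phi> stable c"
          using stable_v[of z] z c by simp
        moreover have "Inr z \<in> X" "c \<in> X"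
          using X(5) z(1) c(1) B by blast+
        ultimately have "Inr z = c"
          using \<phi>.inj_prop[OF stable_closed] by (meson inj_onD)
        then show ?thesis
          using z c False by blast
      qed
    qed
    moreover have "v ` (?B - N) \<subseteq> ?O"
      using v_closed by blast
    ultimately have "avg ?C = avg (v ` (?B - N))"
      using vN by (rule avg.eq_up_to_null)
    also have "\<dots> = avg (?B - N)"
      by (rule v_avg) blast
    also have "\<dots> = avg ?B"
      by (rule avg.eq_up_to_null[symmetric, of _ _ N]) (use N N_null in auto)
    finally show ?thesis
      by (simp only: \<nu>_def)
  qed
  moreover have "\<nu> (\<phi> \<gamma> ` A) = \<nu> A" if "\<gamma> \<in> carrier \<Gamma>" "A \<subseteq> X" for \<gamma> A
    using that
  proof (induction \<gamma> arbitrary: A rule: HNN_induct)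
    case one
    then have "\<phi> \<one>\<^bsub>\<Gamma>\<^esub> x = x" if "x \<in> A" for x
      using fun_cong[OF \<phi>.id_eq_one, of x] that by auto
    then show ?case by simp
  next
    case (base h x)
    have xA: "\<phi> x ` A \<subseteq> X"
      using base \<phi>.element_image by blast
    have "\<phi> (base h \<otimes>\<^bsub>\<Gamma>\<^esub> x) ` A = \<phi> (base h) ` \<phi> x ` A"
      using \<phi>.composition_rule[OF _ base_closed[OF base(1)] base(2)] base(4) by (force simp: image_image)
    moreover have "\<nu> (\<phi> (base h) ` B) = \<nu> B" if B: "B \<subseteq> X" for B
    proof -
      have "{z \<in> ?O. Inr z \<in> \<phi> (base h) ` B} = ?b h ` {z \<in> ?O. Inr z \<in> B}"
      proof (intro equalityI subsetI)
        fix z assume z: "z \<in> {z \<in> ?O. Inr z \<in> \<phi> (base h) ` B}"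
        then obtain c where c: "c \<in> B" "Inr z = \<phi> (base h) c" by blast
        have "z \<in> ?O"
          using z by blast
        then have z': "?b (inv h) z \<in> ?O" "?b h (?b (inv h) z) = z"
          by (rule b.act_closed[OF H.inv_closed[OF base(1)]], rule b.act_inv_right[OF base(1)])
        have "\<phi> (base h) (Inr (?b (inv h) z)) = \<phi> (base h) c"
          using bspec[OF bspec[OF \<phi>_base base(1)] z'(1)] unfolding z'(2) c(2) .
        moreover have "Inr (?b (inv h) z) \<in> X" "c \<in> X"
          using X(5) z'(1) c(1) B by blast+
        ultimately have "Inr (?b (inv h) z) = c"
          using \<phi>.inj_prop[OF base_closed[OF base(1)]] by (meson inj_onD)
        then show "z \<in> ?b h ` {z \<in> ?O. Inr z \<in> B}"
          using z' c(1) by (intro image_eqI[of _ _ "?b (inv h) z"] CollectI conjI) (simp_all only:)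
      next
        fix z assume "z \<in> ?b h ` {z \<in> ?O. Inr z \<in> B}"
        then obtain y where y: "y \<in> ?O" "Inr y \<in> B" "z = ?b h y" by blast
        then have "Inr z = \<phi> (base h) (Inr y)" "z \<in> ?O"
          using bspec[OF bspec[OF \<phi>_base base(1)] y(1)] b.act_closed[OF base(1) y(1)] by (simp_all only:)
        then show "z \<in> {z \<in> ?O. Inr z \<in> \<phi> (base h) ` B}"
          using y(2) by blast
      qed
      then show ?thesis
        unfolding \<nu>_def using avg_translate[OF base(1)] by simp
    qed
    ultimately show ?case
      using xA base by simp
  next
    case (stable x)
    have xA: "\<phi> x ` A \<subseteq> X"
      using stable \<phi>.element_image by blast
    have "\<phi> (stable \<otimes>\<^bsub>\<Gamma>\<^esub> x) ` A = \<phi> stable ` \<phi> x ` A"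
      using \<phi>.composition_rule[OF _ stable_closed stable(1)] stable(3) by (force simp: image_image)
    then show ?case
      using stable_nu[OF xA] stable by simp
  next
    case (inv_stable x)
    have xA: "\<phi> x ` A \<subseteq> X"
      using inv_stable \<phi>.element_image by blast
    \<comment> \<open>Invariance under the inverse follows by applying that of \<open>stable\<close>
      to the image set.\<close>
    let ?B = "\<phi> (inv\<^bsub>\<Gamma>\<^esub> stable \<otimes>\<^bsub>\<Gamma>\<^esub> x) ` A"
    have B: "?B \<subseteq> X"
      using inv_stable \<phi>.element_image[of "inv\<^bsub>\<Gamma>\<^esub> stable \<otimes>\<^bsub>\<Gamma>\<^esub> x"] stable_closed by blast
    have "\<phi> stable (\<phi> (inv\<^bsub>\<Gamma>\<^esub> stable \<otimes>\<^bsub>\<Gamma>\<^esub> x) y) = \<phi> x y" if "y \<in> A" for y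
    proof -
      have "stable \<otimes>\<^bsub>\<Gamma>\<^esub> (inv\<^bsub>\<Gamma>\<^esub> stable \<otimes>\<^bsub>\<Gamma>\<^esub> x) = x"
        using stable_closed inv_stable(1) by (simp flip: G.m_assoc)
      then show ?thesis
        using \<phi>.composition_rule[of y stable "inv\<^bsub>\<Gamma>\<^esub> stable \<otimes>\<^bsub>\<Gamma>\<^esub> x"] that inv_stable(1,3) stable_closed
        by auto
    qed
    then have "\<phi> stable ` ?B = \<phi> x ` A"
      unfolding image_image by (intro image_cong) auto
    then show ?case
      using stable_nu[OF B] inv_stable by simp
  qed
  ultimately have "amenable_action \<Gamma> X \<phi>"
    unfolding amenable_action_def by blast
  then show ?thesis
    using X by blast
qed

end

section \<open>Transport to the natural numbers\<close>

lemma group_action_transport: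
  assumes act: "group_action G X \<phi>" and e: "bij_betw e X E"
  defines "\<psi> \<equiv> \<lambda>g. \<lambda>n\<in>E. e (\<phi> g (inv_into X e n))"
  shows "group_action G E \<psi>"
    and "\<And>g x. x \<in> X \<Longrightarrow> \<psi> g (e x) = e (\<phi> g x)"
    and "faithful_action G X \<phi> \<Longrightarrow> faithful_action G E \<psi>"
    and "highly_transitive G X \<phi> \<Longrightarrow> highly_transitive G E \<psi>"
    and "amenable_action G X \<phi> \<Longrightarrow> amenable_action G E \<psi>"
proof -
  interpret group_action G X \<phi> by fact
  have G: "group G"
    using group_hom by (simp add: group_hom_def)
  define d where "d = inv_into X e"
  have d: "bij_betw d E X" "\<And>n. n \<in> E \<Longrightarrow> d n \<in> X" "\<And>n. n \<in> E \<Longrightarrow> e (d n) = n" "\<And>x. x \<in> X \<Longrightarrow> d (e x) = x"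
    using bij_betw_inv_into[OF e] bij_betw_inv_into_right[OF e] bij_betw_inv_into_left[OF e]
      bij_betw_apply[OF bij_betw_inv_into[OF e]] by (auto simp: d_def)
  have eE: "\<And>x. x \<in> X \<Longrightarrow> e x \<in> E"
    using bij_betw_apply[OF e] .
  have \<psi>: "\<psi> g = (\<lambda>n\<in>E. e (\<phi> g (d n)))" for g
    by (simp add: \<psi>_def d_def)
  have \<phi>_closed: "\<phi> g x \<in> X" if "g \<in> carrier G" "x \<in> X" for g x
    using element_image[OF that] by blast
  show \<psi>_e: "\<psi> g (e x) = e (\<phi> g x)" if "x \<in> X" for g x
    using that d eE by (simp add: \<psi>)
  have \<psi>_Bij: "\<psi> g \<in> Bij E" if g: "g \<in> carrier G" for g
  proof -
    have "bij_betw (e \<circ> (\<phi> g \<circ> d)) E E"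
      using bij_betw_trans[OF bij_betw_trans[OF d(1) bij_prop0[OF g, unfolded Bij_def, THEN IntD2, simplified]] e] .
    then have "bij_betw (\<psi> g) E E"
      by (rule bij_betw_cong[THEN iffD1, rotated]) (simp add: \<psi>)
    then show ?thesis
      by (simp add: Bij_def \<psi>)
  qed
  have "\<psi> (g \<otimes>\<^bsub>G\<^esub> h) = compose E (\<psi> g) (\<psi> h)" if "g \<in> carrier G" "h \<in> carrier G" for g h
  proof
    fix n
    show "\<psi> (g \<otimes>\<^bsub>G\<^esub> h) n = compose E (\<psi> g) (\<psi> h) n"
    proof (cases "n \<in> E")
      case True
      then have "\<psi> (g \<otimes>\<^bsub>G\<^esub> h) n = e (\<phi> g (\<phi> h (d n)))"
        using composition_rule[OF d(2)[OF True] that] by (simp add: \<psi>)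
      also have "\<dots> = \<psi> g (\<psi> h n)"
        using \<psi>_e[OF \<phi>_closed[OF that(2) d(2)[OF True]], of g] True by (simp add: \<psi>[of h])
      finally show ?thesis
        using True by (simp add: compose_def)
    qed (simp add: \<psi> compose_def)
  qed
  then have "\<psi> \<in> hom G (BijGroup E)"
    using \<psi>_Bij by (simp add: hom_def BijGroup_def)
  then show act': "group_action G E \<psi>"
    using G group_BijGroup by (simp add: group_action_def group_hom_def group_hom_axioms_def)
  show "faithful_action G E \<psi>" if "faithful_action G X \<phi>"
  proof -
    have "g = \<one>\<^bsub>G\<^esub>" if g: "g \<in> carrier G" "\<forall>n\<in>E. \<psi> g n = n" for g
    proof -
      have "\<phi> g x = x" if "x \<in> X" for x
        using g(2) \<psi>_e[OF that, of g] eE[OF that] d(4)[OF that] d(4)[OF \<phi>_closed[OF g(1) that]] by metis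
      then show ?thesis
        using \<open>faithful_action G X \<phi>\<close> g(1) by (simp add: faithful_action_iff)
    qed
    then show ?thesis
      using act' by (simp add: faithful_action_iff)
  qed
  show "highly_transitive G E \<psi>" if ht: "highly_transitive G X \<phi>"
    unfolding highly_transitive_def
  proof (intro allI impI)
    fix n :: nat and x y
    assume n: "n \<ge> 1" and xy: "\<forall>k\<in>{1..n}. x k \<in> E \<and> y k \<in> E" "inj_on x {1..n}" "inj_on y {1..n}"
    have "inj_on d E"
      using d(1) bij_betw_imp_inj_on by blast
    then have "inj_on (\<lambda>k. d (x k)) {1..n}" "inj_on (\<lambda>k. d (y k)) {1..n}"
      using xy comp_inj_on[OF xy(2), of d] comp_inj_on[OF xy(3), of d] inj_on_subset[of d E]
      by (auto simp: comp_def image_subset_iff)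
    moreover have "\<forall>k\<in>{1..n}. d (x k) \<in> X \<and> d (y k) \<in> X"
      using xy d(2) by blast
    ultimately have "\<exists>g\<in>carrier G. \<forall>k\<in>{1..n}. \<phi> g (d (x k)) = d (y k)"
      using n ht[unfolded highly_transitive_def, THEN spec[of _ n], THEN spec[of _ "\<lambda>k. d (x k)"],
          THEN spec[of _ "\<lambda>k. d (y k)"]] by simp
    then obtain g where g: "g \<in> carrier G" "\<forall>k\<in>{1..n}. \<phi> g (d (x k)) = d (y k)"
      by blast
    then have "\<forall>k\<in>{1..n}. \<psi> g (x k) = y k"
      using xy(1) d(3) by (simp add: \<psi>)
    then show "\<exists>g\<in>carrier G. \<forall>k\<in>{1..n}. \<psi> g (x k) = y k"
      using g(1) by blast
  qed
  show "amenable_action G E \<psi>" if "amenable_action G X \<phi>"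
  proof -
    obtain \<mu> where \<mu>: "fin_add_prob X \<mu>" "\<And>g A. g \<in> carrier G \<Longrightarrow> A \<subseteq> X \<Longrightarrow> \<mu> (\<phi> g ` A) = \<mu> A"
      using \<open>amenable_action G X \<phi>\<close> unfolding amenable_action_def by blast
    have dX: "d ` A \<subseteq> X" if "A \<subseteq> E" for A
      using that d(2) by blast
    have "d ` A \<inter> d ` B = {}" if "A \<subseteq> E" "B \<subseteq> E" "A \<inter> B = {}" for A B
      using inj_on_image_Int[OF bij_betw_imp_inj_on[OF d(1)] that(1,2)] that(3) by simp
    then have "fin_add_prob E (\<lambda>A. \<mu> (d ` A))"
      using \<mu>(1) dX unfolding fin_add_prob_def bij_betw_imp_surj_on[OF d(1)] image_Un by meson
    moreover have "\<mu> (d ` \<psi> g ` A) = \<mu> (d ` A)" if "g \<in> carrier G" "A \<subseteq> E" for g A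
    proof -
      have "d ` \<psi> g ` A = (\<lambda>n. \<phi> g (d n)) ` A"
        unfolding image_image
      proof (rule image_cong)
        fix n assume "n \<in> A"
        then have "n \<in> E"
          using that(2) by blast
        then show "d (\<psi> g n) = \<phi> g (d n)"
          using d(4)[OF \<phi>_closed[OF that(1) d(2)], of n] by (simp add: \<psi>)
      qed simp
      then show ?thesis
        using \<mu>(2)[OF that(1) dX[OF that(2)]] by (simp add: image_image)
    qed
    ultimately show ?thesis
      unfolding amenable_action_def by blast
  qed
qed

lemma exists_nat_action:
  assumes "countable X" "infinite X" "faithful_action G X \<phi>" "highly_transitive G X \<phi>"
  shows "\<exists>\<psi>. faithful_action G (UNIV :: nat set) \<psi> \<and> highly_transitive G (UNIV :: nat set) \<psi> \<and>
           (amenable_action G X \<phi> \<longrightarrow> amenable_action G (UNIV :: nat set) \<psi>)"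
proof -
  have "group_action G X \<phi>"
    using assms(3) by (simp add: faithful_action_def)
  note transport = group_action_transport[OF this to_nat_on_infinite[OF assms(1,2)]]
  show ?thesis
    using transport(3)[OF assms(3)] transport(4)[OF assms(4)] transport(5) by blast
qed

text \<open>The auxiliary summand is taken empty, with the empty partial bijection;
  \<open>unit\<close> only fixes its type.\<close>

lemma (in hnn_core_free) exists_faithful_highly_transitive_nat_action:
  "\<exists>\<psi>. faithful_action \<Gamma> (UNIV :: nat set) \<psi> \<and> highly_transitive \<Gamma> (UNIV :: nat set) \<psi>"
proof -
  have act: "free_act H {} (\<lambda>_ z. z)"
    by unfold_locales auto
  interpret A: free_act L "{}" "\<lambda>_ z. z" by (rule free_act_K[OF act])
  interpret equivariant_relation L "{}" "\<lambda>_ z. z" "\<lambda>_ z. z" ..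
  have "partial_iso {}"
    by (simp add: partial_iso_def)
  then have "\<exists>(X :: (('a hnn_letter list set \<times> 'a hnn_letter list) + unit) set) \<phi>.
      countable X \<and> infinite X \<and> faithful_action \<Gamma> X \<phi> \<and> highly_transitive \<Gamma> X \<phi> \<and> Inr ` {} \<subseteq> X \<and>
      (\<forall>h\<in>carrier H. \<forall>z\<in>{}. \<phi> (base h) (Inr z) = Inr z) \<and>
      (\<forall>(x, y)\<in>{}. \<phi> stable (Inr x) = Inr y)"
    by (rule exists_faithful_highly_transitive_action[OF act countable_empty]) (simp_all only: empty_iff)
  then obtain X :: "(('a hnn_letter list set \<times> 'a hnn_letter list) + unit) set" and \<phi>
    where "countable X" "infinite X" "faithful_action \<Gamma> X \<phi>" "highly_transitive \<Gamma> X \<phi>"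
    by (elim exE conjE)
  then show ?thesis
    using exists_nat_action[of X \<Gamma> \<phi>] by blast
qed

lemma (in hnn_core_free) exists_amenable_faithful_highly_transitive_nat_action:
  assumes "amenable_group H" "finite K"
  shows "\<exists>\<psi>. faithful_action \<Gamma> (UNIV :: nat set) \<psi> \<and> highly_transitive \<Gamma> (UNIV :: nat set) \<psi> \<and>
           amenable_action \<Gamma> (UNIV :: nat set) \<psi>"
proof -
  obtain X :: "(('a hnn_letter list set \<times> 'a hnn_letter list) + 'a \<times> 'a) set" and \<phi>
    where "countable X" "infinite X" "faithful_action \<Gamma> X \<phi>" "highly_transitive \<Gamma> X \<phi>"
      "amenable_action \<Gamma> X \<phi>"
    using exists_amenable_faithful_highly_transitive_action[OF assms] by blast
  then show ?thesis
    using exists_nat_action[of X \<Gamma> \<phi>] by blast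
qed

theorem theorem2p2:
  fixes H :: "('a, 'b) monoid_scheme" and \<Sigma> :: "'a set" and \<theta> :: "'a \<Rightarrow> 'a"
  assumes "group H" and "infinite (carrier H)" and "countable (carrier H)"
    and "subgroup \<Sigma> H"
    and "\<theta> \<in> hom (H\<lparr>carrier := \<Sigma>\<rparr>) H" and "inj_on \<theta> \<Sigma>"
    and "highly_core_free H \<Sigma>" and "highly_core_free H (\<theta> ` \<Sigma>)"
  shows "(\<exists>(E :: nat set) \<phi>. infinite E \<and>
            faithful_action (HNN H \<Sigma> \<theta>) E \<phi> \<and>
            highly_transitive (HNN H \<Sigma> \<theta>) E \<phi>) \<and>
         (amenable_group H \<and> finite \<Sigma> \<longrightarrow>
           (\<exists>(E :: nat set) \<phi>. infinite E \<and>
              faithful_action (HNN H \<Sigma> \<theta>) E \<phi> \<and>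
              highly_transitive (HNN H \<Sigma> \<theta>) E \<phi> \<and>
              amenable_action (HNN H \<Sigma> \<theta>) E \<phi>))"
proof -
  interpret hnn_core_free H \<Sigma> \<theta>
    using assms by (intro hnn_core_free.intro hnn_data.intro hnn_core_free_axioms.intro)
  show ?thesis
    using exists_faithful_highly_transitive_nat_action
      exists_amenable_faithful_highly_transitive_nat_action infinite_UNIV_nat by blast
qed

end
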